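(* Let $k\in\mathbb{N}$ and let $\lambda_1,\dots,\lambda_s,\mu_1,\dots,\mu_t\in\mathbb{Z}\setminus\{0\}$ with $\lambda_1+\dots+\lambda_s=0$. For every $\eta,\delta>0$ and $M\in\mathbb{N}$ there exist $N_0\in\mathbb{N}$ and $c_0>0$ such that for every $N\ge N_0$ the following holds. If $A\subseteq[N]$ with $|A|\ge\delta N$ and $B$ is $M$-homogeneous in $S(N^{1/k};N^\eta)$, then there are at least $c_0N^{s+\frac tk-1}$ tuples $(x,y)\in A^s\times B^t$ satisfying $$\lambda_1x_1+\dots+\lambda_sx_s=\mu_1y_1^k+\dots+\mu_ty_t^k.$$
   Context: $[N]=\{1,\dots,\lfloor N\rfloor\}$. $S(Y;R)=\{n\in[Y]:\ p\mid n,\ p\text{ prime}\implies p\le R\}$. For $q\in\mathbb{N}$, $q\cdot[M]=\{q,\dots,Mq\}$. A set $B$ is $M$-homogeneous in $S\subseteq\mathbb{N}$ if $B\cap q\cdot[M]\ne\emptyset$ for every $q\in\mathbb{N}$ with $q\cdot[M]\subseteq S$ ($B$ need not be contained in $S$). *)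

theory Defs
  imports Complex_Main "HOL-Library.FuncSet" "HOL-Computational_Algebra.Primes"
begin

text \<open>Throughout, the natural numbers of the source are the positive integers.\<close>

definition initial_segment :: "real \<Rightarrow> nat set" where
  "initial_segment X = {1..nat \<lfloor>X\<rfloor>}"

definition smooth_numbers :: "real \<Rightarrow> real \<Rightarrow> nat set" where
  "smooth_numbers Y R =
     {n \<in> initial_segment Y. \<forall>p. prime p \<longrightarrow> p dvd n \<longrightarrow> real p \<le> R}"

definition homogeneous_progression :: "nat \<Rightarrow> nat \<Rightarrow> nat set" where
  "homogeneous_progression q M = (\<lambda>m. q * m) ` {1..M}"

definition homogeneous_in :: "nat \<Rightarrow> nat set \<Rightarrow> nat set \<Rightarrow> bool" where
  "homogeneous_in M S B \<longleftrightarrow>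
     (\<forall>q\<ge>1. homogeneous_progression q M \<subseteq> S \<longrightarrow> B \<inter> homogeneous_progression q M \<noteq> {})"

definition solutions ::
  "nat \<Rightarrow> nat \<Rightarrow> nat \<Rightarrow> (nat \<Rightarrow> int) \<Rightarrow> (nat \<Rightarrow> int) \<Rightarrow> nat set \<Rightarrow> nat set
     \<Rightarrow> ((nat \<Rightarrow> nat) \<times> (nat \<Rightarrow> nat)) set" where
  "solutions k s t l \<mu> A B =
     {(x, y). x \<in> {1..s} \<rightarrow>\<^sub>E A \<and> y \<in> {1..t} \<rightarrow>\<^sub>E B \<and>
        (\<Sum>i=1..s. l i * int (x i)) = (\<Sum>j=1..t. \<mu> j * int (y j) ^ k)}"

text \<open>The solution set may be infinite, because \<open>B\<close> may be infinite and the coefficients \<open>\<mu>\<close>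
  may have mixed signs; \<open>card\<close> would then be \<open>0\<close>, so this case is included explicitly.\<close>

definition at_least_many :: "real \<Rightarrow> 'a set \<Rightarrow> bool" where
  "at_least_many c X \<longleftrightarrow> infinite X \<or> c \<le> real (card X)"

end

theory Submission
  imports Defs "HOL-Analysis.Analysis"
begin

text \<open>Write \<open>y\<^sub>j = q\<^sub>j n m\<^sub>j\<close> with \<open>q\<^sub>j\<close> smooth. Homogeneity supplies some \<open>m\<^sub>j \<le> M\<close> with \<open>y\<^sub>j \<in> B\<close>, so it is
  enough to find, for every tuple \<open>q\<close>, one bounded \<open>n\<close> such that \<open>\<Sum>\<lambda>\<^sub>i x\<^sub>i = z\<^sub>m n\<^sup>k\<close> has a positive proportion of
  solutions in \<open>A\<close> for all \<open>m \<in> [M]\<^sup>t\<close> at once, where \<open>z\<^sub>m = \<Sum>\<mu>\<^sub>j (q\<^sub>j m\<^sub>j)\<^sup>k\<close>. Since smooth numbers have positive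
  density and only boundedly many \<open>q\<close> lead to the same \<open>y\<close>, this produces enough solutions.

  The finitely many equations are merged into one equation \<open>\<Sum>\<lambda>\<^sub>i x\<^sub>i = Z n\<^sup>k\<close> by reading tuples of elements of \<open>A\<close>
  as digits. Modulo a slightly larger integer, the normalised number of solutions of \<open>\<Sum>\<lambda>\<^sub>i x\<^sub>i = Z m\<close> is the
  Fourier transform, as a function of \<open>m\<close>, of a measure of total variation at most 1. Its averages over
  \<open>m = W \<Sum>\<lambda>\<^sub>i h\<^sub>i\<close> with \<open>h\<^sub>i \<le> H\<close> are bounded below by Roth's theorem (proved through cycle removal), applied to
  the set of starting points of progressions on which \<open>A\<close> is dense. By Weyl's inequality the exponential sums
  over \<open>m = (W n)\<^sup>k\<close> differ from those box averages only on an annulus of rational neighbourhoods, and choosing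
  among many scales one finds an annulus of small mass. Hence the averages over powers are positive too.\<close>

section \<open>Regularity for functions on pairs\<close>

text \<open>The integer \<open>n\<close> has to be fixed before homogeneity is applied to the
  progressions \<open>q_j n [M]\<close>, and there is no control over which multipliers
  \<open>m_j\<close> are returned. Hence recurrence is needed for all \<open>M^t\<close> right-hand
  sides with one common \<open>n\<close>. Merging the equations loses nothing in order of magnitude:
  each has trivially at most \<open>N^(s-1)\<close> solutions, so a lower bound of the right order
  for the product of the counts bounds every factor from below. Powers are compared with the values
  W * (lam_0 h_0 + ... ) because these belong to the linear form itself: shifting x_l by W h_l
  reduces their average to the homogeneous equation, uniformly in W and H. On the side of the
  powers, W clears the bounded denominators at which Weyl sums fail to cancel. Regularity is needed
  in its strong form because the cut-norm error must be small against the squared relative size of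
  the cells, which depends on their number.\<close>

definition cond_avg :: "'x set \<Rightarrow> ('x \<Rightarrow> 'c) \<Rightarrow> ('x \<Rightarrow> real) \<Rightarrow> 'x \<Rightarrow> real" where
  "cond_avg X c f x = (\<Sum>y | y \<in> X \<and> c y = c x. f y) / real (card {y \<in> X. c y = c x})"

lemma cond_avg_cong: "c x = c y \<Longrightarrow> cond_avg X c f x = cond_avg X c f y"
  by (simp add: cond_avg_def)

text \<open>Averaging over cells is self-adjoint: once the sums are exchanged, the weights that a
  point \<open>y\<close> receives from its cell add up to 1.\<close>

lemma sum_cond_avg_mult:
  assumes "finite X" and h: "\<And>x y. x \<in> X \<Longrightarrow> y \<in> X \<Longrightarrow> c x = c y \<Longrightarrow> h x = h y"
  shows "(\<Sum>x\<in>X. cond_avg X c f x * h x) = (\<Sum>x\<in>X. f x * h x)"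
proof -
  let ?n = "\<lambda>x. real (card {y \<in> X. c y = c x})"
  have "(\<Sum>x\<in>X. cond_avg X c f x * h x) = (\<Sum>x\<in>X. \<Sum>y\<in>X. if c y = c x then f y * (h x / ?n x) else 0)"
    using assms(1) by (intro sum.cong refl)
      (simp add: cond_avg_def sum.inter_filter[symmetric] sum_divide_distrib sum_distrib_right)
  also have "\<dots> = (\<Sum>y\<in>X. \<Sum>x\<in>X. if c y = c x then f y * (h x / ?n x) else 0)"
    by (rule sum.swap)
  also have "\<dots> = (\<Sum>y\<in>X. f y * h y)"
  proof (intro sum.cong refl)
    fix y assume y: "y \<in> X"
    have pos: "card {z \<in> X. c z = c y} > 0"
      using y assms(1) by (auto simp: card_gt_0_iff)
    have "(\<Sum>x\<in>X. if c y = c x then f y * (h x / ?n x) else 0)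
        = (\<Sum>x\<in>{z \<in> X. c z = c y}. f y * (h y / ?n y))"
      unfolding sum.inter_filter[OF assms(1)]
    proof (intro sum.cong refl if_cong)
      fix x assume "x \<in> X" "c x = c y"
      then show "f y * (h x / ?n x) = f y * (h y / ?n y)" using h[OF _ y] by simp
    qed auto
    also have "\<dots> = f y * h y" using pos by simp
    finally show "(\<Sum>x\<in>X. if c y = c x then f y * (h x / ?n x) else 0) = f y * h y" .
  qed
  finally show ?thesis .
qed

lemma cond_avg_nonneg: "(\<And>x. x \<in> X \<Longrightarrow> 0 \<le> f x) \<Longrightarrow> 0 \<le> cond_avg X c f x"
  unfolding cond_avg_def by (intro divide_nonneg_nonneg sum_nonneg) auto

lemma cond_avg_le_1:
  assumes "\<And>x. x \<in> X \<Longrightarrow> f x \<le> 1"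
  shows "cond_avg X c f x \<le> 1"
proof -
  have "(\<Sum>y | y \<in> X \<and> c y = c x. f y) \<le> (\<Sum>y | y \<in> X \<and> c y = c x. 1)"
    using assms by (intro sum_mono) auto
  then show ?thesis unfolding cond_avg_def by (cases "card {y \<in> X. c y = c x} = 0") (auto simp: divide_le_eq_1)
qed

text \<open>Pythagoras for nested partitions. The coarse average is constant on the fine cells, so
  both averages have the same inner product with it as \<open>f\<close>, which evaluates the cross
  term.\<close>

lemma sum_cond_avg_diff_square:
  assumes "finite X" and ref: "\<And>x y. x \<in> X \<Longrightarrow> y \<in> X \<Longrightarrow> c' x = c' y \<Longrightarrow> c x = c y"
  shows "(\<Sum>x\<in>X. (cond_avg X c' f x - cond_avg X c f x)\<^sup>2)
       = (\<Sum>x\<in>X. (cond_avg X c' f x)\<^sup>2) - (\<Sum>x\<in>X. (cond_avg X c f x)\<^sup>2)"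
proof -
  let ?g = "cond_avg X c f" and ?g' = "cond_avg X c' f"
  have "(\<Sum>x\<in>X. ?g' x * ?g x) = (\<Sum>x\<in>X. f x * ?g x)"
    using ref by (intro sum_cond_avg_mult[OF assms(1)] cond_avg_cong)
  also have "\<dots> = (\<Sum>x\<in>X. ?g x * ?g x)"
    by (intro sum_cond_avg_mult[OF assms(1), symmetric] cond_avg_cong)
  finally have "(\<Sum>x\<in>X. ?g' x * ?g x) = (\<Sum>x\<in>X. (?g x)\<^sup>2)" by (simp add: power2_eq_square)
  then show ?thesis
    by (simp add: power2_diff sum.distrib sum_subtractf sum_distrib_left[symmetric] mult.assoc)
qed

section \<open>Partitions generated by lists of sets, cut norm and energy\<close>

definition atom_of :: "'a set list \<Rightarrow> 'a \<Rightarrow> bool list" where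
  "atom_of Ss v = map (\<lambda>S. v \<in> S) Ss"

text \<open>The first component is a colour: \<open>s\<close> bipartite graphs on copies of
  \<open>V\<close> are treated as one function and share a single vertex partition.\<close>

definition pair_atom :: "'a set list \<Rightarrow> nat \<times> 'a \<times> 'a \<Rightarrow> nat \<times> bool list \<times> bool list" where
  "pair_atom Ss = (\<lambda>(l, v, w). (l, atom_of Ss v, atom_of Ss w))"

definition edge_avg :: "nat \<Rightarrow> 'a set \<Rightarrow> (nat \<times> 'a \<times> 'a \<Rightarrow> real) \<Rightarrow> 'a set list \<Rightarrow> nat \<times> 'a \<times> 'a \<Rightarrow> real" where
  "edge_avg s V f Ss = cond_avg ({..<s} \<times> V \<times> V) (pair_atom Ss) f"

text \<open>Smallness of the normalised cut norm in every colour. It tests rectangles only, which is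
  why a failure can be repaired by adding two sets to the partition.\<close>

definition cut_close :: "real \<Rightarrow> nat \<Rightarrow> 'a set \<Rightarrow> (nat \<times> 'a \<times> 'a \<Rightarrow> real) \<Rightarrow> (nat \<times> 'a \<times> 'a \<Rightarrow> real) \<Rightarrow> bool" where
  "cut_close e s V f g \<longleftrightarrow> (\<forall>l<s. \<forall>S\<subseteq>V. \<forall>T\<subseteq>V.
     \<bar>\<Sum>v\<in>S. \<Sum>w\<in>T. f (l, v, w) - g (l, v, w)\<bar> \<le> e * (real (card V))\<^sup>2)"

definition energy :: "nat \<Rightarrow> 'a set \<Rightarrow> (nat \<times> 'a \<times> 'a \<Rightarrow> real) \<Rightarrow> 'a set list \<Rightarrow> real" where
  "energy s V f Ss = (\<Sum>x\<in>{..<s} \<times> V \<times> V. (edge_avg s V f Ss x)\<^sup>2)"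

lemma pair_atom_append:
  "pair_atom (Us @ Ss) x = pair_atom (Us @ Ss) y \<Longrightarrow> pair_atom Ss x = pair_atom Ss y"
  by (auto simp: pair_atom_def atom_of_def split: prod.splits)

lemma energy_append:
  assumes "finite V"
  shows "(\<Sum>x\<in>{..<s} \<times> V \<times> V. (edge_avg s V f (Us @ Ss) x - edge_avg s V f Ss x)\<^sup>2)
     = energy s V f (Us @ Ss) - energy s V f Ss"
  unfolding energy_def edge_avg_def
  by (rule sum_cond_avg_diff_square) (use assms pair_atom_append in auto)

lemma energy_le:
  assumes "finite V" and "\<And>x. 0 \<le> f x" "\<And>x. f x \<le> 1"
  shows "energy s V f Ss \<le> real s * (real (card V))\<^sup>2"
proof -
  have "energy s V f Ss \<le> (\<Sum>x\<in>{..<s} \<times> V \<times> V. 1)"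
    unfolding energy_def edge_avg_def
    by (intro sum_mono power_le_one cond_avg_nonneg cond_avg_le_1 assms)
  also have "\<dots> = real s * (real (card V))\<^sup>2"
    by (simp add: card_cartesian_product power2_eq_square)
  finally show ?thesis .
qed

lemma energy_nonneg: "energy s V f Ss \<ge> 0"
  unfolding energy_def by (intro sum_nonneg) auto

text \<open>A rectangle S x T on which \<open>f\<close> and its cell average differ becomes a union
  of cells when \<open>S\<close> and \<open>T\<close> join the list. The refined average reproduces
  the sum of \<open>f\<close> there, so the two averages differ on the rectangle and, by
  Cauchy-Schwarz, in square mean; that square is the gain in energy.\<close>

lemma energy_increment:
  assumes V: "finite V" "V \<noteq> {}" and e: "e > 0" and n: "\<not> cut_close e s V f (edge_avg s V f Ss)"
  shows "\<exists>S T. energy s V f ([S, T] @ Ss) \<ge> energy s V f Ss + e\<^sup>2 * (real (card V))\<^sup>2"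
proof -
  obtain l S T where l: "l < s" and S: "S \<subseteq> V" and T: "T \<subseteq> V" and
    big: "\<bar>\<Sum>v\<in>S. \<Sum>w\<in>T. f (l, v, w) - edge_avg s V f Ss (l, v, w)\<bar> > e * (real (card V))\<^sup>2"
    using n unfolding cut_close_def by (auto simp: not_le)
  define X where "X = {..<s} \<times> V \<times> V"
  define h where "h = (\<lambda>x::nat \<times> 'a \<times> 'a. of_bool (fst x = l \<and> fst (snd x) \<in> S \<and> snd (snd x) \<in> T) :: real)"
  let ?g = "edge_avg s V f Ss" and ?g' = "edge_avg s V f ([S, T] @ Ss)"
  have fX: "finite X" using V by (simp add: X_def)
  have sub: "{l} \<times> S \<times> T \<subseteq> X" using l S T by (auto simp: X_def)
  have sumh: "(\<Sum>x\<in>X. F x * h x) = (\<Sum>v\<in>S. \<Sum>w\<in>T. F (l, v, w))" for F :: "nat \<times> 'a \<times> 'a \<Rightarrow> real"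
  proof -
    have "(\<Sum>x\<in>X. F x * h x) = (\<Sum>x\<in>{l} \<times> S \<times> T. F x)"
      using sub fX by (intro sum.mono_neutral_cong_right) (auto simp: h_def)
    also have "\<dots> = (\<Sum>v\<in>S. \<Sum>w\<in>T. F (l, v, w))"
      by (simp add: sum.cartesian_product')
    finally show ?thesis .
  qed
  have "(\<Sum>x\<in>X. ?g' x * h x) = (\<Sum>x\<in>X. f x * h x)"
    unfolding edge_avg_def X_def
    by (rule sum_cond_avg_mult) (use V in \<open>auto simp: h_def pair_atom_def atom_of_def\<close>)
  then have eq: "(\<Sum>v\<in>S. \<Sum>w\<in>T. f (l, v, w) - ?g (l, v, w)) = (\<Sum>x\<in>X. (?g' x - ?g x) * h x)"
    unfolding left_diff_distrib sum_subtractf sumh[symmetric] by simp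
  have "(e * (real (card V))\<^sup>2)\<^sup>2 \<le> (\<Sum>x\<in>X. (?g' x - ?g x) * h x)\<^sup>2"
    using big e unfolding eq by (intro abs_le_square_iff[THEN iffD1]) (simp only: abs_mult abs_power2 abs_of_pos abs_of_nat power_even_abs)
  also have "\<dots> \<le> (\<Sum>x\<in>X. (?g' x - ?g x)\<^sup>2) * (\<Sum>x\<in>X. (h x)\<^sup>2)"
    by (rule Cauchy_Schwarz_ineq_sum)
  also have "\<dots> \<le> (\<Sum>x\<in>X. (?g' x - ?g x)\<^sup>2) * (real (card V))\<^sup>2"
  proof (rule mult_left_mono)
    have "(\<Sum>x\<in>X. (h x)\<^sup>2) = (\<Sum>x\<in>X. 1 * h x)"
      by (intro sum.cong) (auto simp: h_def)
    also have "\<dots> = real (card S) * real (card T)" unfolding sumh by simp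
    also have "\<dots> \<le> (real (card V))\<^sup>2"
      unfolding power2_eq_square by (intro mult_mono) (use S T V card_mono in auto)
    finally show "(\<Sum>x\<in>X. (h x)\<^sup>2) \<le> (real (card V))\<^sup>2" .
  qed (auto intro: sum_nonneg)
  also have "(\<Sum>x\<in>X. (?g' x - ?g x)\<^sup>2) = energy s V f ([S, T] @ Ss) - energy s V f Ss"
    unfolding X_def by (rule energy_append[OF V(1)])
  finally have "e\<^sup>2 * (real (card V))\<^sup>2 * (real (card V))\<^sup>2 \<le> (energy s V f ([S, T] @ Ss) - energy s V f Ss) * (real (card V))\<^sup>2"
    by (simp add: power_mult_distrib power2_eq_square mult_ac)
  moreover have "(real (card V))\<^sup>2 > 0" using V by (simp add: card_gt_0_iff)
  ultimately have "e\<^sup>2 * (real (card V))\<^sup>2 \<le> energy s V f ([S, T] @ Ss) - energy s V f Ss"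
    by (simp only: mult_le_cancel_right_pos)
  then show ?thesis by (intro exI[of _ S] exI[of _ T]) linarith
qed

text \<open>Each failure adds two sets and raises the energy by e^2 |V|^2, while the energy never
  exceeds s |V|^2. The given partition \<open>Ss\<close> is merely refined, so the lemma can be
  iterated.\<close>

lemma weak_regularity:
  assumes V: "finite V" "V \<noteq> {}" and e: "e > 0" and f: "\<And>x. 0 \<le> f x" "\<And>x. f x \<le> 1"
  shows "\<exists>Us. length Us \<le> 2 * (nat \<lceil>real s / e\<^sup>2\<rceil> + 1) \<and> cut_close e s V f (edge_avg s V f (Us @ Ss))"
proof -
  have main: "(\<exists>Us. length Us \<le> 2 * n \<and> cut_close e s V f (edge_avg s V f (Us @ Ss))) \<or>
     (\<exists>Us. length Us \<le> 2 * n \<and> energy s V f (Us @ Ss) \<ge> real n * (e\<^sup>2 * (real (card V))\<^sup>2))" for n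
  proof (induction n)
    case 0
    then show ?case using energy_nonneg[of s V f Ss] by (intro disjI2 exI[of _ "[]"]) auto
  next
    case (Suc n)
    show ?case
    proof (cases "\<exists>Us. length Us \<le> 2 * n \<and> cut_close e s V f (edge_avg s V f (Us @ Ss))")
      case True
      then show ?thesis by (intro disjI1) (metis (no_types, lifting) le_SucI mult_le_mono2 order_trans order_refl)
    next
      case False
      with Suc obtain Us where Us: "length Us \<le> 2 * n"
        "energy s V f (Us @ Ss) \<ge> real n * (e\<^sup>2 * (real (card V))\<^sup>2)" by blast
      with False have "\<not> cut_close e s V f (edge_avg s V f (Us @ Ss))" by blast
      from energy_increment[OF V e this] obtain S T where
        "energy s V f ([S, T] @ Us @ Ss) \<ge> energy s V f (Us @ Ss) + e\<^sup>2 * (real (card V))\<^sup>2" by blast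
      with Us show ?thesis
        by (intro disjI2 exI[of _ "[S, T] @ Us"]) (auto simp: algebra_simps)
    qed
  qed
  define n where "n = nat \<lceil>real s / e\<^sup>2\<rceil> + 1"
  have n: "real n > real s / e\<^sup>2" unfolding n_def by linarith
  have "real n * (e\<^sup>2 * (real (card V))\<^sup>2) > real s * (real (card V))\<^sup>2"
    using n e V by (simp add: field_simps card_gt_0_iff)
  moreover have "energy s V f (Us @ Ss) \<le> real s * (real (card V))\<^sup>2" for Us
    by (rule energy_le[OF V(1) f])
  ultimately show ?thesis using main[of n] unfolding n_def[symmetric] by (meson linorder_not_le order_trans)
qed

text \<open>Bounds the number of sets after repeated use of \<open>weak_regularity\<close>, when the
  tolerance in each round depends on the number of sets already allowed.\<close>

fun regularity_bound :: "nat \<Rightarrow> (nat \<Rightarrow> real) \<Rightarrow> nat \<Rightarrow> nat" where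
  "regularity_bound s e 0 = 0"
| "regularity_bound s e (Suc n) = regularity_bound s e n + 2 * (nat \<lceil>real s / (e (regularity_bound s e n))\<^sup>2\<rceil> + 1)"

lemma mono_regularity_bound: "m \<le> n \<Longrightarrow> regularity_bound s e m \<le> regularity_bound s e n"
  by (rule lift_Suc_mono_le) auto

text \<open>If every round of weak regularity changed the average by more than \<open>d\<close> in
  square mean, the energy would outgrow its bound; a round without such growth supplies the coarse
  partition \<open>Ss\<close> and the fine one \<open>Us @ Ss\<close>. The decisive point is that
  the tolerance \<open>e m\<close> refers to the complexity \<open>m\<close> of the coarse
  partition, while \<open>M\<close> depends neither on \<open>V\<close> nor on
  \<open>f\<close>.\<close>

lemma strong_regularity:
  fixes e :: "nat \<Rightarrow> real"
  assumes e: "\<And>m. e m > 0" and d: "d > 0"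
  shows "\<exists>M. \<forall>(V::'a set) f. finite V \<longrightarrow> V \<noteq> {} \<longrightarrow> (\<forall>x. 0 \<le> f x \<and> f x \<le> 1) \<longrightarrow>
     (\<exists>m\<le>M. \<exists>Ss Us. length Ss \<le> m \<and> cut_close (e m) s V f (edge_avg s V f (Us @ Ss)) \<and>
       (\<Sum>x\<in>{..<s} \<times> V \<times> V. (edge_avg s V f (Us @ Ss) x - edge_avg s V f Ss x)\<^sup>2) \<le> d * (real (card V))\<^sup>2)"
proof -
  define J where "J = nat \<lceil>real s / d\<rceil> + 1"
  have J: "real J > real s / d" unfolding J_def by linarith
  let ?b = "regularity_bound s e"
  have "\<exists>m\<le>?b J. \<exists>Ss Us. length Ss \<le> m \<and> cut_close (e m) s V f (edge_avg s V f (Us @ Ss)) \<and>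
       (\<Sum>x\<in>{..<s} \<times> V \<times> V. (edge_avg s V f (Us @ Ss) x - edge_avg s V f Ss x)\<^sup>2) \<le> d * (real (card V))\<^sup>2" (is ?good)
    if V: "finite V" "V \<noteq> {}" and f: "\<forall>x. 0 \<le> f x \<and> f x \<le> 1" for V :: "'a set" and f
  proof (rule ccontr)
    assume bad: "\<not> ?good"
    have "\<exists>Ss. length Ss \<le> ?b n \<and> energy s V f Ss \<ge> real n * (d * (real (card V))\<^sup>2)" if "n \<le> J" for n
      using that
    proof (induction n)
      case 0
      then show ?case using energy_nonneg[of s V f "[]"] by (intro exI[of _ "[]"]) auto
    next
      case (Suc n)
      then obtain Ss where Ss: "length Ss \<le> ?b n" "energy s V f Ss \<ge> real n * (d * (real (card V))\<^sup>2)" by auto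
      obtain Us where Us: "length Us \<le> 2 * (nat \<lceil>real s / (e (?b n))\<^sup>2\<rceil> + 1)"
        "cut_close (e (?b n)) s V f (edge_avg s V f (Us @ Ss))"
        using weak_regularity[OF V e, of f] f by blast
      have "?b n \<le> ?b J" using Suc.prems by (intro mono_regularity_bound) auto
      with bad Ss Us have "\<not> (\<Sum>x\<in>{..<s} \<times> V \<times> V. (edge_avg s V f (Us @ Ss) x - edge_avg s V f Ss x)\<^sup>2) \<le> d * (real (card V))\<^sup>2"
        by blast
      then have "energy s V f (Us @ Ss) - energy s V f Ss > d * (real (card V))\<^sup>2"
        unfolding energy_append[OF V(1)] by simp
      with Ss Us show ?case by (intro exI[of _ "Us @ Ss"]) (auto simp: algebra_simps)
    qed
    from this[of J] obtain Ss where "energy s V f Ss \<ge> real J * (d * (real (card V))\<^sup>2)" by auto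
    moreover have "energy s V f Ss \<le> real s * (real (card V))\<^sup>2"
      by (rule energy_le) (use V f in auto)
    moreover have "real J * (d * (real (card V))\<^sup>2) > real s * (real (card V))\<^sup>2"
      using J d V by (simp add: field_simps card_gt_0_iff)
    ultimately show False by linarith
  qed
  then show ?thesis by (intro exI[of _ "?b J"]) blast
qed

section \<open>Counting cycles\<close>

lemma sum_PiE_insert:
  assumes "a \<notin> S"
  shows "(\<Sum>u\<in>Pi\<^sub>E (insert a S) I. \<phi> u) = (\<Sum>r\<in>Pi\<^sub>E S I. \<Sum>x\<in>I a. \<phi> (r(a := x)))"
proof -
  have "(\<Sum>u\<in>Pi\<^sub>E (insert a S) I. \<phi> u) = (\<Sum>p\<in>I a \<times> Pi\<^sub>E S I. \<phi> ((\<lambda>(y, g). g(a := y)) p))"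
    unfolding PiE_insert_eq by (intro sum.reindex_cong[OF inj_combinator[OF assms]]) auto
  also have "\<dots> = (\<Sum>x\<in>I a. \<Sum>r\<in>Pi\<^sub>E S I. \<phi> (r(a := x)))"
    unfolding sum.cartesian_product by (intro sum.cong) auto
  also have "\<dots> = (\<Sum>r\<in>Pi\<^sub>E S I. \<Sum>x\<in>I a. \<phi> (r(a := x)))" by (rule sum.swap)
  finally show ?thesis .
qed

lemma sum_unit_weight_le:
  fixes a Y :: "'a \<Rightarrow> real"
  assumes "finite I" "\<And>v. v \<in> I \<Longrightarrow> 0 \<le> a v \<and> a v \<le> 1"
  shows "(\<Sum>v\<in>I. a v * Y v) \<le> (\<Sum>v\<in>{v \<in> I. Y v > 0}. Y v)"
  unfolding sum.inter_filter[OF assms(1)]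
proof (rule sum_mono)
  fix v assume "v \<in> I"
  then have "0 \<le> a v" "a v \<le> 1" using assms by auto
  then show "a v * Y v \<le> (if 0 < Y v then Y v else 0)"
    by (auto simp: mult_le_0_iff mult_left_le_one_le)
qed

text \<open>The expression is linear in each weight separately, so it is largest at indicators;
  replacing first \<open>a\<close> and then \<open>b\<close> by the indicator of the positive
  contributions leads to a rectangle.\<close>

lemma cut_weighted_le:
  fixes F :: "'a \<Rightarrow> 'b \<Rightarrow> real"
  assumes "finite I" "finite J" and a: "\<And>v. v \<in> I \<Longrightarrow> 0 \<le> a v \<and> a v \<le> 1"
    and b: "\<And>w. w \<in> J \<Longrightarrow> 0 \<le> b w \<and> b w \<le> 1"
    and C: "\<And>S T. S \<subseteq> I \<Longrightarrow> T \<subseteq> J \<Longrightarrow> (\<Sum>v\<in>S. \<Sum>w\<in>T. F v w) \<le> C"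
  shows "(\<Sum>v\<in>I. \<Sum>w\<in>J. a v * b w * F v w) \<le> C"
proof -
  have "(\<Sum>v\<in>I. \<Sum>w\<in>J. a v * b w * F v w) = (\<Sum>v\<in>I. a v * (\<Sum>w\<in>J. b w * F v w))"
    by (simp add: sum_distrib_left mult.assoc)
  also have "\<dots> \<le> (\<Sum>v\<in>{v \<in> I. (\<Sum>w\<in>J. b w * F v w) > 0}. \<Sum>w\<in>J. b w * F v w)" (is "_ \<le> sum _ ?S")
    by (rule sum_unit_weight_le[OF assms(1) a])
  also have "\<dots> = (\<Sum>w\<in>J. b w * (\<Sum>v\<in>?S. F v w))"
    by (subst sum.swap) (simp add: sum_distrib_left)
  also have "\<dots> \<le> (\<Sum>w\<in>{w \<in> J. (\<Sum>v\<in>?S. F v w) > 0}. \<Sum>v\<in>?S. F v w)"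
    by (rule sum_unit_weight_le[OF assms(2) b])
  also have "\<dots> \<le> C" by (subst sum.swap) (rule C; blast)
  finally show ?thesis .
qed

lemma cut_weighted_abs_le:
  fixes F :: "'a \<Rightarrow> 'b \<Rightarrow> real"
  assumes "finite I" "finite J" and a: "\<And>v. v \<in> I \<Longrightarrow> 0 \<le> a v \<and> a v \<le> 1"
    and b: "\<And>w. w \<in> J \<Longrightarrow> 0 \<le> b w \<and> b w \<le> 1"
    and C: "\<And>S T. S \<subseteq> I \<Longrightarrow> T \<subseteq> J \<Longrightarrow> \<bar>\<Sum>v\<in>S. \<Sum>w\<in>T. F v w\<bar> \<le> C"
  shows "\<bar>\<Sum>v\<in>I. \<Sum>w\<in>J. a v * b w * F v w\<bar> \<le> C"
proof -
  have "(\<Sum>v\<in>I. \<Sum>w\<in>J. a v * b w * F v w) \<le> C"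
    by (rule cut_weighted_le[OF assms(1,2) a b]) (use C in \<open>auto simp: abs_le_iff\<close>)
  moreover have "(\<Sum>v\<in>I. \<Sum>w\<in>J. a v * b w * (- F v w)) \<le> C"
    by (rule cut_weighted_le[OF assms(1,2) a b]) (use C in \<open>auto simp: abs_le_iff sum_negf\<close>)
  ultimately show ?thesis by (simp add: sum_negf abs_le_iff)
qed

lemma prod_diff_telescope:
  fixes a b :: "nat \<Rightarrow> real"
  shows "(\<Prod>i<n. a i) - (\<Prod>i<n. b i) = (\<Sum>l<n. (\<Prod>i<l. b i) * (a l - b l) * (\<Prod>i\<in>{l<..<n}. a i))"
proof (induction n)
  case (Suc n)
  have "{l<..<Suc n} = insert n {l<..<n}" if "l < n" for l using that by auto
  then have "(\<Sum>l<n. (\<Prod>i<l. b i) * (a l - b l) * (\<Prod>i\<in>{l<..<Suc n}. a i))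
    = (\<Sum>l<n. (\<Prod>i<l. b i) * (a l - b l) * (\<Prod>i\<in>{l<..<n}. a i)) * a n"
    unfolding sum_distrib_right by (intro sum.cong) auto
  also have "\<dots> = ((\<Prod>i<n. a i) - (\<Prod>i<n. b i)) * a n" using Suc by simp
  finally have *: "(\<Sum>l<n. (\<Prod>i<l. b i) * (a l - b l) * (\<Prod>i\<in>{l<..<Suc n}. a i))
    = ((\<Prod>i<n. a i) - (\<Prod>i<n. b i)) * a n" .
  have "{n<..<Suc n} = {}" by auto
  then show ?case unfolding sum.lessThan_Suc * by (simp add: algebra_simps)
qed simp

text \<open>Fix all vertices except the two ends of edge \<open>l\<close>. On a cycle of length at
  least 3 no other edge joins both ends, so the remaining factors split into a function of one end
  times a function of the other, with values in [0, 1]. The cut norm then replaces \<open>f\<close>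
  by \<open>g\<close>, and \<open>D\<close> pays for replacing \<open>g\<close> by the constant
  \<open>c l\<close>.\<close>

lemma cycle_step:
  fixes f g :: "nat \<times> 'a \<times> 'a \<Rightarrow> real" and c :: "nat \<Rightarrow> real"
  assumes s: "s \<ge> 3" and l: "l < s" and V: "finite V" and I: "\<And>l. l < s \<Longrightarrow> I l \<subseteq> V"
    and f: "\<And>x. 0 \<le> f x" "\<And>x. f x \<le> 1"
    and cut: "cut_close e s V f g"
    and g: "(\<Sum>v\<in>I l. \<Sum>w\<in>I (Suc l mod s). \<bar>g (l, v, w) - c l\<bar>) \<le> D"
  shows "\<bar>\<Sum>u\<in>Pi\<^sub>E {..<s} I. (f (l, u l, u (Suc l mod s)) - c l) * (\<Prod>i\<in>{l<..<s}. f (i, u i, u (Suc i mod s)))\<bar>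
     \<le> (e * (real (card V))\<^sup>2 + D) * (\<Prod>i\<in>{..<s} - {l, Suc l mod s}. real (card (I i)))"
proof -
  define l' where "l' = Suc l mod s"
  define R where "R = {..<s} - {l, l'}"
  have l': "l' < s" "l' \<noteq> l" using s l by (auto simp: l'_def mod_Suc)
  have sp: "{..<s} = insert l (insert l' R)" using l l' by (auto simp: R_def)
  have fin: "finite (I i)" if "i < s" for i using I[OF that] V finite_subset by blast
  let ?W = "\<lambda>u. \<Prod>i\<in>{l<..<s}. f (i, u i, u (Suc i mod s))"
  let ?\<Phi> = "\<lambda>u. (f (l, u l, u l') - c l) * ?W u"
  have bound: "\<bar>\<Sum>v\<in>I l. \<Sum>w\<in>I l'. ?\<Phi> (r(l' := w, l := v))\<bar> \<le> e * (real (card V))\<^sup>2 + D" for r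
  proof -
    \<comment> \<open>Vertex \<open>l'\<close> lies only on the edges \<open>l\<close> and
      \<open>l'\<close>, so \<open>a\<close> is free of \<open>w\<close>; \<open>b\<close> is free
      of \<open>v\<close> because edge \<open>l'\<close> does not end in \<open>l\<close>. For l = s
      - 1 both products are empty.\<close>
    define a where "a = (\<lambda>v. \<Prod>i\<in>{l<..<s} - {l'}. f (i, (r(l := v)) i, (r(l := v)) (Suc i mod s)))"
    define b where "b = (\<lambda>w. \<Prod>i\<in>{l<..<s} \<inter> {l'}. f (i, (r(l' := w)) i, (r(l' := w)) (Suc i mod s)))"
    have ab: "0 \<le> a v \<and> a v \<le> 1" "0 \<le> b w \<and> b w \<le> 1" for v w
      unfolding a_def b_def by (auto intro!: prod_nonneg prod_le_1 simp: f)
    have next_l': "Suc l' mod s \<noteq> l" using s l by (auto simp: l'_def mod_Suc)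
    have next_ne: "Suc i mod s \<noteq> l'" if "i < s" "i \<noteq> l" for i
      using that l by (auto simp: l'_def mod_Suc split: if_splits)
    have W: "?W (r(l' := w, l := v)) = a v * b w" for v w
    proof -
      have "?W (r(l' := w, l := v)) = (\<Prod>i\<in>{l<..<s} - {l'}. f (i, (r(l' := w, l := v)) i, (r(l' := w, l := v)) (Suc i mod s)))
          * (\<Prod>i\<in>{l<..<s} \<inter> {l'}. f (i, (r(l' := w, l := v)) i, (r(l' := w, l := v)) (Suc i mod s)))"
        by (subst prod.union_disjoint[symmetric]) (auto intro: prod.cong)
      also have "(\<Prod>i\<in>{l<..<s} - {l'}. f (i, (r(l' := w, l := v)) i, (r(l' := w, l := v)) (Suc i mod s))) = a v"
        unfolding a_def using next_ne by (intro prod.cong refl) auto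
      also have "(\<Prod>i\<in>{l<..<s} \<inter> {l'}. f (i, (r(l' := w, l := v)) i, (r(l' := w, l := v)) (Suc i mod s))) = b w"
        unfolding b_def using next_l' l' by (intro prod.cong refl) auto
      finally show ?thesis .
    qed
    have "(\<Sum>v\<in>I l. \<Sum>w\<in>I l'. ?\<Phi> (r(l' := w, l := v)))
        = (\<Sum>v\<in>I l. \<Sum>w\<in>I l'. a v * b w * (f (l, v, w) - g (l, v, w)))
        + (\<Sum>v\<in>I l. \<Sum>w\<in>I l'. a v * b w * (g (l, v, w) - c l))"
      unfolding sum.distrib[symmetric] W using l' by (intro sum.cong refl) (auto simp: algebra_simps)
    moreover have "\<bar>\<Sum>v\<in>I l. \<Sum>w\<in>I l'. a v * b w * (f (l, v, w) - g (l, v, w))\<bar> \<le> e * (real (card V))\<^sup>2"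
      using cut l I[OF l] I[OF l'(1)] fin l'(1)
      by (intro cut_weighted_abs_le ab) (auto simp: cut_close_def)
    moreover have "\<bar>\<Sum>v\<in>I l. \<Sum>w\<in>I l'. a v * b w * (g (l, v, w) - c l)\<bar> \<le> D"
    proof -
      have "\<bar>\<Sum>v\<in>I l. \<Sum>w\<in>I l'. a v * b w * (g (l, v, w) - c l)\<bar>
         \<le> (\<Sum>v\<in>I l. \<Sum>w\<in>I l'. \<bar>a v * b w * (g (l, v, w) - c l)\<bar>)"
        by (intro order_trans[OF sum_abs] sum_mono order_trans[OF sum_abs] order_refl)
      also have "\<dots> \<le> (\<Sum>v\<in>I l. \<Sum>w\<in>I l'. \<bar>g (l, v, w) - c l\<bar>)"
        by (intro sum_mono) (auto simp: abs_mult ab intro!: mult_left_le_one_le mult_le_one)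
      finally show ?thesis using g by (simp add: l'_def)
    qed
    ultimately show ?thesis by linarith
  qed
  have "(\<Sum>u\<in>Pi\<^sub>E {..<s} I. ?\<Phi> u) = (\<Sum>r\<in>Pi\<^sub>E R I. \<Sum>w\<in>I l'. \<Sum>v\<in>I l. ?\<Phi> (r(l' := w, l := v)))"
    unfolding sp using l' by (subst sum_PiE_insert, simp add: R_def, subst sum_PiE_insert) (simp_all add: R_def)
  also have "\<dots> = (\<Sum>r\<in>Pi\<^sub>E R I. \<Sum>v\<in>I l. \<Sum>w\<in>I l'. ?\<Phi> (r(l' := w, l := v)))"
    by (intro sum.cong refl sum.swap)
  finally have "\<bar>\<Sum>u\<in>Pi\<^sub>E {..<s} I. ?\<Phi> u\<bar> \<le> (\<Sum>r\<in>Pi\<^sub>E R I. \<bar>\<Sum>v\<in>I l. \<Sum>w\<in>I l'. ?\<Phi> (r(l' := w, l := v))\<bar>)"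
    using sum_abs by simp
  also have "\<dots> \<le> (\<Sum>r\<in>Pi\<^sub>E R I. e * (real (card V))\<^sup>2 + D)"
    by (intro sum_mono bound)
  also have "\<dots> = (e * (real (card V))\<^sup>2 + D) * (\<Prod>i\<in>R. real (card (I i)))"
    by (simp add: card_PiE R_def)
  finally show ?thesis by (simp add: l'_def R_def)
qed

text \<open>Telescoping replaces the edge factors by constants one at a time. Cells holding a
  proportion at least \<nu> of \<open>V\<close> turn the cut error e |V|^2 into an error e / \<nu>^2
  relative to a pair of cells.\<close>

lemma cycle_count_close:
  fixes f g :: "nat \<times> 'a \<times> 'a \<Rightarrow> real" and c :: "nat \<Rightarrow> real"
  assumes s: "s \<ge> 3" and V: "finite V" "V \<noteq> {}" and I: "\<And>l. l < s \<Longrightarrow> I l \<subseteq> V"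
    and \<nu>: "\<nu> > 0" and large: "\<And>l. l < s \<Longrightarrow> \<nu> * real (card V) \<le> real (card (I l))"
    and f: "\<And>x. 0 \<le> f x" "\<And>x. f x \<le> 1"
    and c: "\<And>l. l < s \<Longrightarrow> 0 \<le> c l" "\<And>l. l < s \<Longrightarrow> c l \<le> 1"
    and e: "e \<ge> 0" and cut: "cut_close e s V f g"
    and g: "\<And>l. l < s \<Longrightarrow> (\<Sum>v\<in>I l. \<Sum>w\<in>I (Suc l mod s). \<bar>g (l, v, w) - c l\<bar>)
          \<le> d * real (card (I l)) * real (card (I (Suc l mod s)))"
  shows "(\<Sum>u\<in>Pi\<^sub>E {..<s} I. \<Prod>l<s. f (l, u l, u (Suc l mod s)))
     \<ge> ((\<Prod>l<s. c l) - real s * (e / \<nu>\<^sup>2 + d)) * (\<Prod>l<s. real (card (I l)))"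
proof -
  let ?P = "\<Prod>l<s. real (card (I l))"
  let ?T = "\<lambda>u l. (f (l, u l, u (Suc l mod s)) - c l) * (\<Prod>i\<in>{l<..<s}. f (i, u i, u (Suc i mod s)))"
  have step: "\<bar>\<Sum>u\<in>Pi\<^sub>E {..<s} I. ?T u l\<bar> \<le> (e / \<nu>\<^sup>2 + d) * ?P" if l: "l < s" for l
  proof -
    define l' where "l' = Suc l mod s"
    have l': "l' < s" "l' \<noteq> l" using s l by (auto simp: l'_def mod_Suc)
    have pos: "real (card V) > 0" using V by (simp add: card_gt_0_iff)
    let ?R = "\<Prod>i\<in>{..<s} - {l, l'}. real (card (I i))"
    have P: "?P = real (card (I l)) * real (card (I l')) * ?R"
    proof -
      have "{..<s} = insert l (insert l' ({..<s} - {l, l'}))" using l l' by auto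
      then have "?P = (\<Prod>i\<in>insert l (insert l' ({..<s} - {l, l'})). real (card (I i)))" by simp
      then show ?thesis using l' by (simp add: mult.assoc)
    qed
    have "\<nu> * real (card V) * (\<nu> * real (card V)) \<le> real (card (I l)) * real (card (I l'))"
      using large[OF l] large[OF l'(1)] \<nu> by (intro mult_mono) auto
    then have "(real (card V))\<^sup>2 \<le> real (card (I l)) * real (card (I l')) / \<nu>\<^sup>2"
      using \<nu> by (simp add: field_simps power2_eq_square)
    then have "e * (real (card V))\<^sup>2 \<le> e * (real (card (I l)) * real (card (I l')) / \<nu>\<^sup>2)"
      using e by (intro mult_left_mono)
    then have "(e * (real (card V))\<^sup>2 + d * real (card (I l)) * real (card (I l'))) * ?R
       \<le> ((e / \<nu>\<^sup>2 + d) * (real (card (I l)) * real (card (I l')))) * ?R"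
      by (intro mult_right_mono prod_nonneg) (auto simp: algebra_simps)
    moreover have "\<bar>\<Sum>u\<in>Pi\<^sub>E {..<s} I. ?T u l\<bar> \<le> (e * (real (card V))\<^sup>2 + d * real (card (I l)) * real (card (I l'))) * ?R"
      using cycle_step[where e=e and c=c and g=g and f=f and V=V, OF s l V(1) I f cut g[OF l]] by (simp add: l'_def)
    ultimately show ?thesis unfolding P by (simp add: mult.assoc)
  qed
  have "(\<Sum>u\<in>Pi\<^sub>E {..<s} I. (\<Prod>l<s. f (l, u l, u (Suc l mod s))) - (\<Prod>l<s. c l))
      = (\<Sum>l<s. (\<Prod>i<l. c i) * (\<Sum>u\<in>Pi\<^sub>E {..<s} I. ?T u l))"
    unfolding prod_diff_telescope sum_distrib_left by (subst sum.swap) (simp add: mult.assoc)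
  moreover have "\<bar>\<Sum>l<s. (\<Prod>i<l. c i) * (\<Sum>u\<in>Pi\<^sub>E {..<s} I. ?T u l)\<bar> \<le> (\<Sum>l<s. (e / \<nu>\<^sup>2 + d) * ?P)"
  proof (rule order_trans[OF sum_abs], rule sum_mono)
    fix l assume l: "l \<in> {..<s}"
    have "0 \<le> (\<Prod>i<l. c i)" "(\<Prod>i<l. c i) \<le> 1" using l c by (auto intro!: prod_nonneg prod_le_1)
    then have "\<bar>(\<Prod>i<l. c i) * (\<Sum>u\<in>Pi\<^sub>E {..<s} I. ?T u l)\<bar> \<le> \<bar>\<Sum>u\<in>Pi\<^sub>E {..<s} I. ?T u l\<bar>"
      by (simp add: abs_mult mult_left_le_one_le)
    also have "\<dots> \<le> (e / \<nu>\<^sup>2 + d) * ?P" using l by (intro step) auto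
    finally show "\<bar>(\<Prod>i<l. c i) * (\<Sum>u\<in>Pi\<^sub>E {..<s} I. ?T u l)\<bar> \<le> (e / \<nu>\<^sup>2 + d) * ?P" .
  qed
  moreover have "(\<Sum>u\<in>Pi\<^sub>E {..<s} I. (\<Prod>l<s. f (l, u l, u (Suc l mod s))) - (\<Prod>l<s. c l))
     = (\<Sum>u\<in>Pi\<^sub>E {..<s} I. \<Prod>l<s. f (l, u l, u (Suc l mod s))) - ?P * (\<Prod>l<s. c l)"
    by (simp add: sum_subtractf card_PiE)
  ultimately show ?thesis by (simp add: algebra_simps abs_le_iff)
qed

section \<open>Roth's theorem for translation-invariant equations in cyclic groups\<close>

lemma dvd_diff_imp_eq:
  fixes P a b :: int
  assumes "P dvd a - b" "a \<in> {0..<P}" "b \<in> {0..<P}"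
  shows "a = b"
  using assms by (simp add: mod_eq_dvd_iff[symmetric])

text \<open>There are at most 2^(length Ss) membership patterns, and each pattern among the counted
  points has a cell with fewer than \<open>r\<close> elements.\<close>

lemma card_small_atoms_le:
  assumes V: "finite V" and r: "r \<ge> 0"
  shows "real (card {v \<in> V. real (card {v' \<in> V. atom_of Ss v' = atom_of Ss v}) < r}) \<le> 2 ^ length Ss * r"
proof -
  define S where "S = {v \<in> V. real (card {v' \<in> V. atom_of Ss v' = atom_of Ss v}) < r}"
  have fS: "finite S" using V by (simp add: S_def)
  have sub: "atom_of Ss ` S \<subseteq> {xs. set xs \<subseteq> (UNIV::bool set) \<and> length xs = length Ss}"
    by (auto simp: atom_of_def)
  have "card (atom_of Ss ` S) \<le> card {xs. set xs \<subseteq> (UNIV::bool set) \<and> length xs = length Ss}"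
    by (rule card_mono[OF finite_lists_length_eq sub]) simp
  also have "\<dots> = 2 ^ length Ss" by (subst card_lists_length_eq) auto
  finally have c: "card (atom_of Ss ` S) \<le> 2 ^ length Ss" .
  have "S \<subseteq> (\<Union>b\<in>atom_of Ss ` S. {v \<in> V. atom_of Ss v = b})" by (auto simp: S_def)
  then have "card S \<le> card (\<Union>b\<in>atom_of Ss ` S. {v \<in> V. atom_of Ss v = b})"
    using V fS by (intro card_mono) auto
  also have "\<dots> \<le> (\<Sum>b\<in>atom_of Ss ` S. card {v \<in> V. atom_of Ss v = b})"
    using fS by (intro card_UN_le) auto
  finally have "real (card S) \<le> (\<Sum>b\<in>atom_of Ss ` S. real (card {v \<in> V. atom_of Ss v = b}))"
    by (metis of_nat_le_iff of_nat_sum)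
  also have "\<dots> \<le> (\<Sum>b\<in>atom_of Ss ` S. r)"
    by (intro sum_mono) (auto simp: S_def)
  also have "\<dots> = real (card (atom_of Ss ` S)) * r" by simp
  also have "\<dots> \<le> 2 ^ length Ss * r"
    using c r by (intro mult_right_mono) (simp_all add: of_nat_le_iff[symmetric] del: of_nat_le_iff)
  finally show ?thesis by (simp add: S_def)
qed

text \<open>Small cells at either end account for 2 \<epsilon>, sparse pairs of cells for \<epsilon>
  since the edges there are counted by their averages, and irregular pairs for \<epsilon> by
  Markov's inequality applied to the cell averages \<open>q\<close> of the squared deviation, with
  threshold \<open>D\<close>.\<close>

lemma card_bad_edges_le:
  fixes f :: "nat \<times> 'a \<times> 'a \<Rightarrow> real" and \<epsilon> D :: real
  defines "X s V \<equiv> {..<s::nat} \<times> V \<times> (V::'a set)"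
  defines "q s V Ss G \<equiv> cond_avg (X s V) (pair_atom Ss) (\<lambda>x. (G x - edge_avg s V f Ss x)\<^sup>2)"
  assumes l: "l < s" and V: "finite V" and f: "\<And>x. f x = 0 \<or> f x = 1" and \<epsilon>: "\<epsilon> > 0" and D: "D > 0"
    and len: "length Ss \<le> m"
    and close: "(\<Sum>x\<in>X s V. (G x - edge_avg s V f Ss x)\<^sup>2) \<le> \<epsilon> * D * (real (card V))\<^sup>2"
  shows "real (card {(v, w). v \<in> V \<and> w \<in> V \<and> f (l, v, w) = 1 \<and>
      (real (card {v' \<in> V. atom_of Ss v' = atom_of Ss v}) < \<epsilon> / 2 ^ m * real (card V) \<or>
       real (card {v' \<in> V. atom_of Ss v' = atom_of Ss w}) < \<epsilon> / 2 ^ m * real (card V) \<or>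
       edge_avg s V f Ss (l, v, w) < \<epsilon> \<or> D < q s V Ss G (l, v, w))}) \<le> 4 * \<epsilon> * (real (card V))\<^sup>2"
proof -
  let ?n = "real (card V)"
  define S where "S = {v \<in> V. real (card {v' \<in> V. atom_of Ss v' = atom_of Ss v}) < \<epsilon> / 2 ^ m * ?n}"
  define B2 where "B2 = {(v, w). v \<in> V \<and> w \<in> V \<and> f (l, v, w) = 1 \<and> edge_avg s V f Ss (l, v, w) < \<epsilon>}"
  define B3 where "B3 = {(v, w). v \<in> V \<and> w \<in> V \<and> D < q s V Ss G (l, v, w)}"
  have fX: "finite (X s V)" using V by (simp add: X_def)
  have finS: "finite S" "S \<subseteq> V" using V by (auto simp: S_def)
  have fin: "finite B2" "finite B3"
    by (rule finite_subset[of _ "V \<times> V"]; use V in \<open>auto simp: B2_def B3_def\<close>)+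
  have S: "real (card S) \<le> \<epsilon> * ?n"
  proof -
    have "real (card S) \<le> 2 ^ length Ss * (\<epsilon> / 2 ^ m * ?n)"
      unfolding S_def by (rule card_small_atoms_le) (use V \<epsilon> in auto)
    also have "\<dots> \<le> 2 ^ m * (\<epsilon> / 2 ^ m * ?n)"
      using len \<epsilon> by (intro mult_right_mono power_increasing) auto
    finally show ?thesis by simp
  qed
  have sub: "{l} \<times> V \<times> V \<subseteq> X s V" using l by (auto simp: X_def)
  have B2: "real (card B2) \<le> \<epsilon> * ?n\<^sup>2"
  proof -
    define h where "h = (\<lambda>x. of_bool (fst x = l \<and> edge_avg s V f Ss x < \<epsilon>) :: real)"
    have "real (card B2) = (\<Sum>x\<in>(\<lambda>p. (l, p)) ` B2. 1)" by (simp add: card_image inj_on_def)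
    also have "\<dots> = (\<Sum>x\<in>X s V. f x * h x)"
      using fX l f by (intro sum.mono_neutral_cong_left) (auto simp: B2_def h_def X_def image_def split: if_splits, metis)
    also have "\<dots> = (\<Sum>x\<in>X s V. edge_avg s V f Ss x * h x)"
      unfolding edge_avg_def X_def[symmetric]
      by (rule sum_cond_avg_mult[OF fX, symmetric])
        (auto simp: h_def edge_avg_def pair_atom_def X_def cond_avg_def)
    also have "\<dots> \<le> (\<Sum>x\<in>X s V. if x \<in> {l} \<times> V \<times> V then \<epsilon> else 0)"
      using \<epsilon> by (intro sum_mono) (auto simp: h_def X_def)
    also have "\<dots> = (\<Sum>x\<in>{l} \<times> V \<times> V. \<epsilon>)"
      using sub fX by (intro sum.mono_neutral_cong_right) auto
    also have "\<dots> = \<epsilon> * ?n\<^sup>2" by (simp add: card_cartesian_product power2_eq_square)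
    finally show ?thesis .
  qed
  have B3: "real (card B3) \<le> \<epsilon> * ?n\<^sup>2"
  proof -
    have q0: "q s V Ss G x \<ge> 0" for x unfolding q_def by (intro cond_avg_nonneg) simp
    have "D * real (card B3) = (\<Sum>x\<in>(\<lambda>p. (l, p)) ` B3. D)" by (simp add: card_image inj_on_def)
    also have "\<dots> \<le> (\<Sum>x\<in>(\<lambda>p. (l, p)) ` B3. q s V Ss G x)"
      by (intro sum_mono) (auto simp: B3_def)
    also have "\<dots> \<le> (\<Sum>x\<in>X s V. q s V Ss G x)"
      by (rule sum_mono2[OF fX]) (use l q0 in \<open>auto simp: B3_def X_def\<close>)
    also have "\<dots> = (\<Sum>x\<in>X s V. (G x - edge_avg s V f Ss x)\<^sup>2)"
      using sum_cond_avg_mult[OF fX, where h="\<lambda>_. 1"] by (simp add: q_def)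
    also have "\<dots> \<le> D * (\<epsilon> * ?n\<^sup>2)" using close by (simp add: mult_ac)
    finally show ?thesis using D by simp
  qed
  have "{(v, w). v \<in> V \<and> w \<in> V \<and> f (l, v, w) = 1 \<and>
      (real (card {v' \<in> V. atom_of Ss v' = atom_of Ss v}) < \<epsilon> / 2 ^ m * real (card V) \<or>
       real (card {v' \<in> V. atom_of Ss v' = atom_of Ss w}) < \<epsilon> / 2 ^ m * real (card V) \<or>
       edge_avg s V f Ss (l, v, w) < \<epsilon> \<or> D < q s V Ss G (l, v, w))} \<subseteq> (S \<times> V \<union> V \<times> S) \<union> (B2 \<union> B3)" (is "?B \<subseteq> _")
    by (auto simp: S_def B2_def B3_def)
  then have "card ?B \<le> card ((S \<times> V \<union> V \<times> S) \<union> (B2 \<union> B3))"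
    using V fin finS by (intro card_mono) auto
  also have "\<dots> \<le> (card (S \<times> V) + card (V \<times> S)) + (card B2 + card B3)"
    by (intro order_trans[OF card_Un_le] add_mono card_Un_le)
  finally have "real (card ?B) \<le> real (card (S \<times> V) + card (V \<times> S) + (card B2 + card B3))"
    by (simp only: of_nat_le_iff)
  then have "real (card ?B) \<le> real (card S) * ?n + ?n * real (card S) + (real (card B2) + real (card B3))"
    by (simp only: card_cartesian_product of_nat_add of_nat_mult)
  moreover have "real (card S) * ?n + ?n * real (card S) + (real (card B2) + real (card B3))
      \<le> (\<epsilon> * ?n) * ?n + ?n * (\<epsilon> * ?n) + (\<epsilon> * ?n\<^sup>2 + \<epsilon> * ?n\<^sup>2)"
    using S B2 B3 by (intro add_mono mult_right_mono mult_left_mono) auto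
  moreover have "(\<epsilon> * ?n) * ?n + ?n * (\<epsilon> * ?n) + (\<epsilon> * ?n\<^sup>2 + \<epsilon> * ?n\<^sup>2) = 4 * \<epsilon> * ?n\<^sup>2"
    by (simp add: power2_eq_square)
  ultimately show ?thesis by (rule order_trans[OF _ order_trans[OF _ eq_refl]])
qed

lemma sum_cyclic_shift:
  fixes g :: "nat \<Rightarrow> 'b::comm_monoid_add"
  assumes "s > 0"
  shows "(\<Sum>l<s. g (Suc l mod s)) = (\<Sum>l<s. g l)"
proof -
  obtain n where n: "s = Suc n" using assms gr0_implies_Suc by blast
  have "(\<Sum>l<s. g (Suc l mod s)) = (\<Sum>l<n. g (Suc l mod s)) + g 0" unfolding n by simp
  also have "(\<Sum>l<n. g (Suc l mod s)) = (\<Sum>l<n. g (Suc l))" unfolding n by (intro sum.cong) auto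
  finally show ?thesis unfolding n sum.lessThan_Suc_shift by (simp add: add.commute)
qed

text \<open>Consecutive differences of a closed walk with steps in the sets \<open>\<lambda>\<^sub>l A\<close> form a solution,
  and each solution comes from one closed walk per starting point.\<close>

lemma card_cycles_le:
  fixes P :: int and lam :: "nat \<Rightarrow> int"
  assumes P: "P \<ge> 1" and s: "s > 0" and A: "A \<subseteq> {0..<P}"
  shows "card {u \<in> Pi\<^sub>E {..<s} (\<lambda>_. {0..<P}). \<forall>l<s. \<exists>a\<in>A. P dvd u (Suc l mod s) - u l - lam l * a}
     \<le> nat P * card {x \<in> Pi\<^sub>E {..<s} (\<lambda>_. A). P dvd (\<Sum>l<s. lam l * x l)}" (is "card ?C \<le> _ * card ?S")
proof -
  define sel where "sel u = (\<lambda>l\<in>{..<s}. SOME a. a \<in> A \<and> P dvd u (Suc l mod s) - u l - lam l * a)" for u :: "nat \<Rightarrow> int"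
  have sel: "sel u l \<in> A \<and> P dvd u (Suc l mod s) - u l - lam l * sel u l" if "u \<in> ?C" "l < s" for u l
  proof -
    have "\<exists>a. a \<in> A \<and> P dvd u (Suc l mod s) - u l - lam l * a" using that by blast
    from someI_ex[OF this] show ?thesis using that by (simp add: sel_def)
  qed
  have finA: "finite A" using A finite_subset by blast
  have "(\<lambda>u. (u 0, sel u)) ` ?C \<subseteq> {0..<P} \<times> ?S"
  proof clarsimp
    fix u assume u: "u \<in> {..<s} \<rightarrow>\<^sub>E {0..<P}" "\<forall>l<s. \<exists>a\<in>A. P dvd u (Suc l mod s) - u l - lam l * a"
    then have uC: "u \<in> ?C" by blast
    have "sel u \<in> {..<s} \<rightarrow>\<^sub>E A" using sel[OF uC] by (auto simp: sel_def PiE_def)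
    moreover have "P dvd (\<Sum>l<s. u (Suc l mod s) - u l - lam l * sel u l)"
      using sel[OF uC] by (intro dvd_sum) auto
    then have "P dvd (\<Sum>l<s. lam l * sel u l)"
      by (simp add: sum_subtractf sum_cyclic_shift[OF s])
    ultimately show "0 \<le> u 0 \<and> u 0 < P \<and> sel u \<in> {..<s} \<rightarrow>\<^sub>E A \<and> P dvd (\<Sum>l<s. lam l * sel u l)"
      using u(1) s by (auto simp: PiE_iff)
  qed
  moreover have "inj_on (\<lambda>u. (u 0, sel u)) ?C"
  proof (rule inj_onI)
    fix u v assume u: "u \<in> ?C" and v: "v \<in> ?C" and "(u 0, sel u) = (v 0, sel v)"
    then have eq: "u 0 = v 0" "sel u = sel v" by auto
    have rng: "u l \<in> {0..<P}" "v l \<in> {0..<P}" if "l < s" for l using u v that by (auto simp: PiE_iff)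
    have "l < s \<longrightarrow> u l = v l" for l
    proof (induction l)
      case (Suc l)
      show ?case
      proof
        assume l: "Suc l < s"
        have "P dvd (u (Suc l) - u l - lam l * sel u l) - (v (Suc l) - v l - lam l * sel v l)"
          using sel[OF u, of l] sel[OF v, of l] l by (simp add: dvd_diff)
        then have "P dvd u (Suc l) - v (Suc l)" using Suc l eq by simp
        then show "u (Suc l) = v (Suc l)" using rng l by (intro dvd_diff_imp_eq) auto
      qed
    qed (use eq in simp)
    then show "u = v" using u v by (intro PiE_ext[where k="{..<s}"]) auto
  qed
  ultimately have "card ?C \<le> card ({0..<P} \<times> ?S)"
    using finA by (intro card_inj_on_le finite_cartesian_product) (auto intro!: finite_subset[OF _ finite_PiE[of "{..<s}" "\<lambda>_. A"]])
  then show ?thesis by (simp add: card_cartesian_product)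
qed

text \<open>The walks with all steps given by the same \<open>a \<in> A\<close> form at least \<open>\<delta> P\<^sup>2\<close> closed walks that use each edge at most
  once. The edges lying in small, sparse or irregular cells are fewer, so some such walk avoids them all, and the
  cells through which it passes then contain a positive proportion of closed walks.\<close>

lemma roth_mod_ge3:
  fixes lam :: "nat \<Rightarrow> int"
  assumes s: "s \<ge> 3" and \<delta>: "\<delta> > 0" and lam0: "(\<Sum>l<s. lam l) = 0"
  shows "\<exists>c>0. \<forall>P::int. P \<ge> 1 \<longrightarrow> (\<forall>l<s. coprime (lam l) P) \<longrightarrow> (\<forall>A\<subseteq>{0..<P}. real (card A) \<ge> \<delta> * real_of_int P \<longrightarrow>
     real (card {x \<in> Pi\<^sub>E {..<s} (\<lambda>_. A). P dvd (\<Sum>l<s. lam l * x l)}) \<ge> c * real_of_int P ^ (s - 1))"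
proof -
  \<comment> \<open>The bad edges of all \<open>s\<close> colours then number at most 4 s \<epsilon>
    P^2 = \<delta> P^2 / 2, fewer than the constant-step walks. The next choices give s (e m /
    \<nu>^2 + d) = \<epsilon>^s / 2, half of the main term \<epsilon>^s.\<close>
  define \<epsilon> where "\<epsilon> = \<delta> / (8 * real s)"
  define d where "d = \<epsilon> ^ s / (4 * real s)"
  define \<nu> where "\<nu> = (\<lambda>m::nat. \<epsilon> / 2 ^ m)"
  define e where "e = (\<lambda>m. d * (\<nu> m)\<^sup>2)"
  have pos: "\<epsilon> > 0" "d > 0" "\<nu> m > 0" "e m > 0" for m
    using \<delta> s by (auto simp: \<epsilon>_def d_def \<nu>_def e_def)
  have "\<exists>M. \<forall>(V::int set) f. finite V \<longrightarrow> V \<noteq> {} \<longrightarrow> (\<forall>x. 0 \<le> f x \<and> f x \<le> 1) \<longrightarrow>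
     (\<exists>m\<le>M. \<exists>Ss Us. length Ss \<le> m \<and> cut_close (e m) s V f (edge_avg s V f (Us @ Ss)) \<and>
       (\<Sum>x\<in>{..<s} \<times> V \<times> V. (edge_avg s V f (Us @ Ss) x - edge_avg s V f Ss x)\<^sup>2) \<le> \<epsilon> * d\<^sup>2 * (real (card V))\<^sup>2)"
    by (rule strong_regularity) (use pos in simp_all)
  then obtain M where M: "\<forall>(V::int set) f. finite V \<longrightarrow> V \<noteq> {} \<longrightarrow> (\<forall>x. 0 \<le> f x \<and> f x \<le> 1) \<longrightarrow>
     (\<exists>m\<le>M. \<exists>Ss Us. length Ss \<le> m \<and> cut_close (e m) s V f (edge_avg s V f (Us @ Ss)) \<and>
       (\<Sum>x\<in>{..<s} \<times> V \<times> V. (edge_avg s V f (Us @ Ss) x - edge_avg s V f Ss x)\<^sup>2) \<le> \<epsilon> * d\<^sup>2 * (real (card V))\<^sup>2)" ..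
  define c where "c = \<epsilon> ^ s / 2 * (\<nu> M) ^ s"
  have "real (card {x \<in> Pi\<^sub>E {..<s} (\<lambda>_. A). P dvd (\<Sum>l<s. lam l * x l)}) \<ge> c * real_of_int P ^ (s - 1)" (is "real (card ?S) \<ge> _")
    if P: "P \<ge> 1" and cop: "\<forall>l<s. coprime (lam l) P" and A: "A \<subseteq> {0..<P}" and dens: "real (card A) \<ge> \<delta> * real_of_int P" for P A
  proof -
    define V where "V = {0..<P}"
    define f where "f = (\<lambda>(l, v, w). of_bool (\<exists>a\<in>A. P dvd w - v - lam l * a) :: real)"
    have V: "finite V" "V \<noteq> {}" "real (card V) = real_of_int P" using P by (auto simp: V_def)
    have f01: "f x = 0 \<or> f x = 1" for x by (cases x) (auto simp: f_def)
    have f: "0 \<le> f x" "f x \<le> 1" for x using f01[of x] by auto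
    obtain m Ss Us where m: "m \<le> M" and len: "length Ss \<le> m"
      and cut: "cut_close (e m) s V f (edge_avg s V f (Us @ Ss))"
      and close: "(\<Sum>x\<in>{..<s} \<times> V \<times> V. (edge_avg s V f (Us @ Ss) x - edge_avg s V f Ss x)\<^sup>2) \<le> \<epsilon> * d\<^sup>2 * (real (card V))\<^sup>2"
      using M[rule_format, OF V(1,2), of f] f by blast
    let ?G = "edge_avg s V f (Us @ Ss)" and ?g = "edge_avg s V f Ss"
    define q where "q = cond_avg ({..<s} \<times> V \<times> V) (pair_atom Ss) (\<lambda>x. (?G x - ?g x)\<^sup>2)"
    define cell where "cell v = {v' \<in> V. atom_of Ss v' = atom_of Ss v}" for v
    define Bad where "Bad l = {(v, w). v \<in> V \<and> w \<in> V \<and> f (l, v, w) = 1 \<and>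
      (real (card (cell v)) < \<nu> m * real (card V) \<or> real (card (cell w)) < \<nu> m * real (card V) \<or>
       ?g (l, v, w) < \<epsilon> \<or> d\<^sup>2 < q (l, v, w))}" for l
    have finBad: "finite (Bad l)" for l
      by (rule finite_subset[of _ "V \<times> V"]) (use V in \<open>auto simp: Bad_def\<close>)
    have Bad: "real (card (Bad l)) \<le> 4 * \<epsilon> * (real (card V))\<^sup>2" if "l < s" for l
      unfolding Bad_def cell_def \<nu>_def q_def
      by (rule card_bad_edges_le[OF that V(1) f01 pos(1) _ len close]) (use pos in auto)
    \<comment> \<open>The walk that starts at \<open>fst p\<close> with steps
      \<open>lam l * snd p\<close>; it closes because the coefficients sum to 0.\<close>
    define u where "u p l = (fst p + (\<Sum>i<l. lam i) * snd p) mod P" for p :: "int \<times> int" and l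
    have u_cong: "P dvd u p l - (fst p + (\<Sum>i<l. lam i) * snd p)" for p l
      unfolding u_def by (simp add: mod_eq_dvd_iff[symmetric])
    have uV: "u p l \<in> V" for p l using P by (auto simp: u_def V_def)
    have u_next: "u p (Suc l mod s) = u p (Suc l)" if "l < s" for p l
    proof (cases "Suc l = s")
      case True
      have "u p s = fst p mod P" unfolding u_def lam0 by simp
      with True show ?thesis by (simp add: u_def)
    qed (use that in simp)
    have step: "P dvd u p (Suc l mod s) - u p l - lam l * snd p" if "l < s" for p l
    proof -
      have "P dvd (u p (Suc l) - (fst p + (\<Sum>i<Suc l. lam i) * snd p)) - (u p l - (fst p + (\<Sum>i<l. lam i) * snd p))"
        by (intro dvd_diff u_cong)
      then show ?thesis using u_next[OF that] by (simp add: algebra_simps)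
    qed
    have finA: "finite A" using A finite_subset by blast
    \<comment> \<open>The two ends of an edge give \<open>lam l * snd p\<close> modulo
      \<open>P\<close>; as \<open>lam l\<close> is invertible, they determine the step and then the
      start.\<close>
    have injBad: "inj_on (\<lambda>p. (u p l, u p (Suc l mod s))) (V \<times> A)" if l: "l < s" for l
    proof (rule inj_onI)
      fix p p' assume p: "p \<in> V \<times> A" "p' \<in> V \<times> A"
        and eq: "(u p l, u p (Suc l mod s)) = (u p' l, u p' (Suc l mod s))"
      have "P dvd (u p (Suc l mod s) - u p l - lam l * snd p) - (u p' (Suc l mod s) - u p' l - lam l * snd p')"
        by (intro dvd_diff step l)
      then have "P dvd lam l * (snd p' - snd p)" using eq by (simp add: algebra_simps)
      then have "P dvd snd p' - snd p"
        using cop l by (simp add: coprime_commute coprime_dvd_mult_right_iff)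
      then have 1: "snd p' = snd p" using p A by (intro dvd_diff_imp_eq) auto
      have "P dvd (u p' l - (fst p' + (\<Sum>i<l. lam i) * snd p')) - (u p l - (fst p + (\<Sum>i<l. lam i) * snd p))"
        by (intro dvd_diff u_cong)
      then have "P dvd fst p - fst p'" using eq 1 by simp
      then have "fst p = fst p'" using p by (intro dvd_diff_imp_eq) (auto simp: V_def)
      with 1 show "p = p'" by (simp add: prod_eq_iff)
    qed
    have "\<exists>p\<in>V \<times> A. \<forall>l<s. (u p l, u p (Suc l mod s)) \<notin> Bad l"
    proof (rule ccontr)
      assume neg: "\<not> ?thesis"
      have "V \<times> A \<subseteq> (\<Union>l<s. {p \<in> V \<times> A. (u p l, u p (Suc l mod s)) \<in> Bad l})"
      proof
        fix p assume "p \<in> V \<times> A"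
        moreover from this neg obtain l where "l < s" "(u p l, u p (Suc l mod s)) \<in> Bad l" by metis
        ultimately show "p \<in> (\<Union>l<s. {p \<in> V \<times> A. (u p l, u p (Suc l mod s)) \<in> Bad l})" by blast
      qed
      then have "card (V \<times> A) \<le> card (\<Union>l<s. {p \<in> V \<times> A. (u p l, u p (Suc l mod s)) \<in> Bad l})"
        using V finA by (intro card_mono) auto
      also have "\<dots> \<le> (\<Sum>l<s. card {p \<in> V \<times> A. (u p l, u p (Suc l mod s)) \<in> Bad l})"
        by (intro card_UN_le) auto
      also have "\<dots> \<le> (\<Sum>l<s. card (Bad l))"
      proof (rule sum_mono)
        fix l assume "l \<in> {..<s}"
        then show "card {p \<in> V \<times> A. (u p l, u p (Suc l mod s)) \<in> Bad l} \<le> card (Bad l)"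
          by (intro card_inj_on_le[OF inj_on_subset[OF injBad[of l]] _ finBad]) auto
      qed
      finally have "real (card (V \<times> A)) \<le> (\<Sum>l<s. real (card (Bad l)))"
        by (metis of_nat_le_iff of_nat_sum)
      also have "\<dots> \<le> (\<Sum>l<s. 4 * \<epsilon> * (real (card V))\<^sup>2)" by (intro sum_mono Bad) auto
      also have "\<dots> = \<delta> / 2 * (real (card V))\<^sup>2" using s by (simp add: \<epsilon>_def)
      finally have "real (card V) * real (card A) \<le> \<delta> / 2 * (real (card V))\<^sup>2"
        by (simp add: card_cartesian_product)
      moreover have "real (card V) * real (card A) \<ge> real (card V) * (\<delta> * real (card V))"
        using dens V by (intro mult_left_mono) auto
      moreover have "\<delta> * (real (card V))\<^sup>2 > 0" using \<delta> V P by simp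
      moreover have "real (card V) * (\<delta> * real (card V)) = \<delta> * (real (card V))\<^sup>2"
        by (simp add: power2_eq_square)
      ultimately show False by linarith
    qed
    then obtain p where p: "p \<in> V \<times> A" and good: "\<And>l. l < s \<Longrightarrow> (u p l, u p (Suc l mod s)) \<notin> Bad l" by blast
    define I where "I l = cell (u p l)" for l
    define cc where "cc l = ?g (l, u p l, u p (Suc l mod s))" for l
    have good': "\<nu> m * real (card V) \<le> real (card (I l))" "\<epsilon> \<le> cc l" "q (l, u p l, u p (Suc l mod s)) \<le> d\<^sup>2" if l: "l < s" for l
    proof -
      have "f (l, u p l, u p (Suc l mod s)) = 1"
        using step[OF l, of p] p by (auto simp: f_def)
      then show "\<nu> m * real (card V) \<le> real (card (I l))" "\<epsilon> \<le> cc l" "q (l, u p l, u p (Suc l mod s)) \<le> d\<^sup>2"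
        using good[OF l] uV by (auto simp: Bad_def I_def cc_def not_less)
    qed
    have I: "I l \<subseteq> V" for l by (auto simp: I_def cell_def)
    have finI: "finite (I l)" for l by (rule finite_subset[OF I V(1)])
    have cI: "card (I l) > 0" for l
      using uV[of p l] finI[of l] by (auto simp: card_gt_0_iff I_def cell_def)
    have L1: "(\<Sum>v\<in>I l. \<Sum>w\<in>I (Suc l mod s). \<bar>?G (l, v, w) - cc l\<bar>)
          \<le> d * real (card (I l)) * real (card (I (Suc l mod s)))" if l: "l < s" for l
    proof -
      let ?l' = "Suc l mod s"
      let ?n = "real (card (I l)) * real (card (I ?l'))"
      \<comment> \<open>A cell of pairs is a product of two vertex cells, so Cauchy-Schwarz turns
        the square mean bound on it into the mean absolute deviation that cycle counting asks
        for.\<close>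
      have Y: "{y \<in> {..<s} \<times> V \<times> V. pair_atom Ss y = pair_atom Ss (l, u p l, u p ?l')} = {l} \<times> I l \<times> I ?l'"
        using l by (auto simp: pair_atom_def I_def cell_def)
      have "q (l, u p l, u p ?l') = (\<Sum>x\<in>{l} \<times> I l \<times> I ?l'. (?G x - ?g x)\<^sup>2) / ?n"
        unfolding q_def cond_avg_def Y by (simp only: card_cartesian_product) simp
      then have sq: "(\<Sum>x\<in>{l} \<times> I l \<times> I ?l'. (?G x - ?g x)\<^sup>2) \<le> d\<^sup>2 * ?n"
        using good'(3)[OF l] cI by (simp add: divide_le_eq)
      have gc: "?g x = cc l" if "x \<in> {l} \<times> I l \<times> I ?l'" for x
        unfolding cc_def edge_avg_def
        by (rule cond_avg_cong) (use that in \<open>auto simp: pair_atom_def I_def cell_def\<close>)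
      have "(\<Sum>v\<in>I l. \<Sum>w\<in>I ?l'. \<bar>?G (l, v, w) - cc l\<bar>) = (\<Sum>x\<in>{l} \<times> I l \<times> I ?l'. \<bar>?G x - cc l\<bar>)"
        by (simp add: sum.cartesian_product')
      also have "\<dots> = (\<Sum>x\<in>{l} \<times> I l \<times> I ?l'. \<bar>?G x - ?g x\<bar> * 1)"
        using gc by (intro sum.cong) auto
      finally have "(\<Sum>v\<in>I l. \<Sum>w\<in>I ?l'. \<bar>?G (l, v, w) - cc l\<bar>)\<^sup>2 = (\<Sum>x\<in>{l} \<times> I l \<times> I ?l'. \<bar>?G x - ?g x\<bar> * 1)\<^sup>2" by simp
      also have "\<dots> \<le> (\<Sum>x\<in>{l} \<times> I l \<times> I ?l'. \<bar>?G x - ?g x\<bar>\<^sup>2) * (\<Sum>x\<in>{l} \<times> I l \<times> I ?l'. 1\<^sup>2)"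
        by (rule Cauchy_Schwarz_ineq_sum)
      also have "\<dots> = (\<Sum>x\<in>{l} \<times> I l \<times> I ?l'. (?G x - ?g x)\<^sup>2) * ?n"
        by (simp add: card_cartesian_product)
      also have "\<dots> \<le> d\<^sup>2 * ?n * ?n" by (intro mult_right_mono sq) simp
      also have "\<dots> = (d * ?n)\<^sup>2" by (simp add: power2_eq_square)
      finally have "(\<Sum>v\<in>I l. \<Sum>w\<in>I ?l'. \<bar>?G (l, v, w) - cc l\<bar>) \<le> d * ?n"
        using pos(2) by (rule_tac power2_le_imp_le) auto
      then show ?thesis by (simp only: mult.assoc)
    qed
    have cc0: "0 \<le> cc l" if "l < s" for l using good'(2)[OF that] pos(1) by linarith
    have cc1: "cc l \<le> 1" for l unfolding cc_def edge_avg_def by (rule cond_avg_le_1) (rule f)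
    have "(\<Sum>w\<in>Pi\<^sub>E {..<s} I. \<Prod>l<s. f (l, w l, w (Suc l mod s)))
      \<ge> ((\<Prod>l<s. cc l) - real s * (e m / (\<nu> m)\<^sup>2 + d)) * (\<Prod>l<s. real (card (I l)))"
      by (rule cycle_count_close[OF s V(1,2) I pos(3) good'(1) f cc0 cc1 less_imp_le[OF pos(4)] cut L1])
    moreover have "(\<Prod>l<s. cc l) - real s * (e m / (\<nu> m)\<^sup>2 + d) \<ge> \<epsilon> ^ s / 2"
    proof -
      have "(\<Prod>l<s. cc l) \<ge> (\<Prod>l<s. \<epsilon>)" using good' pos by (intro prod_mono) (auto intro: less_imp_le)
      moreover have "real s * (e m / (\<nu> m)\<^sup>2 + d) = \<epsilon> ^ s / 2"
        using pos(3)[of m] s by (simp add: e_def d_def)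
      ultimately show ?thesis by simp
    qed
    \<comment> \<open>\<open>m\<close> depends on \<open>A\<close>; monotonicity of \<nu> replaces
      it by the uniform bound \<open>M\<close>.\<close>
    moreover have "(\<Prod>l<s. real (card (I l))) \<ge> (\<nu> M * real_of_int P) ^ s"
    proof -
      have "\<nu> M \<le> \<nu> m" unfolding \<nu>_def using m pos(1) by (intro divide_left_mono power_increasing) auto
      then have "\<nu> M * real (card V) \<le> real (card (I l))" if "l < s" for l
        using good'(1)[OF that] by (meson mult_right_mono of_nat_0_le_iff order_trans)
      then have "(\<Prod>l<s. \<nu> M * real (card V)) \<le> (\<Prod>l<s. real (card (I l)))"
        using pos(3)[of M] by (intro prod_mono) auto
      then show ?thesis using V by simp
    qed
    ultimately have low: "(\<Sum>w\<in>Pi\<^sub>E {..<s} I. \<Prod>l<s. f (l, w l, w (Suc l mod s))) \<ge> \<epsilon> ^ s / 2 * (\<nu> M * real_of_int P) ^ s"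
      using pos P by (smt (verit, best) mult_mono zero_le_power mult_nonneg_nonneg of_int_0_le_iff divide_nonneg_pos)
    let ?C = "{w \<in> Pi\<^sub>E {..<s} (\<lambda>_. {0..<P}). \<forall>l<s. \<exists>a\<in>A. P dvd w (Suc l mod s) - w l - lam l * a}"
    have finC: "finite (Pi\<^sub>E {..<s} (\<lambda>_. {0..<P}))" by (intro finite_PiE) auto
    have "(\<Sum>w\<in>Pi\<^sub>E {..<s} I. \<Prod>l<s. f (l, w l, w (Suc l mod s))) \<le> (\<Sum>w\<in>Pi\<^sub>E {..<s} (\<lambda>_. {0..<P}). \<Prod>l<s. f (l, w l, w (Suc l mod s)))"
    proof (rule sum_mono2[OF finC])
      show "Pi\<^sub>E {..<s} I \<subseteq> Pi\<^sub>E {..<s} (\<lambda>_. {0..<P})" using I unfolding V_def by (intro PiE_mono) blast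
    qed (intro prod_nonneg f)
    also have "\<dots> = (\<Sum>w\<in>?C. 1)"
      unfolding sum.inter_filter[OF finC]
    proof (intro sum.cong refl)
      fix w :: "nat \<Rightarrow> int"
      show "(\<Prod>l<s. f (l, w l, w (Suc l mod s))) = (if \<forall>l<s. \<exists>a\<in>A. P dvd w (Suc l mod s) - w l - lam l * a then 1 else 0)"
        by (cases "\<forall>l<s. \<exists>a\<in>A. P dvd w (Suc l mod s) - w l - lam l * a") (auto simp: f_def intro!: prod_zero)
    qed
    also have "\<dots> = real (card ?C)" by simp
    also have "\<dots> \<le> real (nat P * card ?S)"
      using card_cycles_le[where s=s and lam=lam, OF P _ A] s by (intro of_nat_mono) simp
    finally have "\<epsilon> ^ s / 2 * (\<nu> M * real_of_int P) ^ s \<le> real_of_int P * real (card ?S)"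
      using low P by simp
    moreover have "\<epsilon> ^ s / 2 * (\<nu> M * real_of_int P) ^ s = real_of_int P * (c * real_of_int P ^ (s - 1))"
      using s by (cases s) (auto simp: c_def power_mult_distrib)
    ultimately show ?thesis using P by simp
  qed
  moreover have "c > 0" using pos by (simp add: c_def)
  ultimately show ?thesis by blast
qed

text \<open>The constant tuples are solutions and already have the right order of magnitude. The
  case stands apart because in a cycle of length 2 both edges join the same two vertices, so the
  factors do not separate.\<close>

lemma roth_mod_2:
  fixes lam :: "nat \<Rightarrow> int"
  assumes lam0: "(\<Sum>l<2. lam l) = 0" and P: "P \<ge> 1" and A: "A \<subseteq> {0..<P}"
  shows "card {x \<in> Pi\<^sub>E {..<2::nat} (\<lambda>_. A). P dvd (\<Sum>l<2. lam l * x l)} \<ge> card A"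
proof -
  have s2: "{..<2::nat} = {0, 1}" by auto
  have finA: "finite A" using A finite_subset by blast
  have "inj_on (\<lambda>a. \<lambda>l\<in>{..<2::nat}. a) A"
    by (rule inj_onI) (metis (mono_tags, lifting) lessThan_iff pos2 restrict_apply')
  moreover have "P dvd (\<Sum>l<2. lam l * (\<lambda>l\<in>{..<2::nat}. a) l)" for a
  proof -
    have "(\<Sum>l<2. lam l * (\<lambda>l\<in>{..<2::nat}. a) l) = (\<Sum>l<2. lam l) * a"
      unfolding sum_distrib_right by (intro sum.cong) auto
    then show ?thesis by (simp only: lam0) simp
  qed
  then have "(\<lambda>a. \<lambda>l\<in>{..<2::nat}. a) ` A \<subseteq> {x \<in> Pi\<^sub>E {..<2::nat} (\<lambda>_. A). P dvd (\<Sum>l<2. lam l * x l)}"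
    by (intro image_subsetI CollectI conjI) auto
  ultimately show ?thesis
    using finA by (intro card_inj_on_le) (auto intro!: finite_subset[OF _ finite_PiE[of "{..<2::nat}" "\<lambda>_. A"]])
qed

theorem roth_mod:
  fixes lam :: "nat \<Rightarrow> int"
  assumes s: "s \<ge> 2" and \<delta>: "\<delta> > 0" and lam0: "(\<Sum>l<s. lam l) = 0"
  shows "\<exists>c>0. \<forall>P::int. P \<ge> 1 \<longrightarrow> (\<forall>l<s. coprime (lam l) P) \<longrightarrow> (\<forall>A\<subseteq>{0..<P}. real (card A) \<ge> \<delta> * real_of_int P \<longrightarrow>
     real (card {x \<in> Pi\<^sub>E {..<s} (\<lambda>_. A). P dvd (\<Sum>l<s. lam l * x l)}) \<ge> c * real_of_int P ^ (s - 1))"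
proof (cases "s = 2")
  case True
  have "real (card {x \<in> Pi\<^sub>E {..<s} (\<lambda>_. A). P dvd (\<Sum>l<s. lam l * x l)}) \<ge> \<delta> * real_of_int P ^ (s - 1)"
    if "P \<ge> 1" "A \<subseteq> {0..<P}" "real (card A) \<ge> \<delta> * real_of_int P" for P A
  proof -
    have "card A \<le> card {x \<in> Pi\<^sub>E {..<s} (\<lambda>_. A). P dvd (\<Sum>l<s. lam l * x l)}"
      using roth_mod_2[OF _ that(1,2), of lam] lam0 unfolding True .
    with that(3) show ?thesis by (simp add: True)
  qed
  with \<delta> show ?thesis by blast
next
  case False
  then show ?thesis using roth_mod_ge3[OF _ \<delta> lam0] s by simp
qed

section \<open>Exponential sums\<close>

definition near_int :: "real \<Rightarrow> real \<Rightarrow> bool" where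
  "near_int \<xi> x \<longleftrightarrow> (\<exists>a::int. \<bar>x - of_int a\<bar> \<le> \<xi>)"

definition ee :: "real \<Rightarrow> complex" where
  "ee x = cis (2 * pi * x)"

lemma ee_add: "ee (x + y) = ee x * ee y"
  by (simp add: ee_def cis_mult distrib_left)

lemma norm_ee [simp]: "norm (ee x) = 1"
  by (simp add: ee_def)

lemma ee_0 [simp]: "ee 0 = 1"
  by (simp add: ee_def)

lemma ee_of_int [simp]: "ee (of_int a) = 1"
  by (simp add: ee_def cis_multiple_2pi)

lemma ee_diff: "ee (x - y) = ee x * cnj (ee y)"
  by (simp add: ee_def cis_cnj cis_mult algebra_simps)

lemma ee_diff_of_int: "ee (x - of_int a) = ee x"
  using ee_add[of "x - of_int a" "of_int a"] by simp

lemma norm_cis_minus_1: "norm (cis t - 1) = 2 * \<bar>sin (t / 2)\<bar>"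
proof -
  have "(norm (cis t - 1))\<^sup>2 = (cos t - 1)\<^sup>2 + (sin t)\<^sup>2" by (simp add: cmod_power2)
  also have "\<dots> = 2 - 2 * cos t"
    using sin_cos_squared_add[of t] by (simp add: power2_diff)
  also have "\<dots> = (2 * \<bar>sin (t / 2)\<bar>)\<^sup>2"
    using cos_double_sin[of "t / 2"] by (simp add: power_mult_distrib)
  finally show ?thesis by (rule power2_eq_imp_eq) auto
qed

lemma near_int_mono: "near_int \<xi> x \<Longrightarrow> \<xi> \<le> \<zeta> \<Longrightarrow> near_int \<zeta> x"
  unfolding near_int_def by (meson order_trans)

lemma near_int_1: "\<xi> \<ge> 1 \<Longrightarrow> near_int \<xi> x"
  unfolding near_int_def by (rule exI[of _ "\<lfloor>x\<rfloor>"]) linarith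

lemma near_int_mult: "near_int \<xi> x \<Longrightarrow> near_int (\<bar>of_int m\<bar> * \<xi>) (of_int m * x)"
  unfolding near_int_def
proof (elim exE)
  fix a :: int assume "\<bar>x - of_int a\<bar> \<le> \<xi>"
  then have "\<bar>of_int m\<bar> * \<bar>x - of_int a\<bar> \<le> \<bar>of_int m\<bar> * \<xi>" by (intro mult_left_mono) auto
  then show "\<exists>a::int. \<bar>of_int m * x - of_int a\<bar> \<le> \<bar>of_int m\<bar> * \<xi>"
    by (intro exI[of _ "m * a"]) (simp add: abs_mult[symmetric] algebra_simps)
qed

lemma near_int_minus: "near_int \<xi> x \<Longrightarrow> near_int \<xi> (- x)"
  using near_int_mult[of \<xi> x "-1"] by simp

lemma norm_ee_minus_1_le: "near_int \<xi> x \<Longrightarrow> norm (ee x - 1) \<le> 2 * pi * \<xi>"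
  unfolding near_int_def
proof (elim exE)
  fix a :: int assume a: "\<bar>x - of_int a\<bar> \<le> \<xi>"
  have "norm (ee x - 1) = norm (ee (x - of_int a) - 1)" by (simp add: ee_diff_of_int)
  also have "\<dots> = 2 * \<bar>sin (pi * (x - of_int a))\<bar>" unfolding ee_def norm_cis_minus_1 by simp
  also have "\<dots> \<le> 2 * \<bar>pi * (x - of_int a)\<bar>" by (intro mult_left_mono abs_sin_x_le_abs_x) auto
  also have "\<dots> = 2 * pi * \<bar>x - of_int a\<bar>" by (simp add: abs_mult)
  also have "\<dots> \<le> 2 * pi * \<xi>" using a by (intro mult_left_mono) auto
  finally show ?thesis .
qed

text \<open>Cubic Taylor bound: t \<le> 2 gives t^3 / 6 \<le> 2 t / 3. The constant 1/3 is good
  enough because pi / 3 exceeds 1 / 2.\<close>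

lemma sin_ge_third: "0 \<le> t \<Longrightarrow> t \<le> pi / 2 \<Longrightarrow> t / 3 \<le> sin t"
proof -
  assume t: "0 \<le> t" "t \<le> pi / 2"
  have "\<bar>sin t - (\<Sum>m<3. sin_coeff m * t ^ m)\<bar> \<le> inverse (fact 3) * \<bar>t\<bar> ^ 3"
    by (rule Maclaurin_sin_bound)
  then have "6 * \<bar>sin t - t\<bar> \<le> t ^ 3"
    using t by (simp add: sin_coeff_def numeral_3_eq_3 fact_numeral field_simps)
  moreover have "6 * (t - sin t) \<le> 6 * \<bar>sin t - t\<bar>" by (simp add: abs_if)
  ultimately have "6 * (t - sin t) \<le> t ^ 3" by (rule order_trans[rotated])
  then have 1: "sin t \<ge> t - t ^ 3 / 6" by (simp add: algebra_simps)
  have "t \<le> 2" using t pi_less_4 by linarith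
  then have "t * t \<le> 2 * 2" using t by (intro mult_mono) auto
  then have "t * (t * t) \<le> t * 4" using t by (intro mult_left_mono) auto
  then have "t ^ 3 / 6 \<le> 2 * t / 3" by (simp add: power3_eq_cube)
  with 1 show ?thesis by linarith
qed

lemma norm_ee_minus_1_ge:
  assumes "\<not> near_int \<xi> x" and "\<xi> > 0"
  shows "norm (ee x - 1) \<ge> \<xi>"
proof -
  define y where "y = x - of_int (round x)"
  have y: "\<bar>y\<bar> \<le> 1 / 2" "\<bar>y\<bar> > \<xi>"
    using assms(1) of_int_round_abs_le[of x] by (auto simp: y_def near_int_def not_le abs_minus_commute)
  have "\<xi> / 2 \<le> \<bar>y\<bar> * (pi / 3)"
    using mult_left_mono[of "1 / 2" "pi / 3" "\<bar>y\<bar>"] pi_ge_two y by linarith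
  also have "\<dots> \<le> sin (pi * \<bar>y\<bar>)"
    using sin_ge_third[of "pi * \<bar>y\<bar>"] y by (simp add: mult_ac)
  also have "\<dots> \<le> \<bar>sin (pi * y)\<bar>" by (auto simp: abs_if)
  finally have "\<xi> \<le> 2 * \<bar>sin (pi * y)\<bar>" by simp
  also have "\<dots> = norm (ee y - 1)" unfolding ee_def norm_cis_minus_1 by simp
  also have "\<dots> = norm (ee x - 1)" by (simp add: y_def ee_diff_of_int)
  finally show ?thesis .
qed

text \<open>Kept in multiplied form so that it also holds when \<open>ee \<alpha>\<close> is
  1.\<close>

lemma geometric_ee_telescope:
  assumes "a \<le> b"
  shows "(ee \<alpha> - 1) * (\<Sum>n\<in>{a..<b}. ee (c + of_int n * \<alpha>)) = ee (c + of_int b * \<alpha>) - ee (c + of_int a * \<alpha>)"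
  using assms
proof (induction b rule: int_ge_induct)
  case (step b)
  have "{a..<b + 1} = insert b {a..<b}" using step by auto
  moreover have "ee (c + of_int (b + 1) * \<alpha>) = ee \<alpha> * ee (c + of_int b * \<alpha>)"
    by (simp add: ee_add[symmetric] algebra_simps)
  ultimately show ?case using step by (simp add: algebra_simps)
qed simp

lemma norm_geometric_ee_le:
  assumes n: "\<not> near_int \<xi> \<alpha>" and \<xi>: "\<xi> > 0"
  shows "norm (\<Sum>n\<in>{a..<b}. ee (c + of_int n * \<alpha>)) \<le> 2 / \<xi>"
proof (cases "a \<le> b")
  case True
  note tel = geometric_ee_telescope[OF True, of \<alpha> c]
  have "\<xi> * norm (\<Sum>n\<in>{a..<b}. ee (c + of_int n * \<alpha>)) \<le> norm (ee \<alpha> - 1) * norm (\<Sum>n\<in>{a..<b}. ee (c + of_int n * \<alpha>))"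
    by (intro mult_right_mono norm_ee_minus_1_ge n \<xi>) simp
  also have "\<dots> = norm (ee (c + of_int b * \<alpha>) - ee (c + of_int a * \<alpha>))"
    unfolding norm_mult[symmetric] tel ..
  also have "\<dots> \<le> 2" using norm_triangle_ineq4[of "ee (c + of_int b * \<alpha>)" "ee (c + of_int a * \<alpha>)"] by simp
  finally show ?thesis using \<xi> by (simp add: field_simps)
next
  case False
  then show ?thesis using \<xi> by simp
qed

section \<open>Recurrence of linear sequences near the integers\<close>

lemma card_le_diameter:
  fixes S :: "int set"
  assumes "finite S" and D: "D \<ge> 0" and d: "\<And>x y. x \<in> S \<Longrightarrow> y \<in> S \<Longrightarrow> real_of_int \<bar>x - y\<bar> \<le> D"
  shows "real (card S) \<le> D + 1"
proof (cases "S = {}")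
  case False
  have "S \<subseteq> {Min S..Max S}" using assms(1) by auto
  then have "card S \<le> card {Min S..Max S}" by (intro card_mono) auto
  moreover have "Min S \<in> S" "Max S \<in> S" using assms(1) False by auto
  moreover from this have "Min S \<le> Max S" using assms(1) by simp
  ultimately show ?thesis using d[of "Max S" "Min S"] by simp
qed (use D in simp)

text \<open>Pigeonhole on blocks of length 2 / \<epsilon>: at most \<epsilon> X / 2 + 1 of them meet
  the range, fewer than the elements of \<open>H\<close>.\<close>

lemma exists_close_pair:
  fixes H :: "int set"
  assumes H: "H \<subseteq> {1..int X}" and \<epsilon>: "\<epsilon> > 0" and card: "real (card H) \<ge> \<epsilon> * real X" and X: "\<epsilon> * real X > 2"
  shows "\<exists>h\<in>H. \<exists>h'\<in>H. h < h' \<and> real_of_int (h' - h) \<le> 2 / \<epsilon>"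
proof (rule ccontr)
  assume neg: "\<not> ?thesis"
  let ?f = "\<lambda>h::int. \<lfloor>of_int h * (\<epsilon> / 2)\<rfloor>"
  have fin: "finite H" using H finite_subset by blast
  have aux: "\<not> ?f h = ?f h'" if "h \<in> H" "h' \<in> H" "h < h'" for h h'
  proof
    assume "?f h = ?f h'"
    then have "real_of_int (h' - h) * (\<epsilon> / 2) < 1" by (simp add: left_diff_distrib) linarith
    then have "real_of_int (h' - h) < 2 / \<epsilon>" using \<epsilon> by (simp add: field_simps)
    then show False using neg that by force
  qed
  have "inj_on ?f H" by (rule inj_onI) (metis aux linorder_neqE)
  moreover have "?f ` H \<subseteq> {0..\<lfloor>real X * (\<epsilon> / 2)\<rfloor>}"
  proof
    fix y assume "y \<in> ?f ` H"
    then obtain h where h: "h \<in> H" "y = ?f h" by blast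
    then have "1 \<le> h" "h \<le> int X" using H by auto
    then have "real_of_int h * (\<epsilon> / 2) \<le> real X * (\<epsilon> / 2)" "real_of_int h * (\<epsilon> / 2) \<ge> 0"
      using \<epsilon> by (auto intro!: mult_right_mono)
    then show "y \<in> {0..\<lfloor>real X * (\<epsilon> / 2)\<rfloor>}" unfolding h(2) by (auto intro: floor_mono)
  qed
  ultimately have "card H \<le> card {0..\<lfloor>real X * (\<epsilon> / 2)\<rfloor>}" by (metis card_inj_on_le finite_atLeastAtMost_int)
  then have "real (card H) \<le> real X * (\<epsilon> / 2) + 1"
    using \<epsilon> by (simp add: le_nat_iff) linarith
  with card X show False by (simp add: field_simps)
qed

text \<open>If \<open>h \<beta>\<close> is close to an integer for a positive proportion of the \<open>h \<le> X\<close>, then \<open>\<beta>\<close> is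
  extremely close to a rational of small denominator: two such \<open>h\<close> have a small difference \<open>d\<close>, and
  the points of one residue class modulo \<open>d\<close> drift slowly, spending too little time near integers
  unless \<open>d \<beta>\<close> is within \<open>O(\<xi> / X)\<close> of an integer.\<close>

lemma strong_recurrence:
  fixes H :: "int set"
  assumes H: "H \<subseteq> {1..int X}" and \<epsilon>: "0 < \<epsilon>" "\<epsilon> \<le> 1" and card: "real (card H) \<ge> \<epsilon> * real X"
    and X: "real X \<ge> 16 / \<epsilon>\<^sup>2" and \<xi>: "0 < \<xi>" "\<xi> \<le> \<epsilon> / 16"
    and near: "\<And>h. h \<in> H \<Longrightarrow> near_int \<xi> (of_int h * \<beta>)"
  shows "\<exists>d::nat. 1 \<le> d \<and> real d \<le> 2 / \<epsilon> \<and> near_int (16 * \<xi> / (\<epsilon>\<^sup>2 * real X)) (real d * \<beta>)"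
proof -
  have fin: "finite H" using H finite_subset by blast
  have \<epsilon>X: "\<epsilon> * real X \<ge> 16 / \<epsilon>"
    using mult_left_mono[OF X, of \<epsilon>] \<epsilon> by (simp add: power2_eq_square)
  moreover have "16 / \<epsilon> \<ge> 16" using \<epsilon> by (simp add: field_simps)
  ultimately have "\<epsilon> * real X > 2" by linarith
  from exists_close_pair[OF H \<epsilon>(1) card this] obtain h1 h2 where
    h12: "h1 \<in> H" "h2 \<in> H" "h1 < h2" "real_of_int (h2 - h1) \<le> 2 / \<epsilon>" by blast
  define d where "d = h2 - h1"
  have d: "d \<ge> 1" "real_of_int d \<le> 2 / \<epsilon>" using h12 by (auto simp: d_def)
  obtain a1 a2 :: int where a12: "\<bar>of_int h1 * \<beta> - of_int a1\<bar> \<le> \<xi>" "\<bar>of_int h2 * \<beta> - of_int a2\<bar> \<le> \<xi>"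
    using near[OF h12(1)] near[OF h12(2)] unfolding near_int_def by blast
  define b where "b = a2 - a1"
  \<comment> \<open>Along a residue class modulo \<open>d\<close> the sequence h \<beta> moves by
    \<gamma> modulo 1 at each step; this drift is to be bounded.\<close>
  define \<gamma> where "\<gamma> = of_int d * \<beta> - of_int b"
  have \<gamma>: "\<bar>\<gamma>\<bar> \<le> 2 * \<xi>" using a12 unfolding \<gamma>_def d_def b_def by (simp add: left_diff_distrib)
  have Xpos: "real X > 0" using X \<epsilon> by (smt (verit) divide_pos_pos zero_less_power)
  have goal: "\<bar>\<gamma>\<bar> \<le> 8 * of_int d * \<xi> / (\<epsilon> * real X)"
  proof (cases "\<gamma> = 0")
    case True
    then show ?thesis using d \<epsilon> \<xi> by simp
  next
    case False
    have "\<exists>r\<in>{0..<d}. real (card {h \<in> H. h mod d = r}) \<ge> \<epsilon> * real X / of_int d"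
    proof (rule ccontr)
      assume "\<not> ?thesis"
      then have lt: "real (card {h \<in> H. h mod d = r}) < \<epsilon> * real X / of_int d" if "r \<in> {0..<d}" for r
        using that by force
      have "H = (\<Union>r\<in>{0..<d}. {h \<in> H. h mod d = r})" using d by auto
      then have "card H \<le> (\<Sum>r\<in>{0..<d}. card {h \<in> H. h mod d = r})"
        using card_UN_le[of "{0..<d}" "\<lambda>r. {h \<in> H. h mod d = r}"] by simp
      then have "real (card H) \<le> (\<Sum>r\<in>{0..<d}. real (card {h \<in> H. h mod d = r}))"
        by (metis of_nat_le_iff of_nat_sum)
      also have "\<dots> < (\<Sum>r\<in>{0..<d}. \<epsilon> * real X / of_int d)"
        using d by (intro sum_strict_mono lt) auto
      also have "\<dots> = \<epsilon> * real X" using d by simp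
      finally show False using card by simp
    qed
    then obtain r where r: "real (card {h \<in> H. h mod d = r}) \<ge> \<epsilon> * real X / of_int d" by blast
    define Hr where "Hr = {h \<in> H. h mod d = r}"
    have finHr: "finite Hr" using fin by (simp add: Hr_def)
    define j where "j h = h div d" for h
    have hj: "h = j h * d + r" if "h \<in> Hr" for h using that by (auto simp: j_def Hr_def)
    have jX: "real_of_int \<bar>j h - j h'\<bar> \<le> real X / of_int d" if "h \<in> Hr" "h' \<in> Hr" for h h'
    proof -
      have "(j h - j h') * d = h - h'" using hj[OF that(1)] hj[OF that(2)] by (simp add: algebra_simps)
      then have "\<bar>j h - j h'\<bar> * d = \<bar>h - h'\<bar>" using d by (metis abs_mult abs_of_pos zero_less_one order_less_le_trans)
      also have "\<dots> \<le> int X"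
      proof -
        have "h \<in> {1..int X}" "h' \<in> {1..int X}" using that H by (auto simp: Hr_def)
        then show ?thesis by auto
      qed
      finally have "real_of_int (\<bar>j h - j h'\<bar> * d) \<le> real X" by linarith
      then show ?thesis using d by (simp add: field_simps)
    qed
    have "\<forall>h\<in>Hr. \<exists>a::int. \<bar>of_int h * \<beta> - of_int a\<bar> \<le> \<xi>"
      using near by (auto simp: Hr_def near_int_def)
    then obtain a :: "int \<Rightarrow> int" where a: "\<And>h. h \<in> Hr \<Longrightarrow> \<bar>of_int h * \<beta> - of_int (a h)\<bar> \<le> \<xi>" by metis
    \<comment> \<open>The integer approached by r \<beta> + j \<gamma>, once the integral part j b
      is removed from j d \<beta>.\<close>
    define A where "A h = a h - j h * b" for h
    have A: "\<bar>of_int r * \<beta> + of_int (j h) * \<gamma> - of_int (A h)\<bar> \<le> \<xi>" if "h \<in> Hr" for h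
    proof -
      have "of_int h * \<beta> = of_int (j h) * (of_int d * \<beta>) + of_int r * \<beta>"
        by (subst hj[OF that]) (simp add: algebra_simps)
      then have "of_int r * \<beta> + of_int (j h) * \<gamma> - of_int (A h) = of_int h * \<beta> - of_int (a h)"
        by (simp add: \<gamma>_def A_def algebra_simps)
      then show ?thesis using a[OF that] by simp
    qed
    \<comment> \<open>An arithmetic progression with step \<gamma> stays within \<xi> of one integer
      for at most 2 \<xi> / |\<gamma>| + 1 terms; \<open>rangeA\<close> bounds the number of
      integers reached by the total drift.\<close>
    have fiber: "real (card {h \<in> Hr. A h = v}) \<le> 2 * \<xi> / \<bar>\<gamma>\<bar> + 1" for v
    proof -
      have inj: "inj_on j {h \<in> Hr. A h = v}" by (rule inj_onI) (metis hj mem_Collect_eq)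
      have "real (card (j ` {h \<in> Hr. A h = v})) \<le> 2 * \<xi> / \<bar>\<gamma>\<bar> + 1"
      proof (rule card_le_diameter)
        fix x y assume "x \<in> j ` {h \<in> Hr. A h = v}" "y \<in> j ` {h \<in> Hr. A h = v}"
        then obtain h h' where "h \<in> Hr" "A h = v" "x = j h" "h' \<in> Hr" "A h' = v" "y = j h'" by blast
        then have "\<bar>of_int r * \<beta> + of_int x * \<gamma> - of_int v\<bar> \<le> \<xi>" "\<bar>of_int r * \<beta> + of_int y * \<gamma> - of_int v\<bar> \<le> \<xi>"
          using A[of h] A[of h'] by simp_all
        then have "\<bar>of_int x * \<gamma> - of_int y * \<gamma>\<bar> \<le> 2 * \<xi>" by linarith
        then have "real_of_int \<bar>x - y\<bar> * \<bar>\<gamma>\<bar> \<le> 2 * \<xi>" by (simp add: left_diff_distrib[symmetric] abs_mult)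
        then show "real_of_int \<bar>x - y\<bar> \<le> 2 * \<xi> / \<bar>\<gamma>\<bar>" using False by (simp add: field_simps)
      qed (use finHr \<xi> in auto)
      then show ?thesis by (simp add: card_image[OF inj])
    qed
    have rangeA: "real (card (A ` Hr)) \<le> \<bar>\<gamma>\<bar> * (real X / of_int d) + 2 * \<xi> + 1"
    proof (rule card_le_diameter)
      fix x y assume "x \<in> A ` Hr" "y \<in> A ` Hr"
      then obtain h h' where h: "h \<in> Hr" "h' \<in> Hr" "x = A h" "y = A h'" by blast
      have "\<bar>(of_int (j h) - of_int (j h')) * \<gamma>\<bar> \<le> real X / of_int d * \<bar>\<gamma>\<bar>"
        using mult_right_mono[OF jX[OF h(1,2)], of "\<bar>\<gamma>\<bar>"] by (simp add: abs_mult)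
      then have "\<bar>of_int (j h) * \<gamma> - of_int (j h') * \<gamma>\<bar> \<le> \<bar>\<gamma>\<bar> * (real X / of_int d)"
        unfolding left_diff_distrib by (simp only: mult.commute)
      then show "real_of_int \<bar>x - y\<bar> \<le> \<bar>\<gamma>\<bar> * (real X / of_int d) + 2 * \<xi>"
        using A[OF h(1)] A[OF h(2)] unfolding h(3,4) by (simp add: abs_le_iff)
    qed (use finHr \<xi> d in auto)
    have "Hr = (\<Union>v\<in>A ` Hr. {h \<in> Hr. A h = v})" by auto
    then have "card Hr \<le> (\<Sum>v\<in>A ` Hr. card {h \<in> Hr. A h = v})"
      using card_UN_le[of "A ` Hr" "\<lambda>v. {h \<in> Hr. A h = v}"] finHr by simp
    then have "real (card Hr) \<le> (\<Sum>v\<in>A ` Hr. real (card {h \<in> Hr. A h = v}))"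
      by (metis of_nat_le_iff of_nat_sum)
    also have "\<dots> \<le> (\<Sum>v\<in>A ` Hr. 2 * \<xi> / \<bar>\<gamma>\<bar> + 1)" by (intro sum_mono fiber)
    also have "\<dots> = real (card (A ` Hr)) * (2 * \<xi> / \<bar>\<gamma>\<bar> + 1)" by simp
    also have "\<dots> \<le> (\<bar>\<gamma>\<bar> * (real X / of_int d) + 2 * \<xi> + 1) * (2 * \<xi> / \<bar>\<gamma>\<bar> + 1)"
      using \<xi> by (intro mult_right_mono rangeA) auto
    also have "\<dots> = 2 * \<xi> * (real X / of_int d) + \<bar>\<gamma>\<bar> * (real X / of_int d) + (2 * \<xi> + 1) * (2 * \<xi> / \<bar>\<gamma>\<bar> + 1)"
    proof -
      have "(g * z + 2 * \<xi> + 1) * (2 * \<xi> / g + 1) = 2 * \<xi> * z + g * z + (2 * \<xi> + 1) * (2 * \<xi> / g + 1)"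
        if "g \<noteq> 0" for g z :: real using that by (simp add: field_simps)
      from this[of "\<bar>\<gamma>\<bar>" "real X / of_int d"] show ?thesis using False by linarith
    qed
    also have "\<dots> \<le> 2 * \<xi> * (real X / of_int d) + 2 * \<xi> * (real X / of_int d) + 2 * (2 * \<xi> / \<bar>\<gamma>\<bar> + 1)"
      using \<gamma> \<xi> \<epsilon> d by (intro add_mono mult_right_mono order_refl) auto
    also have "\<dots> = 4 * \<xi> * (real X / of_int d) + 2 + 4 * \<xi> / \<bar>\<gamma>\<bar>" by simp
    \<comment> \<open>The terms free of 1 / |\<gamma>| are absorbed by half of the \<epsilon> X / d
      points that \<open>r\<close> guarantees; what is left bounds |\<gamma>|.\<close>
    also have "\<dots> \<le> \<epsilon> / 4 * (real X / of_int d) + \<epsilon> / 4 * (real X / of_int d) + 4 * \<xi> / \<bar>\<gamma>\<bar>"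
    proof (intro add_mono order_refl mult_right_mono)
      have "2 * of_int d \<le> 4 / \<epsilon>" using d by simp
      also have "\<dots> \<le> \<epsilon> / 4 * real X" using \<epsilon>X by simp
      finally show "2 \<le> \<epsilon> / 4 * (real X / of_int d)" using d by (simp add: field_simps)
    qed (use \<xi> d in auto)
    finally have "\<epsilon> / 2 * (real X / of_int d) \<le> 4 * \<xi> / \<bar>\<gamma>\<bar>"
      using r unfolding Hr_def[symmetric] by (simp add: field_simps)
    then show ?thesis using False d \<epsilon> Xpos by (simp add: field_simps)
  qed
  have "8 * of_int d * \<xi> / (\<epsilon> * real X) \<le> 8 * (2 / \<epsilon>) * \<xi> / (\<epsilon> * real X)"
    using d \<xi> \<epsilon> by (intro divide_right_mono mult_right_mono mult_left_mono) auto
  also have "\<dots> = 16 * \<xi> / (\<epsilon>\<^sup>2 * real X)" by (simp add: power2_eq_square)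
  finally have "\<bar>\<gamma>\<bar> \<le> 16 * \<xi> / (\<epsilon>\<^sup>2 * real X)" using goal by linarith
  then show ?thesis
    using d unfolding near_int_def \<gamma>_def by (intro exI[of _ "nat d"]) auto
qed

text \<open>Encodes, without mentioning polynomials, that \<phi> has degree at most \<open>k\<close>
  and that k! times its coefficient in degree \<open>k\<close> is \<alpha>. One differencing step is
  one unfolding of the recursion.\<close>

fun phase :: "nat \<Rightarrow> real \<Rightarrow> (int \<Rightarrow> real) \<Rightarrow> bool" where
  "phase 0 \<alpha> \<phi> \<longleftrightarrow> (\<forall>n. \<phi> n = \<alpha>)"
| "phase (Suc k) \<alpha> \<phi> \<longleftrightarrow> (\<forall>h. phase k (of_int h * \<alpha>) (\<lambda>n. \<phi> (n + h) - \<phi> n))"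

text \<open>Weyl differencing: expand the square and group the pairs by their difference
  \<open>h\<close>. The inner sums run over shortened intervals, so later bounds have to be uniform
  in the interval.\<close>

lemma norm_ee_sum_square_le:
  fixes a b :: int
  assumes X: "b - a \<le> int X"
  shows "(norm (\<Sum>n\<in>{a..<b}. ee (\<phi> n)))\<^sup>2
     \<le> (\<Sum>h\<in>{- int X<..<int X}. norm (\<Sum>n\<in>{max a (a - h)..<min b (b - h)}. ee (\<phi> (n + h) - \<phi> n)))"
proof -
  let ?S = "\<Sum>n\<in>{a..<b}. ee (\<phi> n)"
  have "complex_of_real ((norm ?S)\<^sup>2) = ?S * cnj ?S" by (rule complex_norm_square)
  also have "\<dots> = (\<Sum>n\<in>{a..<b}. \<Sum>m\<in>{a..<b}. ee (\<phi> m - \<phi> n))"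
    by (subst sum.swap) (simp add: cnj_sum sum_product ee_diff)
  also have "\<dots> = (\<Sum>n\<in>{a..<b}. \<Sum>h\<in>{- int X<..<int X}. if n + h \<in> {a..<b} then ee (\<phi> (n + h) - \<phi> n) else 0)"
  proof (rule sum.cong[OF refl])
    fix n assume n: "n \<in> {a..<b}"
    have "(\<Sum>h\<in>{- int X<..<int X}. if n + h \<in> {a..<b} then ee (\<phi> (n + h) - \<phi> n) else 0)
       = (\<Sum>h\<in>{h \<in> {- int X<..<int X}. n + h \<in> {a..<b}}. ee (\<phi> (n + h) - \<phi> n))"
      by (rule sum.inter_filter[symmetric]) simp
    also have "\<dots> = (\<Sum>m\<in>{a..<b}. ee (\<phi> m - \<phi> n))"
      using n X by (intro sum.reindex_bij_witness[of _ "\<lambda>m. m - n" "\<lambda>h. n + h"]) auto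
    finally show "(\<Sum>m\<in>{a..<b}. ee (\<phi> m - \<phi> n))
       = (\<Sum>h\<in>{- int X<..<int X}. if n + h \<in> {a..<b} then ee (\<phi> (n + h) - \<phi> n) else 0)" ..
  qed
  also have "\<dots> = (\<Sum>h\<in>{- int X<..<int X}. \<Sum>n\<in>{a..<b}. if n + h \<in> {a..<b} then ee (\<phi> (n + h) - \<phi> n) else 0)"
    by (rule sum.swap)
  also have "\<dots> = (\<Sum>h\<in>{- int X<..<int X}. \<Sum>n\<in>{max a (a - h)..<min b (b - h)}. ee (\<phi> (n + h) - \<phi> n))"
  proof (rule sum.cong[OF refl])
    fix h
    have "{n \<in> {a..<b}. n + h \<in> {a..<b}} = {max a (a - h)..<min b (b - h)}" by auto
    then show "(\<Sum>n\<in>{a..<b}. if n + h \<in> {a..<b} then ee (\<phi> (n + h) - \<phi> n) else 0)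
      = (\<Sum>n\<in>{max a (a - h)..<min b (b - h)}. ee (\<phi> (n + h) - \<phi> n))"
      by (simp add: sum.inter_filter[symmetric])
  qed
  finally have "(norm ?S)\<^sup>2 = norm (\<Sum>h\<in>{- int X<..<int X}. \<Sum>n\<in>{max a (a - h)..<min b (b - h)}. ee (\<phi> (n + h) - \<phi> n))"
    by (metis norm_of_real abs_power2)
  then show ?thesis by (simp add: norm_sum)
qed

lemma norm_ee_sum_le:
  fixes a b :: int
  assumes "b - a \<le> int X"
  shows "norm (\<Sum>n\<in>{a..<b}. ee (\<phi> n)) \<le> real X"
proof -
  have "norm (\<Sum>n\<in>{a..<b}. ee (\<phi> n)) \<le> (\<Sum>n\<in>{a..<b}. norm (ee (\<phi> n)))" by (rule norm_sum)
  also have "\<dots> = real (nat (b - a))" by simp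
  also have "\<dots> \<le> real X" using assms by simp
  finally show ?thesis .
qed

text \<open>A large sum forces a positive proportion of the differenced sums to be large. For each
  such \<open>h\<close> the case of degree \<open>k\<close> yields a bounded \<open>q\<close> with q
  h \<alpha> near an integer; after fixing one frequent \<open>q\<close>,
  \<open>strong_recurrence\<close> in the variable \<open>h\<close> gains the missing factor
  X.\<close>

lemma weyl_step:
  fixes \<epsilon> :: real
  assumes k: "k \<ge> 1" and \<epsilon>: "0 < \<epsilon>" "\<epsilon> \<le> 1"
    and IH: "\<And>\<epsilon>::real. 0 < \<epsilon> \<Longrightarrow> \<epsilon> \<le> 1 \<Longrightarrow> \<exists>Q::nat. \<forall>X::nat. \<forall>\<alpha> \<phi> a b. X \<ge> 1 \<longrightarrow> phase k \<alpha> \<phi> \<longrightarrow> b - a \<le> int X \<longrightarrow>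
      norm (\<Sum>n\<in>{a..<b}. ee (\<phi> n)) \<ge> \<epsilon> * real X \<longrightarrow> (\<exists>q\<in>{1..Q}. near_int (real Q / real X ^ k) (real q * \<alpha>))"
  shows "\<exists>Q::nat. \<forall>X::nat. \<forall>\<alpha> \<phi> a b. X \<ge> 1 \<longrightarrow> phase (Suc k) \<alpha> \<phi> \<longrightarrow> b - a \<le> int X \<longrightarrow>
      norm (\<Sum>n\<in>{a..<b}. ee (\<phi> n)) \<ge> \<epsilon> * real X \<longrightarrow> (\<exists>q\<in>{1..Q}. near_int (real Q / real X ^ Suc k) (real q * \<alpha>))"
proof -
  have e4: "0 < \<epsilon>\<^sup>2 / 4" "\<epsilon>\<^sup>2 / 4 \<le> 1" "\<epsilon>\<^sup>2 \<le> 1" using \<epsilon> by (auto simp: power_le_one intro: order_trans[of _ 1])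
  from IH[OF e4(1,2)] obtain Q0 where Q0: "\<forall>X::nat. \<forall>\<alpha> \<phi> a b. X \<ge> 1 \<longrightarrow> phase k \<alpha> \<phi> \<longrightarrow> b - a \<le> int X \<longrightarrow>
      norm (\<Sum>n\<in>{a..<b}. ee (\<phi> n)) \<ge> \<epsilon>\<^sup>2 / 4 * real X \<longrightarrow> (\<exists>q\<in>{1..Q0}. near_int (real Q0 / real X ^ k) (real q * \<alpha>))" ..
  define Q1 where "Q1 = max 1 Q0"
  have Q1: "\<exists>q\<in>{1..Q1}. near_int (real Q1 / real X ^ k) (real q * \<alpha>)"
    if X: "X \<ge> 1" and ph: "phase k \<alpha> \<phi>" and ab: "b - a \<le> int X" and big: "norm (\<Sum>n\<in>{a..<b}. ee (\<phi> n)) \<ge> \<epsilon>\<^sup>2 / 4 * real X" for X \<alpha> \<phi> a b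
  proof -
    obtain q where q: "q \<in> {1..Q0}" "near_int (real Q0 / real X ^ k) (real q * \<alpha>)"
      using Q0[rule_format, OF X ph ab big] ..
    have "near_int (real Q1 / real X ^ k) (real q * \<alpha>)"
      by (rule near_int_mono[OF q(2)]) (simp add: Q1_def divide_right_mono)
    then show ?thesis using q(1) unfolding Q1_def by (intro bexI[of _ q]) auto
  qed
  have Q1pos: "Q1 \<ge> 1" by (simp add: Q1_def)
  \<comment> \<open>The share of \<open>h\<close> that survives discarding 0, identifying h with -h
    and choosing one of \<open>Q1\<close> denominators.\<close>
  define \<epsilon>2 where "\<epsilon>2 = \<epsilon>\<^sup>2 / (8 * real Q1)"
  have \<epsilon>2: "0 < \<epsilon>2" "\<epsilon>2 \<le> 1" using \<epsilon> e4 Q1pos by (auto simp: \<epsilon>2_def divide_le_eq)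
  define X0 where "X0 = nat \<lceil>4 / \<epsilon>\<^sup>2 + 16 / \<epsilon>2\<^sup>2 + 16 * real Q1 / \<epsilon>2\<rceil>"
  have X0: "real X \<ge> 4 / \<epsilon>\<^sup>2" "real X \<ge> 16 / \<epsilon>2\<^sup>2" "real X \<ge> 16 * real Q1 / \<epsilon>2" if "X \<ge> X0" for X
  proof -
    have "0 \<le> 4 / \<epsilon>\<^sup>2" "0 \<le> 16 / \<epsilon>2\<^sup>2" "0 \<le> 16 * real Q1 / \<epsilon>2" using \<epsilon>2 by auto
    moreover have "real X \<ge> 4 / \<epsilon>\<^sup>2 + 16 / \<epsilon>2\<^sup>2 + 16 * real Q1 / \<epsilon>2" using that unfolding X0_def by linarith
    ultimately show "real X \<ge> 4 / \<epsilon>\<^sup>2" "real X \<ge> 16 / \<epsilon>2\<^sup>2" "real X \<ge> 16 * real Q1 / \<epsilon>2" by linarith+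
  qed
  define K where "K = nat \<lceil>2 / \<epsilon>2\<rceil>"
  define L where "L = nat \<lceil>16 * real Q1 / \<epsilon>2\<^sup>2\<rceil>"
  \<comment> \<open>The summand X0^(k+1) makes the claim trivial for X < X0, since the tolerance
    then reaches 1; K Q1 bounds the product of the two denominators and \<open>L\<close> the loss in
    \<open>strong_recurrence\<close>.\<close>
  define Q where "Q = 1 + X0 ^ Suc k + K * Q1 + L"
  have main: "\<exists>q\<in>{1..Q}. near_int (real Q / real X ^ Suc k) (real q * \<alpha>)"
    if X: "X \<ge> 1" and ph: "phase (Suc k) \<alpha> \<phi>" and ab: "b - a \<le> int X"
      and big: "norm (\<Sum>n\<in>{a..<b}. ee (\<phi> n)) \<ge> \<epsilon> * real X" for X \<alpha> \<phi> a b
  proof (cases "X \<ge> X0")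
    case False
    then have "X ^ Suc k \<le> Q" using power_mono[of X X0 "Suc k"] by (simp add: Q_def)
    then have "real (X ^ Suc k) \<le> real Q" by (rule of_nat_mono)
    then have "real Q / real X ^ Suc k \<ge> 1" using X by (simp add: le_divide_eq)
    then show ?thesis using near_int_1 by (intro bexI[of _ 1]) (auto simp: Q_def)
  next
    case True
    note X0' = X0[OF True]
    let ?S = "\<lambda>h. \<Sum>n\<in>{max a (a - h)..<min b (b - h)}. ee (\<phi> (n + h) - \<phi> n)"
    define G where "G = {h \<in> {- int X<..<int X}. norm (?S h) \<ge> \<epsilon>\<^sup>2 / 4 * real X}"
    define H where "H = {h \<in> {1..int X}. \<exists>q\<in>{1..Q1}. near_int (real Q1 / real X ^ k) (real q * (of_int h * \<alpha>))}"
    have finH: "finite H" by (rule finite_subset[of _ "{1..int X}"]) (auto simp: H_def)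
    have "(\<epsilon> * real X)\<^sup>2 \<le> (norm (\<Sum>n\<in>{a..<b}. ee (\<phi> n)))\<^sup>2" using big \<epsilon> by (intro power_mono) auto
    also have "\<dots> \<le> (\<Sum>h\<in>{- int X<..<int X}. norm (?S h))" by (rule norm_ee_sum_square_le[OF ab])
    also have "\<dots> \<le> (\<Sum>h\<in>{- int X<..<int X}. (if h \<in> G then real X else 0) + \<epsilon>\<^sup>2 / 4 * real X)"
    proof (intro sum_mono)
      fix h assume h: "h \<in> {- int X<..<int X}"
      have "norm (?S h) \<le> real X" using ab by (intro norm_ee_sum_le) auto
      moreover have "0 \<le> \<epsilon>\<^sup>2 / 4 * real X" using e4 by simp
      ultimately have bounds: "norm (?S h) \<le> real X" "0 \<le> \<epsilon>\<^sup>2 / 4 * real X" .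
      show "norm (?S h) \<le> (if h \<in> G then real X else 0) + \<epsilon>\<^sup>2 / 4 * real X"
      proof (cases "h \<in> G")
        case True
        then have "(if h \<in> G then real X else 0) = real X" by simp
        then show ?thesis using bounds by linarith
      next
        case False
        then have "norm (?S h) < \<epsilon>\<^sup>2 / 4 * real X" using h unfolding G_def by auto
        with False show ?thesis by simp
      qed
    qed
    also have "\<dots> = real (card G) * real X + real (card {- int X<..<int X}) * (\<epsilon>\<^sup>2 / 4 * real X)"
    proof -
      have "(\<Sum>h\<in>{- int X<..<int X}. if h \<in> G then real X else 0) = (\<Sum>h\<in>G. real X)"
        by (intro sum.mono_neutral_cong_right) (auto simp: G_def)
      then show ?thesis by (simp add: sum.distrib)
    qed
    also have "\<dots> \<le> real (card G) * real X + (2 * real X) * (\<epsilon>\<^sup>2 / 4 * real X)"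
      using e4 X by (intro add_mono mult_right_mono order_refl) auto
    finally have "(\<epsilon>\<^sup>2 / 2 * real X) * real X \<le> real (card G) * real X"
      by (simp add: power2_eq_square algebra_simps)
    then have cG: "\<epsilon>\<^sup>2 / 2 * real X \<le> real (card G)" using X by (simp add: mult_le_cancel_right)
    \<comment> \<open>Conjugate sums belong to \<open>h\<close> and \<open>-h\<close>, but only
      nearness to integers is symmetric in the code; reflecting costs a factor 2 and h = 0 one
      element.\<close>
    have GH: "G \<subseteq> insert 0 (H \<union> uminus ` H)"
    proof
      fix h assume h: "h \<in> G"
      have "phase k (of_int h * \<alpha>) (\<lambda>n. \<phi> (n + h) - \<phi> n)" using ph by simp
      moreover have "min b (b - h) - max a (a - h) \<le> int X" using ab by auto
      ultimately obtain q where q: "q \<in> {1..Q1}" "near_int (real Q1 / real X ^ k) (real q * (of_int h * \<alpha>))"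
        using Q1[OF X] h unfolding G_def by blast
      consider "h = 0" | "h > 0" | "h < 0" by linarith
      then show "h \<in> insert 0 (H \<union> uminus ` H)"
      proof cases
        case 2
        then show ?thesis using h q by (auto simp: H_def G_def)
      next
        case 3
        have "near_int (real Q1 / real X ^ k) (real q * (of_int (- h) * \<alpha>))"
          using near_int_minus[OF q(2)] by simp
        then have "- h \<in> H" using h q(1) 3 unfolding H_def G_def by auto
        then show ?thesis by force
      qed simp
    qed
    have "card G \<le> card (insert 0 (H \<union> uminus ` H))" using finH by (intro card_mono GH) auto
    also have "\<dots> \<le> Suc (card (H \<union> uminus ` H))" using finH by (intro card_insert_le_m1) auto
    also have "\<dots> \<le> Suc (card H + card (uminus ` H))" using card_Un_le by auto
    also have "\<dots> \<le> Suc (card H + card H)" using card_image_le[OF finH] by auto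
    finally have "real (card G) \<le> 1 + 2 * real (card H)" by linarith
    moreover have "\<epsilon>\<^sup>2 * real X \<ge> 4" using X0'(1) \<epsilon> by (simp add: divide_le_eq mult.commute)
    ultimately have cH: "real (card H) \<ge> \<epsilon>\<^sup>2 / 8 * real X" using cG by linarith
    define Hq where "Hq q = {h \<in> {1..int X}. near_int (real Q1 / real X ^ k) (real q * (of_int h * \<alpha>))}" for q :: nat
    have "\<exists>q\<in>{1..Q1}. real (card (Hq q)) \<ge> \<epsilon>2 * real X"
    proof (rule ccontr)
      assume "\<not> ?thesis"
      then have lt: "real (card (Hq q)) < \<epsilon>2 * real X" if "q \<in> {1..Q1}" for q using that by force
      have "H = (\<Union>q\<in>{1..Q1}. Hq q)" by (auto simp: H_def Hq_def)
      then have "card H \<le> (\<Sum>q\<in>{1..Q1}. card (Hq q))" using card_UN_le[of "{1..Q1}" Hq] by simp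
      then have "real (card H) \<le> (\<Sum>q\<in>{1..Q1}. real (card (Hq q)))" by (metis of_nat_le_iff of_nat_sum)
      also have "\<dots> < (\<Sum>q\<in>{1..Q1}. \<epsilon>2 * real X)" using Q1pos by (intro sum_strict_mono lt) auto
      also have "\<dots> = \<epsilon>\<^sup>2 / 8 * real X" using Q1pos by (simp add: \<epsilon>2_def)
      finally show False using cH by simp
    qed
    then obtain q where q: "q \<in> {1..Q1}" "real (card (Hq q)) \<ge> \<epsilon>2 * real X" ..
    define \<xi> where "\<xi> = real Q1 / real X ^ k"
    have \<xi>pos: "\<xi> > 0" using Q1pos X by (simp add: \<xi>_def)
    have "\<xi> \<le> real Q1 / real X ^ 1"
      unfolding \<xi>_def using X k by (intro divide_left_mono power_increasing) auto
    also have "\<dots> \<le> \<epsilon>2 / 16" using X0'(3) X \<epsilon>2 by (simp add: field_simps)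
    finally have \<xi>le: "\<xi> \<le> \<epsilon>2 / 16" .
    have "\<exists>d::nat. 1 \<le> d \<and> real d \<le> 2 / \<epsilon>2 \<and> near_int (16 * \<xi> / (\<epsilon>2\<^sup>2 * real X)) (real d * (real q * \<alpha>))"
    proof (rule strong_recurrence[OF _ \<epsilon>2 q(2) X0'(2) \<xi>pos \<xi>le])
      show "Hq q \<subseteq> {1..int X}" by (auto simp: Hq_def)
      show "near_int \<xi> (of_int h * (real q * \<alpha>))" if "h \<in> Hq q" for h
        using that by (simp add: Hq_def \<xi>_def mult_ac)
    qed
    then obtain d :: nat where d: "1 \<le> d" "real d \<le> 2 / \<epsilon>2" "near_int (16 * \<xi> / (\<epsilon>2\<^sup>2 * real X)) (real d * (real q * \<alpha>))" by blast
    have "d \<le> K" using d(2) unfolding K_def by linarith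
    then have dq: "d * q \<in> {1..Q}" using d(1) q(1) mult_mono[of d K q Q1] by (auto simp: Q_def)
    have "16 * \<xi> / (\<epsilon>2\<^sup>2 * real X) = (16 * real Q1 / \<epsilon>2\<^sup>2) / real X ^ Suc k" by (simp add: \<xi>_def)
    also have "\<dots> \<le> real Q / real X ^ Suc k"
    proof (rule divide_right_mono)
      have "16 * real Q1 / \<epsilon>2\<^sup>2 \<le> real L" unfolding L_def by linarith
      also have "\<dots> \<le> real Q" by (simp add: Q_def)
      finally show "16 * real Q1 / \<epsilon>2\<^sup>2 \<le> real Q" .
    qed simp
    finally show ?thesis using d(3) dq near_int_mono by (intro bexI[of _ "d * q"]) (auto simp: mult_ac)
  qed
  then show ?thesis by (intro exI[of _ Q]) blast
qed

text \<open>Induction on the degree: a linear phase gives a geometric sum, for which q = 1 works.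
  The bound \<open>Q\<close> on denominators does not depend on X, so a fixed factorial clears all
  of them.\<close>

theorem weyl_inverse:
  fixes \<epsilon> :: real
  assumes k: "k \<ge> 1" and \<epsilon>: "0 < \<epsilon>" "\<epsilon> \<le> 1"
  shows "\<exists>Q::nat. \<forall>X::nat. \<forall>\<alpha> \<phi> a b. X \<ge> 1 \<longrightarrow> phase k \<alpha> \<phi> \<longrightarrow> b - a \<le> int X \<longrightarrow>
      norm (\<Sum>n\<in>{a..<b}. ee (\<phi> n)) \<ge> \<epsilon> * real X \<longrightarrow> (\<exists>q\<in>{1..Q}. near_int (real Q / real X ^ k) (real q * \<alpha>))"
  using k \<epsilon>
proof (induction k arbitrary: \<epsilon> rule: nat_induct_at_least)
  case base
  define Q where "Q = nat \<lceil>3 / \<epsilon>\<rceil>"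
  have Q: "real Q \<ge> 3 / \<epsilon>" "Q \<ge> 1"
  proof -
    show 1: "real Q \<ge> 3 / \<epsilon>" unfolding Q_def by linarith
    have "3 / \<epsilon> > 0" using base by simp
    with 1 show "Q \<ge> 1" by linarith
  qed
  have "near_int (real Q / real X ^ 1) (real 1 * \<alpha>)"
    if X: "X \<ge> 1" and ph: "phase 1 \<alpha> \<phi>" and big: "norm (\<Sum>n\<in>{a..<b}. ee (\<phi> n)) \<ge> \<epsilon> * real X" for X \<alpha> \<phi> a b
  proof (rule ccontr)
    assume far: "\<not> near_int (real Q / real X ^ 1) (real 1 * \<alpha>)"
    have \<phi>: "\<phi> n = \<phi> 0 + of_int n * \<alpha>" for n
    proof -
      have "\<forall>h m. \<phi> (m + h) - \<phi> m = of_int h * \<alpha>" using ph by simp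
      then have "\<phi> (0 + n) - \<phi> 0 = of_int n * \<alpha>" by blast
      then show ?thesis by simp
    qed
    have "norm (\<Sum>n\<in>{a..<b}. ee (\<phi> 0 + of_int n * \<alpha>)) \<le> 2 / (real Q / real X)"
      using far X Q by (intro norm_geometric_ee_le) auto
    moreover have "(\<Sum>n\<in>{a..<b}. ee (\<phi> n)) = (\<Sum>n\<in>{a..<b}. ee (\<phi> 0 + of_int n * \<alpha>))"
      by (intro sum.cong refl arg_cong[where f=ee] \<phi>)
    ultimately have "\<epsilon> * real X \<le> 2 * real X / real Q" using big by simp
    then have "\<epsilon> * real Q \<le> 2" using X Q by (simp add: field_simps)
    moreover have "\<epsilon> * real Q \<ge> 3" using Q base by (simp add: field_simps)
    ultimately show False by simp
  qed
  then show ?case using Q(2) by (intro exI[of _ Q]) (metis atLeastAtMost_iff order_refl)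
next
  case (Suc k)
  show ?case by (rule weyl_step[OF Suc.hyps Suc.prems Suc.IH])
qed

text \<open>Differencing by \<open>h\<close> lowers the degree and multiplies the leading
  coefficient by h (k + 1), so the factorials accumulate; \<open>c'\<close> lists the coefficients
  of the difference.\<close>

lemma phase_polynomial:
  assumes "\<And>n. \<phi> n = (\<Sum>j\<le>k. c j * of_int n ^ j)"
  shows "phase k (fact k * c k) \<phi>"
  using assms
proof (induction k arbitrary: c \<phi>)
  case (Suc k)
  show ?case unfolding phase.simps
  proof
    fix h :: int
    define c' where "c' i = (\<Sum>j\<in>{i<..Suc k}. c j * real (j choose i) * of_int h ^ (j - i))" for i
    have pw: "of_int (n + h) ^ j - (of_int n ^ j :: real) = (\<Sum>i<j. real (j choose i) * of_int n ^ i * of_int h ^ (j - i))" for n j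
    proof -
      have "(of_int n + of_int h :: real) ^ j = (\<Sum>i\<le>j. real (j choose i) * of_int n ^ i * of_int h ^ (j - i))"
        by (rule binomial_ring)
      also have "\<dots> = (\<Sum>i<j. real (j choose i) * of_int n ^ i * of_int h ^ (j - i)) + of_int n ^ j"
        by (simp add: lessThan_Suc_atMost[symmetric])
      finally show ?thesis by simp
    qed
    have "\<phi> (n + h) - \<phi> n = (\<Sum>i\<le>k. c' i * of_int n ^ i)" for n
    proof -
      have "\<phi> (n + h) - \<phi> n = (\<Sum>j\<le>Suc k. c j * (of_int (n + h) ^ j - of_int n ^ j))"
        unfolding Suc.prems sum_subtractf[symmetric] right_diff_distrib ..
      also have "\<dots> = (\<Sum>j\<le>Suc k. \<Sum>i\<in>{i. i \<le> k \<and> i < j}. c j * (real (j choose i) * of_int n ^ i * of_int h ^ (j - i)))"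
        unfolding pw sum_distrib_left by (intro sum.cong refl) auto
      also have "\<dots> = (\<Sum>i\<le>k. \<Sum>j\<in>{j. j \<le> Suc k \<and> i < j}. c j * (real (j choose i) * of_int n ^ i * of_int h ^ (j - i)))"
        using sum.swap_restrict[of "{..Suc k}" "{..k}" "\<lambda>j i. c j * (real (j choose i) * of_int n ^ i * of_int h ^ (j - i))" "\<lambda>j i. i < j"] by simp
      also have "\<dots> = (\<Sum>i\<le>k. c' i * of_int n ^ i)"
        unfolding c'_def sum_distrib_right by (intro sum.cong refl) auto
      finally show ?thesis .
    qed
    from Suc.IH[OF this] have "phase k (fact k * c' k) (\<lambda>n. \<phi> (n + h) - \<phi> n)" .
    moreover have "{k<..Suc k} = {Suc k}" by auto
    then have "fact k * c' k = of_int h * (fact (Suc k) * c (Suc k))" by (simp add: c'_def algebra_simps)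
    ultimately show "phase k (of_int h * (fact (Suc k) * c (Suc k))) (\<lambda>n. \<phi> (n + h) - \<phi> n)" by simp
  qed
qed simp

lemma phase_monomial: "phase k (fact k * \<alpha>) (\<lambda>n. \<alpha> * of_int n ^ k)"
proof -
  have "\<alpha> * of_int n ^ k = (\<Sum>j\<le>k. (if j = k then \<alpha> else 0) * of_int n ^ j)" for n
    by (simp add: if_distrib[of "\<lambda>x. x * _"] cong: if_cong)
  from phase_polynomial[OF this] show ?thesis by simp
qed

section \<open>Spectral averages along powers\<close>

text \<open>The scale \<xi> i is available only after \<xi> (i + 1), so a chain of length
  \<open>T\<close> is built from its end: the induction puts a new scale in front and shifts the
  others.\<close>

lemma backward_sequence:
  fixes R :: "nat \<Rightarrow> real \<Rightarrow> real \<Rightarrow> nat \<Rightarrow> nat \<Rightarrow> bool"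
  assumes "\<And>i \<xi>'. \<xi>' > 0 \<Longrightarrow> \<exists>\<xi>>0. \<exists>X H. R i \<xi> \<xi>' X H"
  shows "\<exists>\<xi> X H. \<xi> 0 > 0 \<and> (\<forall>i<T. R i (\<xi> i) (\<xi> (Suc i)) (X i) (H i))"
  using assms
proof (induction T arbitrary: R)
  case 0
  show ?case by (rule exI[of _ "\<lambda>_. 1"]) simp
next
  case (Suc T)
  have "\<exists>\<xi> X H. \<xi> 0 > 0 \<and> (\<forall>i<T. R (Suc i) (\<xi> i) (\<xi> (Suc i)) (X i) (H i))"
    by (rule Suc.IH) (rule Suc.prems)
  then obtain \<xi> X H where 1: "\<xi> 0 > 0" "\<forall>i<T. R (Suc i) (\<xi> i) (\<xi> (Suc i)) (X i) (H i)" by blast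
  obtain \<xi>0 X0 H0 where 2: "\<xi>0 > 0" "R 0 \<xi>0 (\<xi> 0) X0 H0" using Suc.prems[OF 1(1)] by blast
  have "R i (case_nat \<xi>0 \<xi> i) (case_nat \<xi>0 \<xi> (Suc i)) (case_nat X0 X i) (case_nat H0 H i)" if "i < Suc T" for i
    using that 1 2 by (cases i) auto
  then show ?case
    using 2(1) by (intro exI[of _ "case_nat \<xi>0 \<xi>"] exI[of _ "case_nat X0 X"] exI[of _ "case_nat H0 H"]) auto
qed

definition box_avg :: "nat \<Rightarrow> (nat \<Rightarrow> int) \<Rightarrow> nat \<Rightarrow> nat \<Rightarrow> real \<Rightarrow> complex" where
  "box_avg s lam W H \<theta> = (\<Sum>h\<in>Pi\<^sub>E {..<s} (\<lambda>_. {1..int H}). ee (of_int (int W * (\<Sum>l<s. lam l * h l)) * \<theta>)) / of_nat (H ^ s)"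

definition power_avg :: "nat \<Rightarrow> nat \<Rightarrow> nat \<Rightarrow> real \<Rightarrow> complex" where
  "power_avg k W X \<theta> = (\<Sum>n\<in>{1..X}. ee (real ((W * n) ^ k) * \<theta>)) / of_nat X"

lemma norm_avg_minus_1_le:
  fixes f :: "'a \<Rightarrow> complex"
  assumes "card A > 0" and "\<And>x. x \<in> A \<Longrightarrow> norm (f x - 1) \<le> e"
  shows "norm ((\<Sum>x\<in>A. f x) / of_nat (card A) - 1) \<le> e"
proof -
  have "(\<Sum>x\<in>A. f x) / of_nat (card A) - 1 = (\<Sum>x\<in>A. f x - 1) / of_nat (card A)"
    using assms(1) by (simp add: sum_subtractf diff_divide_distrib)
  also have "norm \<dots> \<le> (\<Sum>x\<in>A. norm (f x - 1)) / real (card A)"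
    unfolding norm_divide norm_of_nat by (intro divide_right_mono norm_sum) simp
  also have "\<dots> \<le> (\<Sum>x\<in>A. e) / real (card A)"
    by (intro divide_right_mono sum_mono assms) auto
  also have "\<dots> = e" using assms(1) by simp
  finally show ?thesis .
qed

lemma card_box: "card (Pi\<^sub>E {..<s::nat} (\<lambda>_. {1..int H})) = H ^ s"
  by (simp add: card_PiE)

text \<open>Every frequency in the average is a multiple of \<open>W\<close>, so the distance of W
  \<theta> from the integers is magnified only by the cofactor. \<open>power_avg_near_1\<close>
  works alike because (W n)^k = W * W^(k - 1) n^k.\<close>

lemma box_avg_near_1:
  assumes "H \<ge> 1" and near: "near_int \<xi> (real W * \<theta>)" and \<xi>: "\<xi> \<ge> 0"
  shows "norm (box_avg s lam W H \<theta> - 1) \<le> 2 * pi * (real_of_int (\<Sum>l<s. \<bar>lam l\<bar>) * real H * \<xi>)"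
proof -
  have "norm ((\<Sum>h\<in>Pi\<^sub>E {..<s} (\<lambda>_. {1..int H}). ee (of_int (int W * (\<Sum>l<s. lam l * h l)) * \<theta>)) / of_nat (card (Pi\<^sub>E {..<s} (\<lambda>_. {1..int H}))) - 1)
     \<le> 2 * pi * (real_of_int (\<Sum>l<s. \<bar>lam l\<bar>) * real H * \<xi>)"
  proof (rule norm_avg_minus_1_le)
    fix h assume h: "h \<in> Pi\<^sub>E {..<s} (\<lambda>_. {1..int H})"
    let ?m = "\<Sum>l<s. lam l * h l"
    have "\<bar>?m\<bar> \<le> (\<Sum>l<s. \<bar>lam l * h l\<bar>)" by (rule sum_abs)
    also have "\<dots> \<le> (\<Sum>l<s. \<bar>lam l\<bar> * int H)"
      using h by (intro sum_mono) (force simp: abs_mult PiE_iff intro!: mult_left_mono)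
    also have "\<dots> = (\<Sum>l<s. \<bar>lam l\<bar>) * int H" by (simp add: sum_distrib_right)
    finally have "real_of_int \<bar>?m\<bar> \<le> real_of_int ((\<Sum>l<s. \<bar>lam l\<bar>) * int H)" by (simp only: of_int_le_iff)
    then have m: "\<bar>real_of_int ?m\<bar> * \<xi> \<le> real_of_int (\<Sum>l<s. \<bar>lam l\<bar>) * real H * \<xi>"
      using \<xi> by (intro mult_right_mono) auto
    have "near_int (\<bar>real_of_int ?m\<bar> * \<xi>) (of_int ?m * (real W * \<theta>))" by (rule near_int_mult[OF near])
    from norm_ee_minus_1_le[OF near_int_mono[OF this m]]
    show "norm (ee (of_int (int W * ?m) * \<theta>) - 1) \<le> 2 * pi * (real_of_int (\<Sum>l<s. \<bar>lam l\<bar>) * real H * \<xi>)"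
      by (simp add: mult_ac)
  qed (use assms(1) in \<open>simp add: card_box\<close>)
  then show ?thesis unfolding box_avg_def card_box .
qed

lemma power_avg_near_1:
  assumes "X \<ge> 1" and k: "k \<ge> 1" and near: "near_int \<xi> (real W * \<theta>)" and \<xi>: "\<xi> \<ge> 0"
  shows "norm (power_avg k W X \<theta> - 1) \<le> 2 * pi * (real W ^ (k - 1) * real X ^ k * \<xi>)"
proof -
  have "norm ((\<Sum>n\<in>{1..X}. ee (real ((W * n) ^ k) * \<theta>)) / of_nat (card {1..X}) - 1) \<le> 2 * pi * (real W ^ (k - 1) * real X ^ k * \<xi>)"
  proof (rule norm_avg_minus_1_le)
    fix n assume n: "n \<in> {1..X}"
    let ?m = "int (W ^ (k - 1) * n ^ k)"
    have "real (n ^ k) \<le> real (X ^ k)" using n by (intro of_nat_mono power_mono) auto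
    then have "\<bar>real_of_int ?m\<bar> * \<xi> \<le> real W ^ (k - 1) * real X ^ k * \<xi>"
      using \<xi> by (intro mult_right_mono) (auto intro: mult_left_mono)
    with near_int_mult[OF near, of ?m] have "near_int (real W ^ (k - 1) * real X ^ k * \<xi>) (of_int ?m * (real W * \<theta>))"
      by (rule near_int_mono)
    moreover have "of_int ?m * (real W * \<theta>) = real ((W * n) ^ k) * \<theta>"
      using k by (cases k) (auto simp: power_mult_distrib)
    ultimately show "norm (ee (real ((W * n) ^ k) * \<theta>) - 1) \<le> 2 * pi * (real W ^ (k - 1) * real X ^ k * \<xi>)"
      using norm_ee_minus_1_le by metis
  qed (use assms(1) in simp)
  then show ?thesis by (simp add: power_avg_def)
qed

text \<open>The average factors over the coordinates of the box; coordinate 0 contributes a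
  geometric sum with frequency lam 0 * W * \<theta>, and the others are bounded trivially.\<close>

lemma box_avg_le:
  assumes s: "s \<ge> 1" and H: "H \<ge> 1" and big: "norm (box_avg s lam W H \<theta>) > \<epsilon>" and \<epsilon>: "\<epsilon> > 0"
  shows "near_int (2 / (\<epsilon> * real H)) (of_int (lam 0) * (real W * \<theta>))"
proof (rule ccontr)
  assume far: "\<not> ?thesis"
  let ?f = "\<lambda>l. \<Sum>h\<in>{1..int H}. ee (of_int h * (of_int (lam l) * (real W * \<theta>)))"
  have ee_sum: "ee (\<Sum>l\<in>A. x l) = (\<Prod>l\<in>A. ee (x l))" if "finite A" for x and A :: "nat set"
    using that by (induction A) (auto simp: ee_add)
  have iv: "{1..int H} = {1..<int H + 1}" by auto
  have "(\<Sum>h\<in>Pi\<^sub>E {..<s} (\<lambda>_. {1..int H}). ee (of_int (int W * (\<Sum>l<s. lam l * h l)) * \<theta>))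
    = (\<Sum>h\<in>Pi\<^sub>E {..<s} (\<lambda>_. {1..int H}). \<Prod>l<s. ee (of_int (h l) * (of_int (lam l) * (real W * \<theta>))))"
    by (intro sum.cong refl, subst ee_sum[symmetric]) (auto simp: sum_distrib_left sum_distrib_right mult_ac)
  also have "\<dots> = (\<Prod>l<s. ?f l)" by (subst prod_sum_PiE) auto
  finally have F: "box_avg s lam W H \<theta> = (\<Prod>l<s. ?f l) / of_nat (H ^ s)" by (simp add: box_avg_def)
  have f0: "norm (?f 0) \<le> \<epsilon> * real H"
    using norm_geometric_ee_le[OF far, of 0 1 "int H + 1"] H \<epsilon> unfolding iv by simp
  have fl: "norm (?f l) \<le> real H" for l
    using norm_ee_sum_le[of "int H + 1" 1 H "\<lambda>n. of_int n * (of_int (lam l) * (real W * \<theta>))"] unfolding iv by simp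
  have "norm (\<Prod>l<s. ?f l) \<le> \<epsilon> * real H ^ s"
  proof -
    obtain r where r: "s = Suc r" using s by (cases s) auto
    have "norm (\<Prod>l<s. ?f l) = norm (?f 0) * (\<Prod>l<r. norm (?f (Suc l)))"
      unfolding r prod.lessThan_Suc_shift by (simp add: norm_mult prod_norm)
    also have "\<dots> \<le> (\<epsilon> * real H) * (\<Prod>l<r. real H)"
      using \<epsilon> by (intro mult_mono f0 prod_mono) (auto intro: fl prod_nonneg)
    finally show ?thesis by (simp add: r)
  qed
  then have "norm (box_avg s lam W H \<theta>) \<le> \<epsilon>"
    using H by (simp add: F norm_divide norm_power divide_le_eq)
  with big show False by simp
qed

text \<open>Let \<open>\<Omega> i\<close> be the frequencies with U i * \<theta> within
  \<open>\<xi> i\<close> of an integer. On \<open>\<Omega> i\<close> both averages are close to 1,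
  off \<open>\<Omega> (Suc i)\<close> both are close to 0, so only the annulus between can separate
  powers from boxes. The annuli are disjoint and the total mass is at most 1. All scales are chosen
  before the measure, hence \<open>L\<close> is uniform in it.\<close>

theorem power_average_ge_of_box_average_ge:
  fixes lam :: "nat \<Rightarrow> int" and c0 :: real
  assumes s: "s \<ge> 1" and lam: "lam 0 \<noteq> 0" and k: "k \<ge> 1" and c0: "c0 > 0"
  shows "\<exists>L\<ge>1. \<forall>(J::'j set) (c::'j \<Rightarrow> complex) (\<theta>::'j \<Rightarrow> real). finite J \<longrightarrow> (\<Sum>j\<in>J. norm (c j)) \<le> 1 \<longrightarrow>
    (\<forall>W\<ge>1. \<forall>H\<ge>1. c0 \<le> Re (\<Sum>j\<in>J. c j * box_avg s lam W H (\<theta> j))) \<longrightarrow>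
    (\<exists>n\<in>{1..L}. c0 / 2 \<le> Re (\<Sum>j\<in>J. c j * ee (real (n ^ k) * \<theta> j)))"
proof -
  \<comment> \<open>The total error is at most 2 \<epsilon> + 2 c0 / 8 \<le> c0 / 2; the bound 1/4
    keeps an average from being close to both 0 and 1.\<close>
  define \<epsilon> where "\<epsilon> = min (1 / 4) (c0 / 16)"
  have \<epsilon>: "0 < \<epsilon>" "\<epsilon> \<le> 1" "\<epsilon> \<le> 1 / 4" "\<epsilon> \<le> c0 / 16" using c0 by (auto simp: \<epsilon>_def)
  obtain Q :: nat where Q: "\<forall>X::nat. \<forall>\<alpha> \<phi> a b. X \<ge> 1 \<longrightarrow> phase k \<alpha> \<phi> \<longrightarrow> b - a \<le> int X \<longrightarrow>
      norm (\<Sum>n\<in>{a..<b}. ee (\<phi> n)) \<ge> \<epsilon> * real X \<longrightarrow> (\<exists>q\<in>{1..Q}. near_int (real Q / real X ^ k) (real q * \<alpha>))"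
    using weyl_inverse[OF k \<epsilon>(1,2)] by blast
  define m where "m = nat \<bar>lam 0\<bar>"
  have m: "m \<ge> 1" "real m = \<bar>real_of_int (lam 0)\<bar>" using lam by (auto simp: m_def)
  \<comment> \<open>\<open>m\<close> accounts for the factor \<open>lam 0\<close> in
    \<open>box_avg_le\<close>, \<open>fact Q\<close> clears every denominator q \<le> Q,
    \<open>fact k\<close> comes from \<open>phase_monomial\<close>, and U^k is the coefficient of
    n^k.\<close>
  define U :: "nat \<Rightarrow> nat" where "U = rec_nat 1 (\<lambda>_ u. m * fact Q * fact k * u ^ k)"
  have U0: "U 0 = 1" and USuc: "U (Suc i) = m * fact Q * fact k * U i ^ k" for i by (auto simp: U_def)
  have U1: "U i \<ge> 1" for i
  proof (induction i)
    case (Suc i)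
    then have "U i ^ k > 0" by simp
    then show ?case using m(1) unfolding USuc by (simp add: Suc_le_eq)
  qed (simp add: U0)
  \<comment> \<open>Order of choice within one link: \<open>H\<close> and \<open>X\<close> are large
    in terms of \<xi>', and \<xi> is small in terms of \<open>H\<close> and
    \<open>X\<close>.\<close>
  define R where "R i \<xi> \<xi>' X H \<longleftrightarrow> X \<ge> 1 \<and> H \<ge> 1 \<and>
      (\<forall>\<theta>. near_int \<xi> (real (U i) * \<theta>) \<longrightarrow> norm (box_avg s lam (U i) H \<theta> - 1) \<le> \<epsilon> \<and> norm (power_avg k (U i) X \<theta> - 1) \<le> \<epsilon>) \<and>
      (\<forall>\<theta>. \<not> near_int \<xi>' (real (U (Suc i)) * \<theta>) \<longrightarrow> norm (box_avg s lam (U i) H \<theta>) \<le> \<epsilon> \<and> norm (power_avg k (U i) X \<theta>) \<le> \<epsilon>)"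
    for i \<xi> \<xi>' X H
  have "\<exists>\<xi>>0. \<exists>X H. R i \<xi> \<xi>' X H" if \<xi>': "\<xi>' > 0" for i and \<xi>' :: real
  proof -
    define u where "u = U i"
    define A where "A = real (fact Q * fact k * u ^ (k - 1))"
    define H where "H = nat \<lceil>2 * A / (\<epsilon> * \<xi>')\<rceil> + 1"
    define X where "X = nat \<lceil>real (m * fact Q * Q) / \<xi>'\<rceil> + 1"
    define D where "D = 2 * pi * (real_of_int (\<Sum>l<s. \<bar>lam l\<bar>) * real H + real u ^ (k - 1) * real X ^ k) + 1"
    define \<xi> where "\<xi> = \<epsilon> / D"
    have H: "H \<ge> 1" "real H \<ge> 2 * A / (\<epsilon> * \<xi>')" unfolding H_def by linarith+
    have X: "X \<ge> 1" "real X \<ge> real (m * fact Q * Q) / \<xi>'" unfolding X_def by linarith+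
    have lam0: "0 \<le> real_of_int (\<Sum>l<s. \<bar>lam l\<bar>)" by (simp add: sum_nonneg)
    have D: "D \<ge> 1" "D \<ge> 2 * pi * (real_of_int (\<Sum>l<s. \<bar>lam l\<bar>) * real H)" "D \<ge> 2 * pi * (real u ^ (k - 1) * real X ^ k)"
      using lam0 by (auto simp: D_def distrib_left)
    have \<xi>: "\<xi> > 0" "D * \<xi> = \<epsilon>" using D \<epsilon> by (auto simp: \<xi>_def)
    have "norm (box_avg s lam u H \<theta> - 1) \<le> \<epsilon>" "norm (power_avg k u X \<theta> - 1) \<le> \<epsilon>"
      if near: "near_int \<xi> (real u * \<theta>)" for \<theta>
    proof -
      have "2 * pi * (real_of_int (\<Sum>l<s. \<bar>lam l\<bar>) * real H) * \<xi> \<le> D * \<xi>"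
           "2 * pi * (real u ^ (k - 1) * real X ^ k) * \<xi> \<le> D * \<xi>"
        using D \<xi> by (auto intro!: mult_right_mono)
      then show "norm (box_avg s lam u H \<theta> - 1) \<le> \<epsilon>" "norm (power_avg k u X \<theta> - 1) \<le> \<epsilon>"
        using box_avg_near_1[OF H(1) near, of s lam] power_avg_near_1[OF X(1) k near] \<xi> by (simp_all add: mult.assoc)
    qed
    moreover have "norm (box_avg s lam u H \<theta>) \<le> \<epsilon>" if far: "\<not> near_int \<xi>' (real (U (Suc i)) * \<theta>)" for \<theta>
    proof (rule ccontr)
      assume "\<not> ?thesis"
      then have "near_int (2 / (\<epsilon> * real H)) (of_int (lam 0) * (real u * \<theta>))"
        using box_avg_le[OF s H(1)] \<epsilon>(1) by simp
      from near_int_mult[OF this, of "sgn (lam 0) * int (fact Q * fact k * u ^ (k - 1))"]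
      have "near_int (\<bar>real_of_int (sgn (lam 0) * int (fact Q * fact k * u ^ (k - 1)))\<bar> * (2 / (\<epsilon> * real H)))
         (of_int (sgn (lam 0) * int (fact Q * fact k * u ^ (k - 1))) * (of_int (lam 0) * (real u * \<theta>)))" .
      moreover have "\<bar>real_of_int (sgn (lam 0) * int (fact Q * fact k * u ^ (k - 1)))\<bar> = A"
        using lam by (simp add: A_def abs_mult sgn_if)
      moreover have "of_int (sgn (lam 0) * int (fact Q * fact k * u ^ (k - 1))) * (of_int (lam 0) * (real u * \<theta>)) = real (U (Suc i)) * \<theta>"
      proof -
        have 1: "real_of_int (sgn (lam 0)) * real_of_int (lam 0) = real m"
          unfolding m(2) by (auto simp: sgn_if)
        have "real u ^ (k - 1) * real u = real u ^ k" using k by (cases k) auto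
        then have "real (U (Suc i)) * \<theta> = real m * (fact Q * fact k * (real u ^ (k - 1) * real u)) * \<theta>"
          by (simp add: USuc u_def)
        then have "real (U (Suc i)) * \<theta> = of_int (sgn (lam 0) * int (fact Q * fact k * u ^ (k - 1))) * (of_int (lam 0) * (real u * \<theta>))"
          unfolding 1[symmetric] by (simp add: mult_ac)
        then show ?thesis by (rule sym)
      qed
      moreover have "A * (2 / (\<epsilon> * real H)) \<le> \<xi>'" using H \<epsilon> \<xi>' by (simp add: field_simps)
      ultimately show False using far near_int_mono by metis
    qed
    moreover have "norm (power_avg k u X \<theta>) \<le> \<epsilon>" if far: "\<not> near_int \<xi>' (real (U (Suc i)) * \<theta>)" for \<theta>
    proof (rule ccontr)
      assume "\<not> ?thesis"
      then have "norm (\<Sum>n\<in>{1..X}. ee (real ((u * n) ^ k) * \<theta>)) \<ge> \<epsilon> * real X"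
        using X(1) by (simp add: power_avg_def norm_divide divide_le_eq not_le less_imp_le)
      moreover have "(\<Sum>n\<in>{1..X}. ee (real ((u * n) ^ k) * \<theta>)) = (\<Sum>n\<in>{1..<int X + 1}. ee ((real u ^ k * \<theta>) * of_int n ^ k))"
        by (rule sum.reindex_bij_witness[of _ nat int]) (auto simp: power_mult_distrib mult_ac)
      ultimately have "norm (\<Sum>n\<in>{1..<int X + 1}. ee ((real u ^ k * \<theta>) * of_int n ^ k)) \<ge> \<epsilon> * real X" by simp
      from Q[rule_format, OF X(1) phase_monomial _ this]
      obtain q where q: "q \<in> {1..Q}" "near_int (real Q / real X ^ k) (real q * (fact k * (real u ^ k * \<theta>)))" by auto
      have "q dvd fact Q" using q(1) by (intro dvd_fact) auto
      then obtain p where p: "fact Q = q * p" by blast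
      have "near_int (\<bar>real_of_int (int (m * p))\<bar> * (real Q / real X ^ k)) (of_int (int (m * p)) * (real q * (fact k * (real u ^ k * \<theta>))))"
        by (rule near_int_mult[OF q(2)])
      moreover have "of_int (int (m * p)) * (real q * (fact k * (real u ^ k * \<theta>))) = real (U (Suc i)) * \<theta>"
        unfolding USuc u_def p by (simp add: mult_ac)
      moreover have "\<bar>real_of_int (int (m * p))\<bar> * (real Q / real X ^ k) \<le> \<xi>'"
      proof -
        have "p \<le> fact Q" using p q(1) by simp
        then have "real (m * p) \<le> real (m * fact Q)" by (intro of_nat_mono) simp
        then have "real (m * p) * real Q \<le> real (m * fact Q) * real Q" by (intro mult_right_mono) auto
        also have "\<dots> \<le> \<xi>' * real X" using X(2) \<xi>' by (simp add: divide_le_eq mult_ac)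
        also have "real X \<le> real X ^ k" using X(1) k by (intro self_le_power) auto
        finally have "real (m * p) * real Q \<le> \<xi>' * real X ^ k" using \<xi>' by simp
        then show ?thesis using X(1) by (simp add: divide_le_eq)
      qed
      ultimately show False using far near_int_mono by metis
    qed
    ultimately have "R i \<xi> \<xi>' X H" using H(1) X(1) unfolding R_def u_def by blast
    then show ?thesis using \<xi>(1) by blast
  qed
  note backward = backward_sequence[where R=R, OF this]
  define T where "T = nat \<lceil>8 / c0\<rceil> + 1"
  have T: "real T \<ge> 8 / c0" "T \<ge> 1" unfolding T_def by linarith+
  obtain \<xi> X H where R: "\<And>i. i < T \<Longrightarrow> R i (\<xi> i) (\<xi> (Suc i)) (X i) (H i)" using backward[of T] by blast
  define L where "L = (\<Sum>i<T. U i * X i) + 1"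
  have "\<exists>n\<in>{1..L}. c0 / 2 \<le> Re (\<Sum>j\<in>J. c j * ee (real (n ^ k) * \<theta> j))"
    if J: "finite J" and c: "(\<Sum>j\<in>J. norm (c j)) \<le> 1"
      and hyp: "\<forall>W\<ge>1. \<forall>H\<ge>1. c0 \<le> Re (\<Sum>j\<in>J. c j * box_avg s lam W H (\<theta> j))"
    for J :: "'j set" and c \<theta>
  proof -
    define \<Omega> where "\<Omega> i j \<longleftrightarrow> near_int (\<xi> i) (real (U i) * \<theta> j)" for i j
    \<comment> \<open>Nestedness is not imposed on the scales; it follows because a power average
      within \<epsilon> of 1 cannot be within \<epsilon> of 0.\<close>
    have mono: "\<Omega> (Suc i) j" if "i < T" "\<Omega> i j" for i j
    proof (rule ccontr)
      assume "\<not> \<Omega> (Suc i) j"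
      then have "norm (power_avg k (U i) (X i) (\<theta> j)) \<le> \<epsilon>" "norm (power_avg k (U i) (X i) (\<theta> j) - 1) \<le> \<epsilon>"
        using R[OF that(1)] that(2) unfolding R_def \<Omega>_def by blast+
      then have "norm (1::complex) \<le> \<epsilon> + \<epsilon>"
        using norm_triangle_ineq4[of "power_avg k (U i) (X i) (\<theta> j)" "power_avg k (U i) (X i) (\<theta> j) - 1"] by simp
      then show False using \<epsilon>(3) by simp
    qed
    define \<mu> where "\<mu> i = (\<Sum>j\<in>J. norm (c j) * of_bool (\<Omega> (Suc i) j \<and> \<not> \<Omega> i j))" for i
    have "(\<Sum>i<T. \<mu> i) \<le> 1"
    proof -
      have "(\<Sum>i<T. \<mu> i) = (\<Sum>j\<in>J. norm (c j) * (\<Sum>i<T. of_bool (\<Omega> (Suc i) j \<and> \<not> \<Omega> i j)))"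
        unfolding \<mu>_def sum_distrib_left by (rule sum.swap)
      also have "\<dots> \<le> (\<Sum>j\<in>J. norm (c j) * 1)"
      proof (intro sum_mono mult_left_mono)
        fix j
        \<comment> \<open>By nestedness the annulus indicators telescope, so each frequency is
          counted at most once.\<close>
        have "(\<Sum>i<T. of_bool (\<Omega> (Suc i) j \<and> \<not> \<Omega> i j)) = (\<Sum>i<T. of_bool (\<Omega> (Suc i) j) - of_bool (\<Omega> i j) :: real)"
          using mono by (intro sum.cong) auto
        also have "\<dots> = of_bool (\<Omega> T j) - of_bool (\<Omega> 0 j)" by (rule sum_lessThan_telescope)
        finally show "(\<Sum>i<T. of_bool (\<Omega> (Suc i) j \<and> \<not> \<Omega> i j)) \<le> (1::real)" by auto
      qed simp
      finally show ?thesis using c by simp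
    qed
    have "\<exists>i<T. \<mu> i \<le> c0 / 8"
    proof (rule ccontr)
      assume "\<not> ?thesis"
      then have "(\<Sum>i<T. c0 / 8) < (\<Sum>i<T. \<mu> i)" using T(2) by (intro sum_strict_mono) (auto simp: not_le lessThan_empty_iff)
      then have "real T * (c0 / 8) < 1" using \<open>(\<Sum>i<T. \<mu> i) \<le> 1\<close> by simp
      then show False using T(1) c0 by (simp add: field_simps)
    qed
    then obtain i where i: "i < T" "\<mu> i \<le> c0 / 8" by blast
    note Ri = R[OF i(1), unfolded R_def]
    let ?F = "\<lambda>j. box_avg s lam (U i) (H i) (\<theta> j)" and ?g = "\<lambda>j. power_avg k (U i) (X i) (\<theta> j)"
    have g1: "norm (?g j) \<le> 1" for j
    proof -
      have "norm (\<Sum>n\<in>{1..X i}. ee (real ((U i * n) ^ k) * \<theta> j)) \<le> (\<Sum>n\<in>{1..X i}. 1)"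
        by (rule order_trans[OF norm_sum]) simp
      then show ?thesis using Ri by (simp add: power_avg_def norm_divide divide_le_eq)
    qed
    have F1: "norm (?F j) \<le> 1" for j
    proof -
      have "norm (\<Sum>h\<in>Pi\<^sub>E {..<s} (\<lambda>_. {1..int (H i)}). ee (of_int (int (U i) * (\<Sum>l<s. lam l * h l)) * \<theta> j)) \<le> (\<Sum>h\<in>Pi\<^sub>E {..<s} (\<lambda>_. {1..int (H i)}). 1)"
        by (rule order_trans[OF norm_sum]) simp
      also have "\<dots> = real (H i ^ s)" by (simp add: card_box)
      finally show ?thesis using Ri by (simp add: box_avg_def norm_divide norm_power divide_le_eq)
    qed
    have diff: "norm (?F j - ?g j) \<le> 2 * \<epsilon> + 2 * of_bool (\<Omega> (Suc i) j \<and> \<not> \<Omega> i j)" for j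
    proof -
      consider "\<Omega> i j" | "\<not> \<Omega> (Suc i) j" | "\<Omega> (Suc i) j \<and> \<not> \<Omega> i j" by blast
      then show ?thesis
      proof cases
        case 1
        then have "norm (?F j - 1) \<le> \<epsilon>" "norm (?g j - 1) \<le> \<epsilon>" using Ri unfolding \<Omega>_def by blast+
        then have "norm (?F j - ?g j) \<le> 2 * \<epsilon>" using norm_triangle_ineq4[of "?F j - 1" "?g j - 1"] by simp
        then show ?thesis by simp
      next
        case 2
        then have "norm (?F j) \<le> \<epsilon>" "norm (?g j) \<le> \<epsilon>" using Ri unfolding \<Omega>_def by blast+
        then have "norm (?F j - ?g j) \<le> 2 * \<epsilon>" using norm_triangle_ineq4[of "?F j" "?g j"] by simp
        then show ?thesis by simp
      next
        case 3
        then show ?thesis using norm_triangle_ineq4[of "?F j" "?g j"] F1[of j] g1[of j] \<epsilon>(1) by simp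
      qed
    qed
    have "norm ((\<Sum>j\<in>J. c j * ?F j) - (\<Sum>j\<in>J. c j * ?g j)) = norm (\<Sum>j\<in>J. c j * (?F j - ?g j))"
      by (simp add: sum_subtractf right_diff_distrib)
    also have "\<dots> \<le> (\<Sum>j\<in>J. norm (c j) * norm (?F j - ?g j))"
      by (rule order_trans[OF norm_sum]) (simp add: norm_mult)
    also have "\<dots> \<le> (\<Sum>j\<in>J. norm (c j) * (2 * \<epsilon> + 2 * of_bool (\<Omega> (Suc i) j \<and> \<not> \<Omega> i j)))"
      by (intro sum_mono mult_left_mono diff) simp
    also have "\<dots> = 2 * \<epsilon> * (\<Sum>j\<in>J. norm (c j)) + 2 * \<mu> i"
      unfolding \<mu>_def by (simp add: distrib_left sum.distrib sum_distrib_left mult_ac)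
    also have "\<dots> \<le> 2 * \<epsilon> * 1 + 2 * (c0 / 8)" using c i \<epsilon> by (intro add_mono mult_left_mono) auto
    finally have "norm ((\<Sum>j\<in>J. c j * ?F j) - (\<Sum>j\<in>J. c j * ?g j)) \<le> c0 / 2" using \<epsilon>(4) c0 by simp
    then have "Re (\<Sum>j\<in>J. c j * ?F j) - Re (\<Sum>j\<in>J. c j * ?g j) \<le> c0 / 2"
      using complex_Re_le_cmod[of "(\<Sum>j\<in>J. c j * ?F j) - (\<Sum>j\<in>J. c j * ?g j)"] by simp
    moreover have "c0 \<le> Re (\<Sum>j\<in>J. c j * ?F j)" using hyp U1 Ri by blast
    ultimately have low: "c0 / 2 \<le> Re (\<Sum>j\<in>J. c j * ?g j)" by linarith
    have "(\<Sum>j\<in>J. c j * ?g j) = (\<Sum>n\<in>{1..X i}. \<Sum>j\<in>J. c j * ee (real ((U i * n) ^ k) * \<theta> j)) / of_nat (X i)"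
      unfolding power_avg_def by (subst sum.swap) (simp add: sum_distrib_left sum_divide_distrib)
    then have "Re (\<Sum>j\<in>J. c j * ?g j) = (\<Sum>n\<in>{1..X i}. Re (\<Sum>j\<in>J. c j * ee (real ((U i * n) ^ k) * \<theta> j))) / real (X i)"
      by (simp add: Re_divide_of_nat)
    with low have low': "c0 / 2 * real (X i) \<le> (\<Sum>n\<in>{1..X i}. Re (\<Sum>j\<in>J. c j * ee (real ((U i * n) ^ k) * \<theta> j)))"
      using Ri by (simp add: le_divide_eq)
    have "\<exists>n\<in>{1..X i}. c0 / 2 \<le> Re (\<Sum>j\<in>J. c j * ee (real ((U i * n) ^ k) * \<theta> j))"
    proof (rule ccontr)
      assume "\<not> ?thesis"
      then have "(\<Sum>n\<in>{1..X i}. Re (\<Sum>j\<in>J. c j * ee (real ((U i * n) ^ k) * \<theta> j))) < (\<Sum>n\<in>{1..X i}. c0 / 2)"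
        using Ri by (intro sum_strict_mono) (auto simp: not_le)
      moreover have "(\<Sum>n\<in>{1..X i}. c0 / 2) = c0 / 2 * real (X i)" by simp
      ultimately show False using low' by linarith
    qed
    then obtain n where n: "n \<in> {1..X i}" "c0 / 2 \<le> Re (\<Sum>j\<in>J. c j * ee (real ((U i * n) ^ k) * \<theta> j))" ..
    have "U i * n \<le> U i * X i" using n by simp
    also have "\<dots> \<le> (\<Sum>i<T. U i * X i)" using i(1) by (intro member_le_sum) auto
    finally have "U i * n \<in> {1..L}" using n U1[of i] by (simp add: L_def Suc_le_eq)
    then show ?thesis using n(2) by blast
  qed
  then show ?thesis by (intro exI[of _ L]) (auto simp: L_def)
qed

section \<open>Dense sets and a single equation\<close>

lemma ee_sum: "finite A \<Longrightarrow> ee (\<Sum>l\<in>A. x l) = (\<Prod>l\<in>A. ee (x l))"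
  by (induction A rule: finite_induct) (auto simp: ee_add)

text \<open>If \<open>P\<close> does not divide \<open>m\<close>, then m / P has distance at least 1
  / P from the integers, so its character value is not 1, while the telescoped sum vanishes.\<close>

lemma sum_ee_orthogonal:
  fixes P m :: int
  assumes P: "P \<ge> 1"
  shows "(\<Sum>a\<in>{0..<P}. ee (of_int a * (of_int m / of_int P))) = (if P dvd m then of_int P else 0)"
proof (cases "P dvd m")
  case True
  then obtain b where "m = P * b" by blast
  then have "ee (of_int a * (of_int m / of_int P)) = 1" for a
    using ee_of_int[of "a * b"] P by simp
  then show ?thesis using True P by simp
next
  case False
  let ?\<alpha> = "of_int m / of_int P :: real"
  have "\<not> near_int (1 / (2 * of_int P)) ?\<alpha>"
  proof
    assume "near_int (1 / (2 * of_int P)) ?\<alpha>"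
    then obtain b :: int where b: "\<bar>?\<alpha> - of_int b\<bar> \<le> 1 / (2 * of_int P)" unfolding near_int_def by blast
    have "\<bar>of_int P * (?\<alpha> - of_int b)\<bar> \<le> of_int P * (1 / (2 * of_int P))"
      unfolding abs_mult using P b by (intro mult_mono) auto
    then have "\<bar>real_of_int (m - P * b)\<bar> \<le> 1 / 2" using P by (simp add: algebra_simps)
    then have "m - P * b = 0" by linarith
    then have "m = P * b" by simp
    with False show False by simp
  qed
  then have "norm (ee ?\<alpha> - 1) > 0"
    using norm_ee_minus_1_ge[of "1 / (2 * of_int P)" ?\<alpha>] P by (smt (verit) divide_pos_pos of_int_pos zero_less_one)
  then have "ee ?\<alpha> - 1 \<noteq> 0" by simp
  moreover have "(ee ?\<alpha> - 1) * (\<Sum>a\<in>{0..<P}. ee (0 + of_int a * ?\<alpha>)) = ee (0 + of_int P * ?\<alpha>) - ee (0 + of_int 0 * ?\<alpha>)"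
    using P by (intro geometric_ee_telescope) simp
  moreover have "of_int P * ?\<alpha> = of_int m" using P by simp
  ultimately show ?thesis using False by simp
qed

section \<open>Fourier counting in the cyclic group of order P\<close>

definition exp_sum :: "int \<Rightarrow> int set \<Rightarrow> int \<Rightarrow> complex" where
  "exp_sum P A a = (\<Sum>x\<in>A. ee (of_int (a * x) / of_int P))"

lemma norm_exp_sum_le: "norm (exp_sum P A a) \<le> real (card A)"
proof -
  have "norm (exp_sum P A a) \<le> (\<Sum>x\<in>A. norm (ee (of_int (a * x) / of_int P)))"
    unfolding exp_sum_def by (rule norm_sum)
  then show ?thesis by simp
qed

text \<open>The frequencies are dilated by a unit \<open>b\<close>, so that the identity applies
  directly to the factors \<open>exp_sum P A (a * lam l)\<close>.\<close>

lemma parseval: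
  assumes P: "P \<ge> 1" and A: "A \<subseteq> {0..<P}" and cop: "coprime b P"
  shows "(\<Sum>a\<in>{0..<P}. (norm (exp_sum P A (a * b)))\<^sup>2) = real_of_int P * real (card A)"
proof -
  have finA: "finite A" using A finite_subset by blast
  have "complex_of_real (\<Sum>a\<in>{0..<P}. (norm (exp_sum P A (a * b)))\<^sup>2)
     = (\<Sum>a\<in>{0..<P}. \<Sum>x\<in>A. \<Sum>y\<in>A. ee (of_int a * (of_int (b * (x - y)) / of_int P)))"
    unfolding of_real_sum complex_norm_square exp_sum_def cnj_sum sum_product
    by (intro sum.cong refl) (simp add: ee_diff[symmetric] diff_divide_distrib[symmetric] algebra_simps)
  also have "\<dots> = (\<Sum>x\<in>A. \<Sum>y\<in>A. \<Sum>a\<in>{0..<P}. ee (of_int a * (of_int (b * (x - y)) / of_int P)))"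
    by (subst sum.swap, intro sum.cong refl sum.swap)
  also have "\<dots> = (\<Sum>x\<in>A. \<Sum>y\<in>A. if y = x then of_int P else 0)"
  proof (intro sum.cong refl)
    fix x y assume xy: "x \<in> A" "y \<in> A"
    have "P dvd b * (x - y) \<longleftrightarrow> y = x"
    proof
      assume "P dvd b * (x - y)"
      then have "P dvd x - y" using cop by (simp add: coprime_commute coprime_dvd_mult_right_iff)
      then show "y = x" using xy A by (intro dvd_diff_imp_eq[symmetric]) auto
    qed simp
    then show "(\<Sum>a\<in>{0..<P}. ee (of_int a * (of_int (b * (x - y)) / of_int P))) = (if y = x then of_int P else 0)"
      unfolding sum_ee_orthogonal[OF P] by simp
  qed
  also have "\<dots> = of_int P * of_nat (card A)" using finA by (simp add: sum.delta)
  finally have "complex_of_real (\<Sum>a\<in>{0..<P}. (norm (exp_sum P A (a * b)))\<^sup>2) = complex_of_real (real_of_int P * real (card A))" by simp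
  then show ?thesis by (simp only: of_real_eq_iff)
qed

definition fourier_coeff :: "nat \<Rightarrow> (nat \<Rightarrow> int) \<Rightarrow> int \<Rightarrow> int set \<Rightarrow> int \<Rightarrow> complex" where
  "fourier_coeff s lam P A a = (\<Prod>l<s. exp_sum P A (a * lam l)) / of_int P ^ s"

text \<open>Two of the \<open>s\<close> factors are handled by 2 x y \<le> x^2 + y^2 and Parseval,
  the remaining ones trivially by \<open>P\<close>. This is the mass bound demanded by
  \<open>power_average_ge_of_box_average_ge\<close>.\<close>

lemma sum_norm_fourier_coeff_le:
  assumes s: "s \<ge> 2" and P: "P \<ge> 1" and A: "A \<subseteq> {0..<P}" and cop: "\<And>l. l < s \<Longrightarrow> coprime (lam l) P"
  shows "(\<Sum>a\<in>{0..<P}. norm (fourier_coeff s lam P A a)) \<le> 1"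
proof -
  have "card A \<le> card {0..<P}" using A by (intro card_mono) auto
  then have cA: "real (card A) \<le> real_of_int P" using P by simp
  obtain r where r: "s = Suc (Suc r)" using s by (metis add_2_eq_Suc le_Suc_ex)
  let ?S = "\<lambda>l a. norm (exp_sum P A (a * lam l))"
  have "norm (fourier_coeff s lam P A a) \<le> ((?S 0 a)\<^sup>2 + (?S 1 a)\<^sup>2) / 2 / of_int P ^ 2" for a
  proof -
    have "norm (\<Prod>l<s. exp_sum P A (a * lam l)) = ?S 0 a * (?S 1 a * (\<Prod>l<r. ?S (Suc (Suc l)) a))"
      unfolding r prod.lessThan_Suc_shift by (simp add: norm_mult prod_norm)
    also have "\<dots> \<le> ?S 0 a * (?S 1 a * (\<Prod>l<r. real_of_int P))"
      using cA by (intro mult_left_mono prod_mono) (auto intro: order_trans[OF norm_exp_sum_le])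
    also have "\<dots> = ?S 0 a * ?S 1 a * real_of_int P ^ r" by simp
    also have "\<dots> \<le> ((?S 0 a)\<^sup>2 + (?S 1 a)\<^sup>2) / 2 * real_of_int P ^ r"
      using P sum_squares_bound[of "?S 0 a" "?S 1 a"] by (intro mult_right_mono) auto
    finally have *: "norm (\<Prod>l<s. exp_sum P A (a * lam l)) \<le> ((?S 0 a)\<^sup>2 + (?S 1 a)\<^sup>2) / 2 * real_of_int P ^ r" .
    have "norm (fourier_coeff s lam P A a) = norm (\<Prod>l<s. exp_sum P A (a * lam l)) / of_int P ^ s"
      using P by (simp add: fourier_coeff_def norm_divide norm_power)
    also have "\<dots> \<le> ((?S 0 a)\<^sup>2 + (?S 1 a)\<^sup>2) / 2 * real_of_int P ^ r / of_int P ^ s"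
      using P by (intro divide_right_mono *) simp
    also have "\<dots> = ((?S 0 a)\<^sup>2 + (?S 1 a)\<^sup>2) / 2 / of_int P ^ 2" using P by (simp add: r field_simps power2_eq_square)
    finally show ?thesis .
  qed
  then have "(\<Sum>a\<in>{0..<P}. norm (fourier_coeff s lam P A a)) \<le> (\<Sum>a\<in>{0..<P}. ((?S 0 a)\<^sup>2 + (?S 1 a)\<^sup>2) / 2 / of_int P ^ 2)"
    by (intro sum_mono)
  also have "\<dots> = (real_of_int P * real (card A) + real_of_int P * real (card A)) / 2 / of_int P ^ 2"
    using parseval[OF P A cop[of 0]] parseval[OF P A cop[of 1]] s
    by (simp add: sum_divide_distrib[symmetric] sum.distrib)
  also have "\<dots> = real (card A) / of_int P" using P by (simp add: power2_eq_square)
  also have "\<dots> \<le> 1" using cA P by simp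
  finally show ?thesis .
qed

text \<open>Orthogonality returns one of the \<open>s\<close> factors \<open>P\<close> in the
  normalisation, leaving the number of solutions relative to the expected order P^(s - 1).\<close>

lemma fourier_count:
  assumes P: "P \<ge> 1" and A: "A \<subseteq> {0..<P}" and s: "s \<ge> 1"
  shows "(\<Sum>a\<in>{0..<P}. fourier_coeff s lam P A a * ee (of_int m * (- of_int (a * Z) / of_int P)))
     = of_nat (card {x \<in> Pi\<^sub>E {..<s} (\<lambda>_. A). P dvd (\<Sum>l<s. lam l * x l) - Z * m}) / of_int P ^ (s - 1)"
proof -
  have finA: "finite A" using A finite_subset by blast
  have finX: "finite (Pi\<^sub>E {..<s} (\<lambda>_. A))" using finA by (intro finite_PiE) auto
  have pprod: "(\<Prod>l<s. exp_sum P A (a * lam l)) = (\<Sum>x\<in>Pi\<^sub>E {..<s} (\<lambda>_. A). ee (of_int a * (of_int (\<Sum>l<s. lam l * x l) / of_int P)))" for a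
    unfolding exp_sum_def using finA
    by (subst prod_sum_PiE) (auto simp: ee_sum[symmetric] sum_distrib_left sum_divide_distrib mult_ac intro!: sum.cong arg_cong[where f=ee])
  have "fourier_coeff s lam P A a * ee (of_int m * (- of_int (a * Z) / of_int P))
     = (\<Sum>x\<in>Pi\<^sub>E {..<s} (\<lambda>_. A). ee (of_int a * (of_int ((\<Sum>l<s. lam l * x l) - Z * m) / of_int P))) / of_int P ^ s" for a
  proof -
    have "ee (of_int a * (of_int L / of_int P)) * ee (of_int m * (- of_int (a * Z) / of_int P))
      = ee (of_int a * (of_int (L - Z * m) / of_int P))" for L
      unfolding ee_add[symmetric] by (rule arg_cong[where f=ee]) (simp add: diff_divide_distrib algebra_simps)
    then show ?thesis by (simp only: fourier_coeff_def pprod times_divide_eq_left sum_distrib_right)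
  qed
  then have "(\<Sum>a\<in>{0..<P}. fourier_coeff s lam P A a * ee (of_int m * (- of_int (a * Z) / of_int P)))
     = (\<Sum>a\<in>{0..<P}. \<Sum>x\<in>Pi\<^sub>E {..<s} (\<lambda>_. A). ee (of_int a * (of_int ((\<Sum>l<s. lam l * x l) - Z * m) / of_int P))) / of_int P ^ s"
    by (simp only: sum_divide_distrib)
  also have "\<dots> = (\<Sum>x\<in>Pi\<^sub>E {..<s} (\<lambda>_. A). \<Sum>a\<in>{0..<P}. ee (of_int a * (of_int ((\<Sum>l<s. lam l * x l) - Z * m) / of_int P))) / of_int P ^ s"
    by (subst sum.swap) rule
  also have "\<dots> = (\<Sum>x\<in>Pi\<^sub>E {..<s} (\<lambda>_. A). if P dvd (\<Sum>l<s. lam l * x l) - Z * m then of_int P else 0) / of_int P ^ s"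
    unfolding sum_ee_orthogonal[OF P] ..
  also have "\<dots> = of_nat (card {x \<in> Pi\<^sub>E {..<s} (\<lambda>_. A). P dvd (\<Sum>l<s. lam l * x l) - Z * m}) * of_int P / of_int P ^ s"
    unfolding sum.inter_filter[OF finX, symmetric] by simp
  also have "\<dots> = of_nat (card {x \<in> Pi\<^sub>E {..<s} (\<lambda>_. A). P dvd (\<Sum>l<s. lam l * x l) - Z * m}) / of_int P ^ (s - 1)"
    using P s by (cases s) auto
  finally show ?thesis .
qed

lemma real_card_filter: "finite S \<Longrightarrow> real (card {x \<in> S. Q x}) = (\<Sum>x\<in>S. of_bool (Q x))"
  by (simp add: of_bool_def sum.inter_filter[symmetric])

text \<open>Call \<open>y\<close> good if y + W h lies in \<open>A\<close> for a proportion \<delta>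
  / 2 of the h \<le> H; averaging over translates gives density at least \<delta> / 2 of good
  points, whatever W and H are. A homogeneous solution \<open>y\<close> in good points, with hits
  h_l at its coordinates, yields the solution y_l + W h_l with right-hand side W times the linear
  form in \<open>h\<close>.\<close>

lemma count_translates:
  fixes P W :: int
  defines "sols \<equiv> \<lambda>s lam P A n. {x \<in> Pi\<^sub>E {..<s::nat} (\<lambda>_. A). (P::int) dvd (\<Sum>l<s. lam l * x l) - n}"
  assumes P: "P \<ge> 1" and A: "A \<subseteq> {0..<P}" and H: "H \<ge> 1" and \<delta>: "\<delta> > 0" and s: "s \<ge> 1"
    and dens: "real (card A) \<ge> \<delta> * real_of_int P"
    and roth: "\<And>A'. A' \<subseteq> {0..<P} \<Longrightarrow> real (card A') \<ge> \<delta> / 2 * real_of_int P \<Longrightarrow> real (card (sols s lam P A' 0)) \<ge> c * real_of_int P ^ (s - 1)"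
  shows "(\<Sum>h\<in>Pi\<^sub>E {..<s} (\<lambda>_. {1..int H}). real (card (sols s lam P A (W * (\<Sum>l<s. lam l * h l)))))
     \<ge> (\<delta> / 2) ^ s * c * real_of_int P ^ (s - 1) * real H ^ s"
proof -
  have finA: "finite A" using A finite_subset by blast
  define hits where "hits y = {h \<in> {1..int H}. (y + W * h) mod P \<in> A}" for y
  have fin_hits: "finite (hits y)" for y
    by (rule finite_subset[of _ "{1..int H}"]) (auto simp: hits_def)
  define A' where "A' = {y \<in> {0..<P}. real (card (hits y)) \<ge> \<delta> / 2 * real H}"
  have A': "A' \<subseteq> {0..<P}" by (auto simp: A'_def)
  have finA': "finite A'" using A' finite_subset by blast
  have "real (card A') \<ge> \<delta> / 2 * real_of_int P"
  proof -
    have shift: "card A \<le> card {y \<in> {0..<P}. (y + W * h) mod P \<in> A}" for h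
    proof (rule card_inj_on_le[of "\<lambda>a. (a - W * h) mod P"])
      show "inj_on (\<lambda>a. (a - W * h) mod P) A"
      proof (rule inj_onI)
        fix a b assume ab: "a \<in> A" "b \<in> A" "(a - W * h) mod P = (b - W * h) mod P"
        then have "P dvd a - b" by (simp add: mod_eq_dvd_iff)
        then show "a = b" using ab A by (intro dvd_diff_imp_eq) auto
      qed
      show "(\<lambda>a. (a - W * h) mod P) ` A \<subseteq> {y \<in> {0..<P}. (y + W * h) mod P \<in> A}"
      proof (rule image_subsetI)
        fix a assume a: "a \<in> A"
        then have "a mod P = a" using A by (auto intro: mod_pos_pos_trivial)
        then have "((a - W * h) mod P + W * h) mod P = a" by (simp add: mod_simps)
        then show "(a - W * h) mod P \<in> {y \<in> {0..<P}. (y + W * h) mod P \<in> A}" using a P by simp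
      qed
    qed (rule finite_subset[of _ "{0..<P}"], auto)
    have "real H * real (card A) = (\<Sum>h\<in>{1..int H}. real (card A))" by simp
    also have "\<dots> \<le> (\<Sum>h\<in>{1..int H}. real (card {y \<in> {0..<P}. (y + W * h) mod P \<in> A}))"
      by (intro sum_mono of_nat_mono shift)
    also have "\<dots> = (\<Sum>h\<in>{1..int H}. \<Sum>y\<in>{0..<P}. of_bool ((y + W * h) mod P \<in> A))"
      by (intro sum.cong refl real_card_filter) simp
    also have "\<dots> = (\<Sum>y\<in>{0..<P}. \<Sum>h\<in>{1..int H}. of_bool ((y + W * h) mod P \<in> A))" by (rule sum.swap)
    also have "\<dots> = (\<Sum>y\<in>{0..<P}. real (card (hits y)))"
      unfolding hits_def by (intro sum.cong refl real_card_filter[symmetric]) simp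
    also have "\<dots> \<le> (\<Sum>y\<in>{0..<P}. (if y \<in> A' then real H else 0) + \<delta> / 2 * real H)"
    proof (rule sum_mono)
      fix y assume y: "y \<in> {0..<P}"
      have "card (hits y) \<le> card {1..int H}" by (intro card_mono) (auto simp: hits_def)
      then have "real (card (hits y)) \<le> real H" by simp
      moreover have "0 \<le> \<delta> / 2 * real H" using \<delta> by simp
      ultimately show "real (card (hits y)) \<le> (if y \<in> A' then real H else 0) + \<delta> / 2 * real H"
        using y by (cases "y \<in> A'") (auto simp: A'_def)
    qed
    also have "\<dots> = real (card A') * real H + real_of_int P * (\<delta> / 2 * real H)"
    proof -
      have "(\<Sum>y\<in>{0..<P}. if y \<in> A' then real H else 0) = (\<Sum>y\<in>A'. real H)"
        using A' by (intro sum.mono_neutral_cong_right) auto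
      then show ?thesis using P by (simp add: sum.distrib)
    qed
    finally have "real H * real (card A) \<le> real H * (real (card A') + \<delta> / 2 * real_of_int P)"
      by (simp add: algebra_simps)
    then have "real (card A) \<le> real (card A') + \<delta> / 2 * real_of_int P" using H by simp
    then show ?thesis using dens by linarith
  qed
  from roth[OF A' this] have c: "c * real_of_int P ^ (s - 1) \<le> real (card (sols s lam P A' 0))" .
  define box where "box = Pi\<^sub>E {..<s} (\<lambda>_. {1..int H})"
  have finbox: "finite box" unfolding box_def by (intro finite_PiE) auto
  have fin_sols: "finite (sols s lam P A n)" for n
    unfolding sols_def using finA by (intro finite_subset[OF _ finite_PiE[of "{..<s}" "\<lambda>_. A"]]) auto
  have fin_sols': "finite (sols s lam P A' n)" for n
    unfolding sols_def using finA' by (intro finite_subset[OF _ finite_PiE[of "{..<s}" "\<lambda>_. A'"]]) auto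
  define T1 where "T1 = (SIGMA y:sols s lam P A' 0. Pi\<^sub>E {..<s} (\<lambda>l. hits (y l)))"
  define T2 where "T2 = (SIGMA h:box. sols s lam P A (W * (\<Sum>l<s. lam l * h l)))"
  \<comment> \<open>Keeping \<open>h\<close> in the image makes the map injective: each
    \<open>y l\<close> is then recovered modulo \<open>P\<close>.\<close>
  define F where "F = (\<lambda>(y::nat \<Rightarrow> int, h::nat \<Rightarrow> int). (h, \<lambda>l\<in>{..<s}. (y l + W * h l) mod P))"
  have sub: "F ` T1 \<subseteq> T2"
  proof (rule image_subsetI)
    fix p assume "p \<in> T1"
    then obtain y h where p: "p = (y, h)" and y: "y \<in> sols s lam P A' 0" and h: "h \<in> Pi\<^sub>E {..<s} (\<lambda>l. hits (y l))"
      unfolding T1_def by auto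
    have "h \<in> box" using h by (auto simp: box_def hits_def PiE_iff)
    moreover have "(\<lambda>l\<in>{..<s}. (y l + W * h l) mod P) \<in> Pi\<^sub>E {..<s} (\<lambda>_. A)" using h by (auto simp: hits_def PiE_iff)
    moreover have "P dvd (\<Sum>l<s. lam l * (\<lambda>l\<in>{..<s}. (y l + W * h l) mod P) l) - W * (\<Sum>l<s. lam l * h l)"
    proof -
      have "(\<Sum>l<s. lam l * (\<lambda>l\<in>{..<s}. (y l + W * h l) mod P) l) - W * (\<Sum>l<s. lam l * h l)
        = (\<Sum>l<s. lam l * ((y l + W * h l) mod P - (y l + W * h l))) + (\<Sum>l<s. lam l * y l)"
        by (simp add: sum_distrib_left sum.distrib[symmetric] sum_subtractf[symmetric] algebra_simps)
      moreover have "P dvd (\<Sum>l<s. lam l * ((y l + W * h l) mod P - (y l + W * h l)))"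
        by (intro dvd_sum dvd_mult) (simp add: mod_eq_dvd_iff[symmetric])
      moreover have "P dvd (\<Sum>l<s. lam l * y l)" using y by (simp add: sols_def)
      ultimately show ?thesis by simp
    qed
    ultimately show "F p \<in> T2" by (simp add: p F_def T2_def sols_def)
  qed
  have inj: "inj_on F T1"
  proof (rule inj_onI)
    fix p p' assume pT: "p \<in> T1" "p' \<in> T1" and eq: "F p = F p'"
    obtain y h y' h' where p: "p = (y, h)" "p' = (y', h')" by fastforce
    have h: "h = h'" using eq by (simp add: p F_def)
    have yy: "y \<in> Pi\<^sub>E {..<s} (\<lambda>_. A')" "y' \<in> Pi\<^sub>E {..<s} (\<lambda>_. A')" using pT by (auto simp: p T1_def sols_def)
    have "y = y'"
    proof (rule PiE_ext[OF yy])
      fix l assume l: "l \<in> {..<s}"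
      have "(y l + W * h l) mod P = (y' l + W * h l) mod P"
        using eq l by (auto simp: p F_def h dest!: fun_cong[of _ _ l])
      then have "P dvd y l - y' l" by (simp add: mod_eq_dvd_iff)
      moreover have "y l \<in> {0..<P}" "y' l \<in> {0..<P}" using yy l A' by (auto simp: PiE_iff)
      ultimately show "y l = y' l" by (rule dvd_diff_imp_eq)
    qed
    with h p show "p = p'" by simp
  qed
  have "(\<delta> / 2 * real H) ^ s * real (card (sols s lam P A' 0)) = (\<Sum>y\<in>sols s lam P A' 0. \<Prod>l<s. \<delta> / 2 * real H)" by simp
  also have "\<dots> \<le> (\<Sum>y\<in>sols s lam P A' 0. \<Prod>l<s. real (card (hits (y l))))"
  proof (intro sum_mono prod_mono conjI)
    fix y l assume "y \<in> sols s lam P A' 0" "l \<in> {..<s}"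
    then have "y l \<in> A'" by (auto simp: sols_def PiE_iff)
    then show "\<delta> / 2 * real H \<le> real (card (hits (y l)))" by (simp add: A'_def)
  qed (use \<delta> in simp)
  also have "\<dots> = real (card T1)"
    unfolding T1_def using fin_sols' fin_hits by (subst card_SigmaI) (auto simp: card_PiE intro!: finite_PiE)
  also have "\<dots> \<le> real (card T2)"
    unfolding T2_def[symmetric] using finbox fin_sols
    by (intro of_nat_mono card_inj_on_le[OF inj sub]) (auto simp: T2_def)
  also have "\<dots> = (\<Sum>h\<in>box. real (card (sols s lam P A (W * (\<Sum>l<s. lam l * h l)))))"
    unfolding T2_def using finbox fin_sols by (subst card_SigmaI) auto
  finally have "(\<delta> / 2 * real H) ^ s * real (card (sols s lam P A' 0)) \<le> (\<Sum>h\<in>box. real (card (sols s lam P A (W * (\<Sum>l<s. lam l * h l)))))" .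
  moreover have "(\<delta> / 2 * real H) ^ s * (c * real_of_int P ^ (s - 1)) \<le> (\<delta> / 2 * real H) ^ s * real (card (sols s lam P A' 0))"
    using \<delta> by (intro mult_left_mono c) simp
  moreover have "(\<delta> / 2 * real H) ^ s * (c * real_of_int P ^ (s - 1)) = (\<delta> / 2) ^ s * c * real_of_int P ^ (s - 1) * real H ^ s"
    unfolding power_mult_distrib by (simp only: mult_ac)
  ultimately show ?thesis unfolding box_def by linarith
qed

text \<open>\<open>A\<close> is viewed modulo P = 1 + B N. As \<open>B\<close> is a multiple of all
  coefficients, they are units modulo \<open>P\<close>; as P exceeds (\<Lambda> + 1) N, the
  congruences in question are equations. With \<theta> a = - a Z / P the transform at
  \<open>m\<close> counts solutions with right-hand side Z m, so a box average with multiplier W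
  counts translates with multiplier Z W.\<close>

theorem dense_set_power_recurrence:
  fixes lam :: "nat \<Rightarrow> int" and \<delta> :: real
  assumes s: "s \<ge> 2" and lam: "\<And>l. l < s \<Longrightarrow> lam l \<noteq> 0" and lam0: "(\<Sum>l<s. lam l) = 0" and k: "k \<ge> 1" and \<delta>: "\<delta> > 0"
  shows "\<exists>L\<ge>1::nat. \<exists>c>0. \<forall>N\<ge>1::nat. \<forall>A\<subseteq>{1..int N}. \<delta> * real N \<le> real (card A) \<longrightarrow>
    (\<forall>Z. \<bar>Z\<bar> * int L ^ k \<le> int N \<longrightarrow>
      (\<exists>n\<in>{1..L}. c * real N ^ (s - 1) \<le> real (card {x \<in> Pi\<^sub>E {..<s} (\<lambda>_. A). (\<Sum>l<s. lam l * x l) = Z * int n ^ k})))"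
proof -
  define \<Lambda> where "\<Lambda> = (\<Sum>l<s. \<bar>lam l\<bar>)"
  define q where "q = (\<Prod>l<s. \<bar>lam l\<bar>)"
  define B where "B = q * (\<Lambda> + 1)"
  have q1: "q \<ge> 1" unfolding q_def using lam by (intro prod_ge_1) force
  have \<Lambda>0: "\<Lambda> \<ge> 0" unfolding \<Lambda>_def by (intro sum_nonneg) auto
  have B1: "B \<ge> \<Lambda> + 1" unfolding B_def using q1 \<Lambda>0 mult_right_mono[of 1 q "\<Lambda> + 1"] by simp
  with \<Lambda>0 have B: "B \<ge> \<Lambda> + 1" "B \<ge> 1" by linarith+
  \<comment> \<open>Density relative to \<open>P\<close> instead of \<open>N\<close>, as P \<le> (1
    + B) N.\<close>
  define \<delta>' where "\<delta>' = \<delta> / (1 + of_int B)"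
  have \<delta>': "\<delta>' > 0" using \<delta> B by (simp add: \<delta>'_def)
  obtain cR where cR: "cR > 0" and roth: "\<forall>P::int. P \<ge> 1 \<longrightarrow> (\<forall>l<s. coprime (lam l) P) \<longrightarrow> (\<forall>A\<subseteq>{0..<P}. real (card A) \<ge> \<delta>' / 2 * real_of_int P \<longrightarrow>
     real (card {x \<in> Pi\<^sub>E {..<s} (\<lambda>_. A). P dvd (\<Sum>l<s. lam l * x l)}) \<ge> cR * real_of_int P ^ (s - 1))"
    using roth_mod[OF s _ lam0, of "\<delta>' / 2"] \<delta>' by auto
  define c0 where "c0 = (\<delta>' / 2) ^ s * cR"
  have c0: "c0 > 0" using \<delta>' cR by (simp add: c0_def)
  obtain L :: nat where L: "L \<ge> 1" and corr: "\<forall>(J::int set) c \<theta>. finite J \<longrightarrow> (\<Sum>j\<in>J. norm (c j)) \<le> 1 \<longrightarrow>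
    (\<forall>W\<ge>1. \<forall>H\<ge>1. c0 \<le> Re (\<Sum>j\<in>J. c j * box_avg s lam W H (\<theta> j))) \<longrightarrow>
    (\<exists>n\<in>{1..L}. c0 / 2 \<le> Re (\<Sum>j\<in>J. c j * ee (real (n ^ k) * \<theta> j)))"
    using power_average_ge_of_box_average_ge[where s=s and lam=lam and 'j=int, OF _ lam k c0] s by fastforce
  have "\<exists>n\<in>{1..L}. c0 / 2 * real N ^ (s - 1) \<le> real (card {x \<in> Pi\<^sub>E {..<s} (\<lambda>_. A). (\<Sum>l<s. lam l * x l) = Z * int n ^ k})"
    if N: "N \<ge> 1" and A: "A \<subseteq> {1..int N}" and dens: "\<delta> * real N \<le> real (card A)" and Z: "\<bar>Z\<bar> * int L ^ k \<le> int N" for N A Z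
  proof -
    define P where "P = 1 + B * int N"
    have "B * int N \<ge> (\<Lambda> + 1) * int N" "(\<Lambda> + 1) * int N \<ge> int N"
      using B \<Lambda>0 mult_right_mono[of 1 "\<Lambda> + 1" "int N"] by (auto intro: mult_right_mono)
    then have P: "P \<ge> 1" "P > int N" "P > (\<Lambda> + 1) * int N" by (auto simp: P_def)
    have AP: "A \<subseteq> {0..<P}" using A P by auto
    have cop: "coprime (lam l) P" if "l < s" for l
    proof -
      have "lam l dvd q" unfolding q_def using that by (subst abs_dvd_iff[symmetric]) (intro dvd_prodI, auto)
      then have "lam l dvd B * int N" by (simp add: B_def)
      then obtain t where "B * int N = lam l * t" by blast
      then have eq: "P = 1 + t * lam l" by (simp add: P_def)
      show ?thesis
      proof (rule coprimeI)
        fix c assume "c dvd lam l" "c dvd P"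
        then have "c dvd P - t * lam l" by (intro dvd_diff) auto
        then show "is_unit c" unfolding eq by simp
      qed
    qed
    have densP: "real (card A) \<ge> \<delta>' * real_of_int P"
    proof -
      have "real_of_int P \<le> (1 + of_int B) * real N" using N by (simp add: P_def algebra_simps)
      then have "\<delta>' * real_of_int P \<le> \<delta>' * ((1 + of_int B) * real N)" using \<delta>' by (intro mult_left_mono) auto
      also have "\<dots> = \<delta> * real N" using B by (simp add: \<delta>'_def)
      finally show ?thesis using dens by simp
    qed
    define cf where "cf = fourier_coeff s lam P A"
    define \<theta> :: "int \<Rightarrow> real" where "\<theta> a = - of_int (a * Z) / of_int P" for a
    define S where "S n = {x \<in> Pi\<^sub>E {..<s} (\<lambda>_. A). P dvd (\<Sum>l<s. lam l * x l) - n}" for n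
    have count: "(\<Sum>a\<in>{0..<P}. cf a * ee (of_int m * \<theta> a)) = of_nat (card (S (Z * m))) / of_int P ^ (s - 1)" for m :: int
      unfolding cf_def \<theta>_def S_def by (rule fourier_count) (use P AP s in auto)
    have "c0 \<le> Re (\<Sum>a\<in>{0..<P}. cf a * box_avg s lam W H (\<theta> a))" if "W \<ge> 1" "H \<ge> 1" for W H :: nat
    proof -
      let ?box = "Pi\<^sub>E {..<s} (\<lambda>_. {1..int H})"
      have "(\<Sum>a\<in>{0..<P}. cf a * box_avg s lam W H (\<theta> a))
        = (\<Sum>h\<in>?box. \<Sum>a\<in>{0..<P}. cf a * ee (of_int (int W * (\<Sum>l<s. lam l * h l)) * \<theta> a)) / of_nat (H ^ s)"
        unfolding box_avg_def sum_divide_distrib sum_distrib_left times_divide_eq_right by (rule sum.swap)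
      also have "\<dots> = (\<Sum>h\<in>?box. of_nat (card (S (Z * (int W * (\<Sum>l<s. lam l * h l))))) / of_int P ^ (s - 1)) / of_nat (H ^ s)"
        unfolding count ..
      also have "\<dots> = of_real ((\<Sum>h\<in>?box. real (card (S (Z * int W * (\<Sum>l<s. lam l * h l))))) / of_int P ^ (s - 1) / real H ^ s)"
        by (simp add: sum_divide_distrib mult.assoc)
      finally have "Re (\<Sum>a\<in>{0..<P}. cf a * box_avg s lam W H (\<theta> a))
         = (\<Sum>h\<in>?box. real (card (S (Z * int W * (\<Sum>l<s. lam l * h l))))) / of_int P ^ (s - 1) / real H ^ s" by (simp only: Re_complex_of_real)
      moreover have "(\<Sum>h\<in>?box. real (card (S (Z * int W * (\<Sum>l<s. lam l * h l))))) \<ge> (\<delta>' / 2) ^ s * cR * real_of_int P ^ (s - 1) * real H ^ s"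
        unfolding S_def
        by (rule count_translates[OF P(1) AP that(2) \<delta>' _ densP]) (use s P roth cop in auto)
      ultimately show ?thesis using P that(2) by (simp add: c0_def le_divide_eq)
    qed
    moreover have "(\<Sum>a\<in>{0..<P}. norm (cf a)) \<le> 1"
      unfolding cf_def by (rule sum_norm_fourier_coeff_le[OF s P(1) AP cop])
    ultimately obtain n where n: "n \<in> {1..L}" "c0 / 2 \<le> Re (\<Sum>a\<in>{0..<P}. cf a * ee (real (n ^ k) * \<theta> a))"
      using corr[rule_format, of "{0..<P}" cf \<theta>] by auto
    have "(\<Sum>a\<in>{0..<P}. cf a * ee (real (n ^ k) * \<theta> a)) = of_real (real (card (S (Z * int n ^ k))) / of_int P ^ (s - 1))"
      using count[of "int n ^ k"] by simp
    then have "c0 / 2 \<le> real (card (S (Z * int n ^ k))) / of_int P ^ (s - 1)" using n(2) by (simp only: Re_complex_of_real)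
    then have "c0 / 2 * of_int P ^ (s - 1) \<le> real (card (S (Z * int n ^ k)))" using P by (simp add: le_divide_eq)
    moreover have "c0 / 2 * real N ^ (s - 1) \<le> c0 / 2 * of_int P ^ (s - 1)"
      using c0 P by (intro mult_left_mono power_mono) auto
    moreover have "S (Z * int n ^ k) = {x \<in> Pi\<^sub>E {..<s} (\<lambda>_. A). (\<Sum>l<s. lam l * x l) = Z * int n ^ k}"
    proof -
      have "(\<Sum>l<s. lam l * x l) = Z * int n ^ k" if x: "x \<in> Pi\<^sub>E {..<s} (\<lambda>_. A)" and d: "P dvd (\<Sum>l<s. lam l * x l) - Z * int n ^ k" for x
      proof (rule ccontr)
        assume ne: "\<not> ?thesis"
        have "\<bar>\<Sum>l<s. lam l * x l\<bar> \<le> (\<Sum>l<s. \<bar>lam l * x l\<bar>)" by (rule sum_abs)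
        also have "\<dots> \<le> (\<Sum>l<s. \<bar>lam l\<bar> * int N)"
        proof (rule sum_mono)
          fix l assume "l \<in> {..<s}"
          then have "x l \<in> {1..int N}" using x A by (auto simp: PiE_iff)
          then show "\<bar>lam l * x l\<bar> \<le> \<bar>lam l\<bar> * int N" by (simp add: abs_mult mult_left_mono)
        qed
        also have "\<dots> = \<Lambda> * int N" by (simp add: \<Lambda>_def sum_distrib_right)
        finally have 1: "\<bar>\<Sum>l<s. lam l * x l\<bar> \<le> \<Lambda> * int N" .
        have "int n ^ k \<le> int L ^ k" using n by (intro power_mono) auto
        then have "\<bar>Z * int n ^ k\<bar> \<le> \<bar>Z\<bar> * int L ^ k" by (simp add: abs_mult mult_left_mono)
        then have "\<bar>Z * int n ^ k\<bar> \<le> int N" using Z by simp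
        with 1 have "\<bar>(\<Sum>l<s. lam l * x l) - Z * int n ^ k\<bar> \<le> \<Lambda> * int N + int N" by linarith
        then have 2: "\<bar>(\<Sum>l<s. lam l * x l) - Z * int n ^ k\<bar> < P" using P(3) by (simp add: distrib_right)
        moreover have "P dvd \<bar>(\<Sum>l<s. lam l * x l) - Z * int n ^ k\<bar>" using d by simp
        ultimately show False using zdvd_imp_le[of P "\<bar>(\<Sum>l<s. lam l * x l) - Z * int n ^ k\<bar>"] ne by linarith
      qed
      then show ?thesis unfolding S_def by auto
    qed
    ultimately show ?thesis using n(1) by (intro bexI[of _ n]) auto
  qed
  then show ?thesis using L c0 by (intro exI[of _ L] conjI exI[of _ "c0 / 2"]) auto
qed

section \<open>Simultaneous equations\<close>

text \<open>Digits may be negative. The lowest one is divisible by \<open>b\<close> and smaller than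
  \<open>b\<close> in absolute value, hence 0; the rest follows after division by
  \<open>b\<close>.\<close>

lemma digits_eq_0:
  fixes d :: "nat \<Rightarrow> int" and b :: int
  assumes "\<And>i. i < R \<Longrightarrow> \<bar>d i\<bar> < b" and "(\<Sum>i<R. d i * b ^ i) = 0" and "i < R"
  shows "d i = 0"
  using assms
proof (induction R arbitrary: d i)
  case (Suc R)
  have "(\<Sum>i<Suc R. d i * b ^ i) = d 0 + b * (\<Sum>i<R. d (Suc i) * b ^ i)"
    unfolding sum.lessThan_Suc_shift by (simp add: sum_distrib_left mult_ac)
  then have eq: "d 0 + b * (\<Sum>i<R. d (Suc i) * b ^ i) = 0" using Suc.prems(2) by simp
  then have "b dvd d 0" by (metis add_eq_0_iff dvd_minus_iff dvd_triv_left)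
  moreover have d0: "\<bar>d 0\<bar> < b" using Suc.prems(1) by simp
  ultimately have 0: "d 0 = 0" by (metis abs_ge_zero dvd_abs_iff zdvd_not_zless zero_less_abs_iff)
  have b: "b > 0" using d0 by linarith
  then have "(\<Sum>i<R. d (Suc i) * b ^ i) = 0" using eq 0 by simp
  then have "d (Suc j) = 0" if "j < R" for j using Suc.IH[of "\<lambda>i. d (Suc i)" j] Suc.prems(1) that by auto
  with 0 show ?case using Suc.prems(3) by (cases i) auto
qed simp

lemma sum_digits_less:
  fixes a :: "nat \<Rightarrow> int"
  assumes "\<And>i. i < R \<Longrightarrow> a i \<le> b - 1"  "b \<ge> 1"
  shows "(\<Sum>i<R. a i * b ^ i) \<le> b ^ R - 1"
  using assms(1)
proof (induction R)
  case (Suc R)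
  have "a R * b ^ R \<le> (b - 1) * b ^ R" using Suc.prems[of R] assms(2) by (intro mult_right_mono) auto
  with Suc show ?case by (simp add: algebra_simps)
qed simp

text \<open>The last coordinate is determined by the others. This trivial bound has the same order
  as the lower bounds, which allows a single factor to be isolated from a product of counts.\<close>

lemma card_linear_solutions_le:
  fixes lam :: "nat \<Rightarrow> int"
  assumes "finite A" and s: "s \<ge> 1" and lam: "lam (s - 1) \<noteq> 0"
  shows "card {x \<in> Pi\<^sub>E {..<s} (\<lambda>_. A). (\<Sum>l<s. lam l * x l) = m} \<le> card A ^ (s - 1)"
proof -
  obtain r where r: "s = Suc r" using s by (cases s) auto
  let ?X = "{x \<in> Pi\<^sub>E {..<s} (\<lambda>_. A). (\<Sum>l<s. lam l * x l) = m}"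
  have "card ?X \<le> card (Pi\<^sub>E {..<r} (\<lambda>_. A))"
  proof (rule card_inj_on_le[of "\<lambda>x. restrict x {..<r}"])
    show "inj_on (\<lambda>x. restrict x {..<r}) ?X"
    proof (rule inj_onI)
      fix x y assume x: "x \<in> ?X" and y: "y \<in> ?X" and eq: "restrict x {..<r} = restrict y {..<r}"
      have low: "x l = y l" if "l < r" for l using fun_cong[OF eq, of l] that by simp
      then have "(\<Sum>l<r. lam l * x l) = (\<Sum>l<r. lam l * y l)" by (intro sum.cong) auto
      moreover have "(\<Sum>l<r. lam l * x l) + lam r * x r = m" "(\<Sum>l<r. lam l * y l) + lam r * y r = m"
        using x y by (auto simp: r)
      ultimately have "lam r * x r = lam r * y r" by linarith
      then have "x r = y r" using lam by (simp add: r)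
      then have "x l = y l" if "l < s" for l using low that by (cases "l = r") (auto simp: r less_Suc_eq)
      then show "x = y" using x y by (intro PiE_ext[where k="{..<s}"]) auto
    qed
    show "(\<lambda>x. restrict x {..<r}) ` ?X \<subseteq> Pi\<^sub>E {..<r} (\<lambda>_. A)"
    proof (rule image_subsetI)
      fix x assume "x \<in> ?X"
      then have "x l \<in> A" if "l < r" for l using that by (simp add: r PiE_iff)
      then show "restrict x {..<r} \<in> Pi\<^sub>E {..<r} (\<lambda>_. A)" by (simp add: restrict_PiE_iff)
    qed
    show "finite (Pi\<^sub>E {..<r} (\<lambda>_. A))" using assms(1) by (intro finite_PiE) auto
  qed
  then show ?thesis by (simp add: card_PiE r)
qed

text \<open>Reading an \<open>R\<close>-tuple of elements of \<open>A\<close> as the digits of one integer turns \<open>R\<close> simultaneous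
  equations into a single equation over a set that is still dense.\<close>

theorem simultaneous_power_recurrence:
  fixes lam :: "nat \<Rightarrow> int" and \<delta> :: real and R :: nat
  assumes s: "s \<ge> 2" and lam: "\<And>l. l < s \<Longrightarrow> lam l \<noteq> 0" and lam0: "(\<Sum>l<s. lam l) = 0" and k: "k \<ge> 1" and \<delta>: "\<delta> > 0"
  shows "\<exists>L\<ge>1::nat. \<exists>c>0. \<forall>N\<ge>1::nat. \<forall>A\<subseteq>{1..int N}. \<delta> * real N \<le> real (card A) \<longrightarrow>
    (\<forall>z. (\<forall>i<R. \<bar>z i\<bar> * int L ^ k \<le> int N) \<longrightarrow>
      (\<exists>n\<in>{1..L}. \<forall>i<R. c * real N ^ (s - 1) \<le> real (card {x \<in> Pi\<^sub>E {..<s} (\<lambda>_. A). (\<Sum>l<s. lam l * x l) = z i * int n ^ k})))"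
proof (cases "R = 0")
  case True
  then show ?thesis by (intro exI[of _ 1] conjI exI[of _ "1::real"]) auto
next
  case False
  define \<Lambda> where "\<Lambda> = (\<Sum>l<s. \<bar>lam l\<bar>)"
  have \<Lambda>0: "\<Lambda> \<ge> 0" unfolding \<Lambda>_def by (intro sum_nonneg) auto
  \<comment> \<open>The encoded set has at least (\<delta> N)^R elements in an interval of length
    b^R, with b \<le> (2 \<Lambda> + 3) N.\<close>
  define \<delta>' where "\<delta>' = (\<delta> / (2 * of_int \<Lambda> + 3)) ^ R"
  have \<delta>': "\<delta>' > 0" using \<delta> \<Lambda>0 by (simp add: \<delta>'_def)
  obtain L :: nat and c where L: "L \<ge> 1" and c: "c > 0" and core: "\<forall>N\<ge>1::nat. \<forall>A\<subseteq>{1..int N}. \<delta>' * real N \<le> real (card A) \<longrightarrow>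
    (\<forall>Z. \<bar>Z\<bar> * int L ^ k \<le> int N \<longrightarrow>
      (\<exists>n\<in>{1..L}. c * real N ^ (s - 1) \<le> real (card {x \<in> Pi\<^sub>E {..<s} (\<lambda>_. A). (\<Sum>l<s. lam l * x l) = Z * int n ^ k})))"
    using dense_set_power_recurrence[OF s lam lam0 k \<delta>'] by blast
  have "\<exists>n\<in>{1..L}. \<forall>i<R. c * real N ^ (s - 1) \<le> real (card {x \<in> Pi\<^sub>E {..<s} (\<lambda>_. A). (\<Sum>l<s. lam l * x l) = z i * int n ^ k})"
    if N: "N \<ge> 1" and A: "A \<subseteq> {1..int N}" and dens: "\<delta> * real N \<le> real (card A)" and z: "\<forall>i<R. \<bar>z i\<bar> * int L ^ k \<le> int N" for N A z
  proof -
    have finA: "finite A" using A finite_subset by blast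
    have cA: "card A \<le> N" using card_mono[OF _ A] by simp
    \<comment> \<open>\<open>D\<close> bounds the difference of the two sides of each single
      equation, so in a base above \<open>D\<close> there are no carries and the merged equation
      splits digit by digit.\<close>
    define D where "D = (\<Lambda> + 1) * int N"
    define b where "b = 2 * D + 1"
    have DN: "D \<ge> int N" using mult_right_mono[of 1 "\<Lambda> + 1" "int N"] \<Lambda>0 by (simp add: D_def)
    have b: "b > D" "b \<ge> 1" "b \<ge> int N + 1" using DN N by (auto simp: b_def)
    have ble: "real_of_int b \<le> (2 * of_int \<Lambda> + 3) * real N" using N by (simp add: b_def D_def algebra_simps)
    define enc where "enc a = (\<Sum>i<R. a i * b ^ i)" for a :: "nat \<Rightarrow> int"
    let ?E = "Pi\<^sub>E {..<R} (\<lambda>_. A)"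
    have rng: "1 \<le> a i \<and> a i \<le> int N" if "a \<in> ?E" "i < R" for a i using that A by (force simp: PiE_iff)
    have inj: "inj_on enc ?E"
    proof (rule inj_onI)
      fix a a' assume a: "a \<in> ?E" "a' \<in> ?E" and eq: "enc a = enc a'"
      have "a i - a' i = 0" if i: "i < R" for i
      proof (rule digits_eq_0[where d="\<lambda>i. a i - a' i" and b=b, OF _ _ i])
        show "\<bar>a j - a' j\<bar> < b" if "j < R" for j using rng[OF a(1) that] rng[OF a(2) that] b by linarith
        show "(\<Sum>i<R. (a i - a' i) * b ^ i) = 0" using eq by (simp add: enc_def left_diff_distrib sum_subtractf)
      qed
      then show "a = a'" using a by (intro PiE_ext[where k="{..<R}"]) auto
    qed
    define NN where "NN = nat (b ^ R)"
    have NN: "int NN = b ^ R" "real NN = real_of_int b ^ R" "NN \<ge> 1"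
      using b by (auto simp: NN_def Suc_le_eq)
    have sub: "enc ` ?E \<subseteq> {1..int NN}"
    proof (rule image_subsetI)
      fix a assume a: "a \<in> ?E"
      have "enc a \<le> b ^ R - 1" unfolding enc_def using rng[OF a] b by (intro sum_digits_less) force+
      moreover have "enc a \<ge> a 0 * b ^ 0"
        unfolding enc_def using rng[OF a] b False by (intro member_le_sum) (auto intro!: mult_nonneg_nonneg, force)
      moreover have "a 0 \<ge> 1" using rng[OF a, of 0] False by simp
      ultimately show "enc a \<in> {1..int NN}" using NN by simp
    qed
    have "\<delta>' * real NN \<le> real (card (enc ` ?E))"
    proof -
      have "\<delta>' * real NN \<le> \<delta>' * ((2 * of_int \<Lambda> + 3) * real N) ^ R"
        unfolding NN(2) using \<delta>' ble b by (intro mult_left_mono power_mono) auto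
      also have "\<dots> = (\<delta> * real N) ^ R"
      proof -
        have "2 * real_of_int \<Lambda> + 3 \<noteq> 0" using \<Lambda>0 by linarith
        then show ?thesis unfolding \<delta>'_def power_mult_distrib[symmetric] by (simp add: mult_ac)
      qed
      also have "\<dots> \<le> real (card A) ^ R" using dens \<delta> by (intro power_mono) auto
      also have "\<dots> = real (card (enc ` ?E))" by (simp add: card_image[OF inj] card_PiE)
      finally show ?thesis .
    qed
    moreover define Z where "Z = (\<Sum>i<R. z i * b ^ i)"
    have "\<bar>Z\<bar> * int L ^ k \<le> int NN"
    proof -
      have "\<bar>Z\<bar> * int L ^ k \<le> (\<Sum>i<R. \<bar>z i * b ^ i\<bar>) * int L ^ k" unfolding Z_def by (intro mult_right_mono sum_abs) simp
      also have "\<dots> = (\<Sum>i<R. (\<bar>z i\<bar> * int L ^ k) * b ^ i)" 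
        unfolding sum_distrib_right using b by (intro sum.cong) (auto simp: abs_mult power_abs)
      also have "\<dots> \<le> b ^ R - 1" using z b by (intro sum_digits_less) force+
      finally show ?thesis using NN by simp
    qed
    ultimately obtain n where n: "n \<in> {1..L}" and big: "c * real NN ^ (s - 1) \<le> real (card {x \<in> Pi\<^sub>E {..<s} (\<lambda>_. enc ` ?E). (\<Sum>l<s. lam l * x l) = Z * int n ^ k})"
      using core NN(3) sub by blast
    let ?X = "{x \<in> Pi\<^sub>E {..<s} (\<lambda>_. enc ` ?E). (\<Sum>l<s. lam l * x l) = Z * int n ^ k}"
    define Sol where "Sol i = {x \<in> Pi\<^sub>E {..<s} (\<lambda>_. A). (\<Sum>l<s. lam l * x l) = z i * int n ^ k}" for i
    have finSol: "finite (Sol i)" for i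
      unfolding Sol_def using finA by (intro finite_subset[OF _ finite_PiE[of "{..<s}" "\<lambda>_. A"]]) auto
    \<comment> \<open>Transposes \<open>R\<close> solutions into one \<open>s\<close>-tuple of
      encoded numbers; covering \<open>?X\<close> by its image is enough for an upper bound on
      \<open>card ?X\<close>.\<close>
    define G where "G f = (\<lambda>l\<in>{..<s}. enc (\<lambda>i. f i l))" for f :: "nat \<Rightarrow> nat \<Rightarrow> int"
    have "?X \<subseteq> G ` Pi\<^sub>E {..<R} Sol"
    proof
      fix x assume x: "x \<in> ?X"
      then have "\<forall>l\<in>{..<s}. \<exists>a\<in>?E. x l = enc a" by (auto simp: PiE_iff image_iff)
      then obtain a where a: "\<And>l. l < s \<Longrightarrow> a l \<in> ?E \<and> x l = enc (a l)" by (metis lessThan_iff)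
      define f where "f = (\<lambda>i\<in>{..<R}. \<lambda>l\<in>{..<s}. a l i)"
      have xG: "x = G f"
      proof (rule PiE_ext[where k="{..<s}"])
        show "x \<in> Pi\<^sub>E {..<s} (\<lambda>_. UNIV)" using x by (auto simp: PiE_def)
        show "G f \<in> Pi\<^sub>E {..<s} (\<lambda>_. UNIV)" by (auto simp: G_def)
        show "x l = G f l" if "l \<in> {..<s}" for l
          using a[of l] that by (auto simp: G_def f_def enc_def intro!: sum.cong)
      qed
      have "(\<Sum>l<s. lam l * a l i) - z i * int n ^ k = 0" if i: "i < R" for i
      proof (rule digits_eq_0[where d="\<lambda>i. (\<Sum>l<s. lam l * a l i) - z i * int n ^ k" and b=b, OF _ _ i])
        fix j assume j: "j < R"
        have "\<bar>\<Sum>l<s. lam l * a l j\<bar> \<le> (\<Sum>l<s. \<bar>lam l * a l j\<bar>)" by (rule sum_abs)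
        also have "\<dots> \<le> (\<Sum>l<s. \<bar>lam l\<bar> * int N)"
        proof (rule sum_mono)
          fix l assume "l \<in> {..<s}"
          then have "1 \<le> a l j \<and> a l j \<le> int N" using a[of l] rng[of "a l" j] j by auto
          then show "\<bar>lam l * a l j\<bar> \<le> \<bar>lam l\<bar> * int N" by (simp add: abs_mult mult_left_mono)
        qed
        also have "\<dots> = \<Lambda> * int N" by (simp add: \<Lambda>_def sum_distrib_right)
        finally have 1: "\<bar>\<Sum>l<s. lam l * a l j\<bar> \<le> \<Lambda> * int N" .
        have "int n ^ k \<le> int L ^ k" using n by (intro power_mono) auto
        then have "\<bar>z j * int n ^ k\<bar> \<le> \<bar>z j\<bar> * int L ^ k" by (simp add: abs_mult mult_left_mono)
        then have "\<bar>z j * int n ^ k\<bar> \<le> int N" using z j by force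
        then have "\<bar>(\<Sum>l<s. lam l * a l j) - z j * int n ^ k\<bar> \<le> \<Lambda> * int N + int N" using 1 by linarith
        also have "\<dots> = D" by (simp add: D_def distrib_right)
        also have "\<dots> < b" by (rule b)
        finally show "\<bar>(\<Sum>l<s. lam l * a l j) - z j * int n ^ k\<bar> < b" .
      next
        have "(\<Sum>l<s. lam l * x l) = (\<Sum>l<s. lam l * enc (a l))" using a by (intro sum.cong) auto
        also have "\<dots> = (\<Sum>i<R. (\<Sum>l<s. lam l * a l i) * b ^ i)"
          unfolding enc_def sum_distrib_left sum_distrib_right by (subst sum.swap) (simp add: mult.assoc)
        finally have "(\<Sum>i<R. (\<Sum>l<s. lam l * a l i) * b ^ i) = (\<Sum>i<R. z i * b ^ i) * int n ^ k" using x by (simp add: Z_def)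
        moreover have "((\<Sum>l<s. lam l * a l i) - z i * int n ^ k) * b ^ i
            = (\<Sum>l<s. lam l * a l i) * b ^ i - (z i * b ^ i) * int n ^ k" for i
          by (subst left_diff_distrib) (simp only: mult_ac)
        ultimately show "(\<Sum>i<R. ((\<Sum>l<s. lam l * a l i) - z i * int n ^ k) * b ^ i) = 0"
          by (simp only: sum_subtractf sum_distrib_right diff_self)
      qed
      then have "f i \<in> Sol i" if "i < R" for i
        using that a by (auto simp: Sol_def f_def PiE_iff)
      then have "f \<in> Pi\<^sub>E {..<R} Sol" by (auto simp: f_def)
      with xG show "x \<in> G ` Pi\<^sub>E {..<R} Sol" by blast
    qed
    then have "card ?X \<le> card (G ` Pi\<^sub>E {..<R} Sol)" using finSol by (intro card_mono finite_imageI finite_PiE) auto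
    also have "\<dots> \<le> card (Pi\<^sub>E {..<R} Sol)" using finSol by (intro card_image_le finite_PiE) auto
    also have "\<dots> = (\<Prod>i<R. card (Sol i))" by (simp add: card_PiE)
    finally have "real (card ?X) \<le> real (\<Prod>i<R. card (Sol i))" by (rule of_nat_mono)
    with big have prod: "c * real NN ^ (s - 1) \<le> (\<Prod>i<R. real (card (Sol i)))" by simp
    \<comment> \<open>The product of the counts is at least c K^R and each count is at most K, so
      every single one is at least c K.\<close>
    have "c * real N ^ (s - 1) \<le> real (card (Sol i))" if i: "i < R" for i
    proof -
      define K where "K = real N ^ (s - 1)"
      have K: "K > 0" using N by (simp add: K_def)
      have SolK: "real (card (Sol j)) \<le> K" for j
      proof -
        have "card (Sol j) \<le> card A ^ (s - 1)"
          unfolding Sol_def using s lam by (intro card_linear_solutions_le finA) auto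
        also have "\<dots> \<le> N ^ (s - 1)" using cA by (intro power_mono) auto
        finally show ?thesis unfolding K_def by (metis of_nat_le_iff of_nat_power)
      qed
      have "K ^ R \<le> real NN ^ (s - 1)"
      proof -
        have "real N ^ R \<le> real NN" unfolding NN(2) using b by (intro power_mono) auto
        then have "(real N ^ R) ^ (s - 1) \<le> real NN ^ (s - 1)" by (intro power_mono) auto
        then show ?thesis unfolding K_def by (simp add: power_mult[symmetric] mult.commute)
      qed
      then have "c * K ^ R \<le> (\<Prod>i<R. real (card (Sol i)))" using prod c by (smt (verit) mult_left_mono)
      also have "\<dots> = real (card (Sol i)) * (\<Prod>j\<in>{..<R} - {i}. real (card (Sol j)))" using i by (intro prod.remove) auto
      also have "\<dots> \<le> real (card (Sol i)) * (\<Prod>j\<in>{..<R} - {i}. K)" by (intro mult_left_mono prod_mono) (auto intro: SolK)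
      also have "\<dots> = real (card (Sol i)) * K ^ (R - 1)" using i by simp
      finally have "(c * K) * K ^ (R - 1) \<le> real (card (Sol i)) * K ^ (R - 1)"
        using i by (cases R) (auto simp: mult_ac)
      then show ?thesis using K by (simp add: K_def mult_le_cancel_right)
    qed
    then show ?thesis unfolding Sol_def using n by blast
  qed
  then show ?thesis using L c by (intro exI[of _ L] conjI exI[of _ c]) auto
qed

section \<open>Positive density of smooth numbers\<close>

lemma card_multiples:
  assumes "d \<ge> 1"
  shows "card {m \<in> {1..n}. d dvd m} = n div (d::nat)"
proof -
  have "{m \<in> {1..n}. d dvd m} = (\<lambda>k. d * k) ` {1..n div d}"
  proof (intro equalityI subsetI)
    fix m assume "m \<in> {m \<in> {1..n}. d dvd m}"
    then obtain k where k: "m = d * k" "1 \<le> m" "m \<le> n" by auto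
    then have "k \<le> n div d" using assms by (metis div_le_mono nonzero_mult_div_cancel_left not_one_le_zero)
    moreover have "k \<ge> 1" using k by (cases k) auto
    ultimately show "m \<in> (\<lambda>k. d * k) ` {1..n div d}" using k by auto
  next
    fix m assume "m \<in> (\<lambda>k. d * k) ` {1..n div d}"
    then obtain k where "k \<in> {1..n div d}" and k: "m = d * k" by blast
    then have k: "m = d * k" "1 \<le> k" "k \<le> n div d" by auto
    have "d * k \<le> d * (n div d)" using k by simp
    also have "\<dots> \<le> n" by simp
    finally show "m \<in> {m \<in> {1..n}. d dvd m}" using k assms by auto
  qed
  moreover have "inj_on (\<lambda>k. d * k) {1..n div d}" using assms by (auto simp: inj_on_def)
  ultimately show ?thesis by (simp add: card_image)
qed

text \<open>Legendre's formula, by counting the pairs (m, j) with p^j dividing m in two ways.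
  Exponents above \<open>n\<close> cannot occur because p^j > j.\<close>

lemma multiplicity_fact:
  fixes p :: nat
  assumes p: "prime p"
  shows "multiplicity p (fact n) = (\<Sum>j\<in>{1..n}. n div p ^ j)"
proof -
  have p2: "p \<ge> 2" using p by (rule prime_ge_2_nat)
  have "multiplicity p (fact n) = (\<Sum>m\<in>{1..n}. multiplicity p m)"
  proof -
    have "multiplicity p (\<Prod>m\<in>{1..n}. m) = (\<Sum>m\<in>{1..n}. multiplicity p m)"
      using p by (intro prime_elem_multiplicity_prod_distrib) auto
    then show ?thesis by (simp add: fact_prod)
  qed
  also have "\<dots> = (\<Sum>m\<in>{1..n}. card {j \<in> {1..n}. p ^ j dvd m})"
  proof (rule sum.cong[OF refl])
    fix m assume m: "m \<in> {1..n}"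
    have "p ^ multiplicity p m \<le> m" using m by (intro dvd_imp_le multiplicity_dvd) auto
    moreover have "multiplicity p m < 2 ^ multiplicity p m" by (rule less_exp)
    moreover have "(2::nat) ^ multiplicity p m \<le> p ^ multiplicity p m" using p2 by (intro power_mono) auto
    moreover have "m \<le> n" using m by simp
    ultimately have "multiplicity p m \<le> n" by linarith
    moreover have dvd: "p ^ j dvd m \<longleftrightarrow> j \<le> multiplicity p m" for j
      using m p by (intro power_dvd_iff_le_multiplicity) auto
    ultimately have "{j \<in> {1..n}. p ^ j dvd m} = {1..multiplicity p m}"
      unfolding dvd by auto
    then show "multiplicity p m = card {j \<in> {1..n}. p ^ j dvd m}" by simp
  qed
  also have "\<dots> = (\<Sum>m\<in>{1..n}. \<Sum>j\<in>{1..n}. if p ^ j dvd m then 1 else 0)"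
    by (simp only: card_eq_sum sum.inter_filter finite_atLeastAtMost)
  also have "\<dots> = (\<Sum>j\<in>{1..n}. \<Sum>m\<in>{1..n}. if p ^ j dvd m then 1 else 0)" by (rule sum.swap)
  also have "\<dots> = (\<Sum>j\<in>{1..n}. n div p ^ j)"
  proof (rule sum.cong[OF refl])
    fix j
    have "(\<Sum>m\<in>{1..n}. if p ^ j dvd m then 1 else 0) = card {m \<in> {1..n}. p ^ j dvd m}"
      by (simp only: card_eq_sum sum.inter_filter finite_atLeastAtMost)
    also have "\<dots> = n div p ^ j" using p2 by (intro card_multiples) simp
    finally show "(\<Sum>m\<in>{1..n}. if p ^ j dvd m then 1 else 0) = n div p ^ j" .
  qed
  finally show ?thesis .
qed

lemma finite_primes_le: "finite {p::nat. prime p \<and> p \<le> n}"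
  by (rule finite_subset[of _ "{..n}"]) auto

lemma ln_fact_eq: "ln (fact n :: real) = (\<Sum>p | prime p \<and> p \<le> n. real (multiplicity p (fact n :: nat)) * ln (real p))"
proof -
  have "(fact n :: nat) = (\<Prod>p\<in>prime_factors (fact n :: nat). p ^ multiplicity p (fact n :: nat))"
    by (rule prime_factorization_nat) simp
  also have "prime_factors (fact n :: nat) = {p. prime p \<and> p \<le> n}"
    by (auto simp: prime_factors_dvd prime_dvd_fact_iff)
  finally have "real (fact n) = real (\<Prod>p | prime p \<and> p \<le> n. p ^ multiplicity p (fact n :: nat))" by simp
  then have "(fact n :: real) = (\<Prod>p | prime p \<and> p \<le> n. real p ^ multiplicity p (fact n :: nat))" by simp
  moreover have "ln (\<Prod>p | prime p \<and> p \<le> n. real p ^ multiplicity p (fact n :: nat))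
      = (\<Sum>p | prime p \<and> p \<le> n. ln (real p ^ multiplicity p (fact n :: nat)))"
    by (rule ln_prod) (auto simp: finite_primes_le intro: prime_gt_0_nat)
  ultimately have "ln (fact n :: real) = (\<Sum>p | prime p \<and> p \<le> n. ln (real p ^ multiplicity p (fact n :: nat)))"
    by (simp only:)
  also have "\<dots> = (\<Sum>p | prime p \<and> p \<le> n. real (multiplicity p (fact n :: nat)) * ln (real p))"
    by (intro sum.cong refl ln_realpow)
  finally show ?thesis .
qed

text \<open>n^n / n! is a single term of the exponential series at \<open>n\<close>, so it is at
  most e^n.\<close>

lemma ln_fact_ge: "n \<ge> 1 \<Longrightarrow> real n * ln (real n) - real n \<le> ln (fact n)"
proof -
  assume n: "n \<ge> 1"
  have "(\<Sum>k\<in>{n}. real n ^ k /\<^sub>R fact k) \<le> (\<Sum>k. real n ^ k /\<^sub>R fact k)"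
    by (intro sum_le_suminf summable_exp_generic) auto
  then have "real n ^ n / fact n \<le> exp (real n)" by (simp add: exp_def field_simps)
  then have "ln (real n ^ n / fact n) \<le> real n"
    using n by (metis exp_gt_zero fact_gt_zero ln_exp ln_le_cancel_iff of_nat_0_less_iff zero_less_divide_iff zero_less_power less_le_trans zero_less_one)
  then show ?thesis using n by (simp add: ln_div ln_realpow)
qed

lemma ln_fact_le: "n \<ge> 1 \<Longrightarrow> ln (fact n) \<le> real n * ln (real n)"
proof -
  assume n: "n \<ge> 1"
  have "(fact n :: real) \<le> real (n ^ n)" by (rule fact_le_power)
  then have "(fact n :: real) \<le> real n ^ n" by simp
  then have "ln (fact n) \<le> ln (real n ^ n)" using n by simp
  then show ?thesis using n by (simp add: ln_realpow)
qed

lemma sum_inverse_powers_le: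
  assumes "p \<ge> (2::nat)"
  shows "(\<Sum>j\<in>{1..n}. 1 / real p ^ j) \<le> 1 / (real p - 1)"
proof -
  have "(\<Sum>j\<in>{1..n}. 1 / real p ^ j) = (1 - 1 / real p ^ n) / (real p - 1)"
  proof (induction n)
    case (Suc n)
    have "q / real p + (1 - q) / (real p - 1) = (1 - q / real p) / (real p - 1)" for q :: real
      using assms by (simp add: field_simps)
    from this[of "1 / real p ^ n"] show ?case using Suc by (simp add: field_simps)
  qed simp
  also have "\<dots> \<le> 1 / (real p - 1)" using assms by (intro divide_right_mono) auto
  finally show ?thesis .
qed

text \<open>In Legendre's formula each prime contributes at most n ln p / (p - 1) to ln n!.
  Replacing p - 1 by p costs a convergent series, since ln p \<le> 2 sqrt p makes the difference at
  most 4 p^(-3/2).\<close>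

lemma mertens_lower: "\<exists>C. \<forall>n\<ge>1. ln (real n) - C \<le> (\<Sum>p | prime p \<and> p \<le> n. ln (real p) / real p)"
proof -
  define C where "C = (\<Sum>m. 4 * real m powr (-3/2))"
  have summ: "summable (\<lambda>m. 4 * real m powr (-3/2))"
    by (intro summable_mult) (simp add: summable_real_powr_iff)
  have "ln (real n) - (1 + C) \<le> (\<Sum>p | prime p \<and> p \<le> n. ln (real p) / real p)" if n: "n \<ge> 1" for n
  proof -
    let ?P = "{p. prime p \<and> p \<le> n}"
    have "real n * ln (real n) - real n \<le> (\<Sum>p\<in>?P. real (multiplicity p (fact n :: nat)) * ln (real p))"
      using ln_fact_ge[OF n] unfolding ln_fact_eq .
    also have "\<dots> \<le> (\<Sum>p\<in>?P. (real n / (real p - 1)) * ln (real p))"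
    proof (intro sum_mono mult_right_mono)
      fix p assume p: "p \<in> ?P"
      then have p2: "p \<ge> 2" using prime_ge_2_nat by blast
      have "real (multiplicity p (fact n :: nat)) = (\<Sum>j\<in>{1..n}. real (n div p ^ j))"
        using p by (simp add: multiplicity_fact)
      also have "\<dots> \<le> (\<Sum>j\<in>{1..n}. real n / real p ^ j)"
        by (intro sum_mono) (metis of_nat_power of_nat_div_le_of_nat)
      also have "\<dots> = real n * (\<Sum>j\<in>{1..n}. 1 / real p ^ j)" by (simp add: sum_distrib_left)
      also have "\<dots> \<le> real n * (1 / (real p - 1))" by (intro mult_left_mono sum_inverse_powers_le p2) simp
      finally show "real (multiplicity p (fact n :: nat)) \<le> real n / (real p - 1)" by simp
      show "0 \<le> ln (real p)" using p2 by simp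
    qed
    also have "\<dots> \<le> (\<Sum>p\<in>?P. real n * (ln (real p) / real p + 4 * real p powr (-3/2)))"
    proof (intro sum_mono)
      fix p assume p: "p \<in> ?P"
      then have p2: "real p \<ge> 2" using prime_ge_2_nat by force
      have sq: "ln (real p) \<le> 2 * sqrt (real p)"
      proof -
        have "ln (sqrt (real p)) \<le> sqrt (real p) - 1" using p2 by (intro ln_le_minus_one) simp
        then show ?thesis using p2 by (simp add: ln_sqrt)
      qed
      have "ln (real p) / (real p - 1) = ln (real p) / real p + ln (real p) / (real p * (real p - 1))"
        using p2 by (simp add: field_simps)
      also have "ln (real p) / (real p * (real p - 1)) \<le> 2 * sqrt (real p) / (real p * (real p / 2))"
        using p2 sq by (intro frac_le mult_mono) auto
      also have "2 * sqrt (real p) / (real p * (real p / 2)) = 4 * real p powr (-3/2)"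
      proof -
        have "real p powr (1/2) / real p powr 2 = real p powr (1/2 - 2)" using p2 by (subst powr_diff) auto
        then show ?thesis using p2 by (simp add: powr_half_sqrt powr_numeral power2_eq_square)
      qed
      finally have "ln (real p) / (real p - 1) \<le> ln (real p) / real p + 4 * real p powr (-3/2)" by simp
      from mult_left_mono[OF this, of "real n"]
      show "(real n / (real p - 1)) * ln (real p) \<le> real n * (ln (real p) / real p + 4 * real p powr (-3/2))" by simp
    qed
    also have "\<dots> = real n * ((\<Sum>p\<in>?P. ln (real p) / real p) + (\<Sum>p\<in>?P. 4 * real p powr (-3/2)))"
      by (simp only: sum_distrib_left[symmetric] sum.distrib)
    also have "\<dots> \<le> real n * ((\<Sum>p\<in>?P. ln (real p) / real p) + C)"
      unfolding C_def by (intro mult_left_mono add_left_mono sum_le_suminf summ finite_primes_le) auto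
    finally have "real n * (ln (real n) - 1) \<le> real n * ((\<Sum>p\<in>?P. ln (real p) / real p) + C)"
      by (simp add: algebra_simps)
    then have "ln (real n) - 1 \<le> (\<Sum>p\<in>?P. ln (real p) / real p) + C" using n by (simp only: mult_le_cancel_left_pos of_nat_0_less_iff)
    then show ?thesis by simp
  qed
  then show ?thesis by blast
qed

text \<open>The obstacle is the sum of ln p over p \<le> x, lost by rounding n / p down. Instead of
  Chebyshev's estimate the trivial bound x ln x is used, with n = x y and y about ln x: the loss is
  then at most \<open>n\<close>, and the price is ln y, which is below \<delta> ln x up to a
  constant.\<close>

lemma mertens_upper:
  assumes \<delta>: "\<delta> > 0"
  shows "\<exists>C. \<forall>x::nat\<ge>1. (\<Sum>p | prime p \<and> p \<le> x. ln (real p) / real p) \<le> (1 + \<delta>) * ln (real x) + C"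
proof -
  define C where "C = 1 + 2 * \<delta> - ln \<delta>"
  have "(\<Sum>p | prime p \<and> p \<le> x. ln (real p) / real p) \<le> (1 + \<delta>) * ln (real x) + C" if x: "x \<ge> 1" for x :: nat
  proof -
    let ?P = "{p. prime p \<and> p \<le> x}"
    define y where "y = nat \<lceil>ln (real x)\<rceil> + 1"
    have lnx: "ln (real x) \<ge> 0" using x by simp
    have y: "y \<ge> 1" "real y \<ge> ln (real x)" "real y \<le> ln (real x) + 2" unfolding y_def using lnx by linarith+
    define n where "n = x * y"
    have n: "n \<ge> x" "n \<ge> 1" "real n = real x * real y" using x y(1) by (auto simp: n_def Suc_le_eq)
    have "(\<Sum>p\<in>?P. (real n / real p - 1) * ln (real p)) \<le> (\<Sum>p\<in>?P. real (multiplicity p (fact n :: nat)) * ln (real p))"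
    proof (intro sum_mono mult_right_mono)
      fix p assume p: "p \<in> ?P"
      then have p2: "p \<ge> 2" using prime_ge_2_nat by blast
      have 1: "real n / real p - 1 \<le> real (n div p)"
        using p2 real_of_nat_div[of p n] by (smt (verit) floor_divide_of_nat_eq of_int_of_nat_eq of_int_floor_le real_of_int_floor_ge_diff_one)
      have 2: "n div p \<le> (\<Sum>j\<in>{1..n}. n div p ^ j)"
        using member_le_sum[of 1 "{1..n}" "\<lambda>j. n div p ^ j"] n by simp
      have "n div p \<le> multiplicity p (fact n :: nat)" using p 2 by (simp add: multiplicity_fact)
      then have "real (n div p) \<le> real (multiplicity p (fact n :: nat))" by (rule of_nat_mono)
      with 1 show "real n / real p - 1 \<le> real (multiplicity p (fact n :: nat))" by linarith
      show "0 \<le> ln (real p)" using p2 by simp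
    qed
    also have "\<dots> \<le> (\<Sum>p | prime p \<and> p \<le> n. real (multiplicity p (fact n :: nat)) * ln (real p))"
    proof (rule sum_mono2)
      show "?P \<subseteq> {p. prime p \<and> p \<le> n}" using n(1) by auto
    qed (auto simp: finite_primes_le prime_gt_0_nat intro!: mult_nonneg_nonneg)
    also have "\<dots> \<le> real n * ln (real n)" unfolding ln_fact_eq[symmetric] using n(2) by (rule ln_fact_le)
    finally have "real n * (\<Sum>p\<in>?P. ln (real p) / real p) - (\<Sum>p\<in>?P. ln (real p)) \<le> real n * ln (real n)"
      by (simp add: sum_distrib_left left_diff_distrib sum_subtractf)
    moreover have "(\<Sum>p\<in>?P. ln (real p)) \<le> real n"
    proof -
      have "(\<Sum>p\<in>?P. ln (real p)) \<le> (\<Sum>p\<in>?P. ln (real x))"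
      proof (intro sum_mono)
        fix p assume "p \<in> ?P"
        then have "0 < real p" "real p \<le> real x" by (auto simp: prime_gt_0_nat)
        then show "ln (real p) \<le> ln (real x)" by simp
      qed
      also have "\<dots> = real (card ?P) * ln (real x)" by simp
      also have "\<dots> \<le> real x * ln (real x)"
      proof (intro mult_right_mono lnx of_nat_mono)
        have "card ?P \<le> card {1..x}" by (intro card_mono) (auto dest: prime_gt_0_nat)
        then show "card ?P \<le> x" by simp
      qed
      also have "\<dots> \<le> real x * real y" using y(2) by (intro mult_left_mono) auto
      finally show ?thesis using n by simp
    qed
    ultimately have "real n * (\<Sum>p\<in>?P. ln (real p) / real p) \<le> real n * (ln (real n) + 1)"
      by (simp add: algebra_simps)
    then have "(\<Sum>p\<in>?P. ln (real p) / real p) \<le> ln (real n) + 1"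
      by (rule mult_left_le_imp_le) (use n(2) in simp)
    also have "ln (real n) = ln (real x) + ln (real y)" using x y(1) unfolding n(3) by (intro ln_mult_pos) auto
    also have "ln (real y) \<le> \<delta> * real y - 1 - ln \<delta>"
    proof -
      have "ln (\<delta> * real y) \<le> \<delta> * real y - 1" using \<delta> y(1) by (intro ln_le_minus_one) auto
      moreover have "ln (\<delta> * real y) = ln \<delta> + ln (real y)" using \<delta> y(1) by (intro ln_mult_pos) auto
      ultimately show ?thesis by linarith
    qed
    also have "\<delta> * real y \<le> \<delta> * (ln (real x) + 2)" using y(3) \<delta> by (intro mult_left_mono) auto
    finally show ?thesis by (simp add: C_def algebra_simps)
  qed
  then show ?thesis by blast
qed

section \<open>Primes in logarithmic ranges and products of them\<close>

lemma half_le_nat_floor: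
  fixes x :: real
  assumes "x \<ge> 1"
  shows "x / 2 \<le> real (nat \<lfloor>x\<rfloor>)"
proof -
  have "\<lfloor>x\<rfloor> \<ge> 1" using assms by simp
  then have "real (nat \<lfloor>x\<rfloor>) = of_int \<lfloor>x\<rfloor>" "real_of_int \<lfloor>x\<rfloor> \<ge> 1" by simp_all
  then show ?thesis by linarith
qed

text \<open>Subtract the Mertens estimates at R and R^(1 - \<sigma>). The factor 1 + \<sigma> / 2 is
  affordable as (1 + \<sigma> / 2) (1 - \<sigma>) \<le> 1 - \<sigma> / 2; of the remaining \<sigma>
  / 2 * ln R, half absorbs the constants once R \<ge> exp (4 C / \<sigma>). Then ln p \<le> ln R
  removes the weight.\<close>

lemma sum_inverse_primes_gap:
  fixes \<sigma> :: real
  assumes \<sigma>: "0 < \<sigma>" "\<sigma> < 1"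
  shows "\<exists>R0>1. \<forall>R\<ge>R0. \<sigma> / 4 \<le> (\<Sum>p | prime p \<and> R powr (1 - \<sigma>) < real p \<and> real p \<le> R. 1 / real p)"
proof -
  obtain C1 where C1: "\<forall>n\<ge>1. ln (real n) - C1 \<le> (\<Sum>p | prime p \<and> p \<le> n. ln (real p) / real p)"
    using mertens_lower by blast
  obtain C2 where C2: "\<forall>x::nat\<ge>1. (\<Sum>p | prime p \<and> p \<le> x. ln (real p) / real p) \<le> (1 + \<sigma> / 2) * ln (real x) + C2"
    using mertens_upper[of "\<sigma> / 2"] \<sigma> by auto
  define C where "C = max 1 (C1 + C2 + 1)"
  define R0 where "R0 = exp (4 * C / \<sigma>)"
  have C: "C \<ge> 1" "C \<ge> C1 + C2 + 1" by (auto simp: C_def)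
  have "R0 > 1" using C \<sigma> by (simp add: R0_def)
  moreover have "\<sigma> / 4 \<le> (\<Sum>p | prime p \<and> R powr (1 - \<sigma>) < real p \<and> real p \<le> R. 1 / real p)" (is "_ \<le> sum _ ?I") if R: "R \<ge> R0" for R
  proof -
    have R1: "R > 1" using R \<open>R0 > 1\<close> by simp
    have lnR: "ln R \<ge> 4 * C / \<sigma>" using R R1 unfolding R0_def by (metis exp_gt_zero ln_exp ln_le_cancel_iff less_trans zero_less_one)
    have lnR0: "ln R > 0" using R1 by simp
    define n where "n = nat \<lfloor>R\<rfloor>"
    define x where "x = nat \<lfloor>R powr (1 - \<sigma>)\<rfloor>"
    have n: "n \<ge> 1" "real n \<ge> R / 2" "real n \<le> R" 
      using R1 half_le_nat_floor[of R] by (auto simp: n_def le_nat_iff)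
    have n_iff: "p \<le> n \<longleftrightarrow> real p \<le> R" for p :: nat unfolding n_def using R1 by (simp add: le_nat_iff le_floor_iff)
    have Rx: "R powr (1 - \<sigma>) \<ge> 1" using R1 \<sigma> by (intro ge_one_powr_ge_zero) auto
    have x: "x \<ge> 1" "real x \<le> R powr (1 - \<sigma>)" 
    proof -
      have "\<lfloor>R powr (1 - \<sigma>)\<rfloor> \<ge> 1" using Rx by simp
      then show "x \<ge> 1" "real x \<le> R powr (1 - \<sigma>)" by (auto simp: x_def le_nat_iff)
    qed
    have x_iff: "p \<le> x \<longleftrightarrow> real p \<le> R powr (1 - \<sigma>)" for p :: nat
      unfolding x_def using Rx by (simp add: le_nat_iff le_floor_iff)
    have RR: "R powr (1 - \<sigma>) \<le> R" using R1 \<sigma> powr_mono[of "1 - \<sigma>" 1 R] by simp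
    have xn: "x \<le> n" using x(2) RR n_iff[of x] by simp
    have I: "?I = {p. prime p \<and> p \<le> n} - {p. prime p \<and> p \<le> x}" by (auto simp: n_iff x_iff)
    have "(\<Sum>p\<in>?I. ln (real p) / real p) = (\<Sum>p | prime p \<and> p \<le> n. ln (real p) / real p) - (\<Sum>p | prime p \<and> p \<le> x. ln (real p) / real p)"
      unfolding I using xn by (intro sum_diff finite_primes_le) auto
    moreover have "(\<Sum>p | prime p \<and> p \<le> n. ln (real p) / real p) \<ge> ln (real n) - C1" using C1 n(1) by blast
    moreover have "ln (real n) \<ge> ln R - 1"
    proof -
      have "ln (R / 2) \<le> ln (real n)" using n R1 by simp
      moreover have "ln (R / 2) = ln R - ln 2" by (rule ln_divide_pos) (use R1 in auto)
      moreover have "ln 2 \<le> (1::real)" using ln_le_minus_one[of 2] by simp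
      ultimately show ?thesis by linarith
    qed
    moreover have "(\<Sum>p | prime p \<and> p \<le> x. ln (real p) / real p) \<le> (1 + \<sigma> / 2) * ln (real x) + C2" using C2 x(1) by blast
    moreover have "(1 + \<sigma> / 2) * ln (real x) \<le> (1 + \<sigma> / 2) * ((1 - \<sigma>) * ln R)"
    proof (intro mult_left_mono)
      have "ln (real x) \<le> ln (R powr (1 - \<sigma>))" using x(1) by (intro ln_mono x(2)) simp
      then show "ln (real x) \<le> (1 - \<sigma>) * ln R" using R1 by (simp add: ln_powr)
    qed (use \<sigma> in simp)
    moreover have "(1 + \<sigma> / 2) * ((1 - \<sigma>) * ln R) \<le> (1 - \<sigma> / 2) * ln R"
    proof -
      have "(1 + \<sigma> / 2) * (1 - \<sigma>) \<le> 1 - \<sigma> / 2" using \<sigma> by (simp add: algebra_simps)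
      from mult_right_mono[OF this, of "ln R"] lnR0 show ?thesis by (simp add: mult.assoc)
    qed
    ultimately have "(\<Sum>p\<in>?I. ln (real p) / real p) \<ge> ln R - (1 - \<sigma> / 2) * ln R - C" using C(2) by linarith
    moreover have "ln R - (1 - \<sigma> / 2) * ln R - C \<ge> \<sigma> / 4 * ln R"
    proof -
      have "\<sigma> / 4 * ln R \<ge> C" using lnR \<sigma> by (simp add: field_simps)
      moreover have "ln R - (1 - \<sigma> / 2) * ln R - C = 2 * (\<sigma> / 4 * ln R) - C" by (simp add: algebra_simps)
      ultimately show ?thesis by linarith
    qed
    moreover have "(\<Sum>p\<in>?I. ln (real p) / real p) \<le> (\<Sum>p\<in>?I. ln R * (1 / real p))"
      using R1 by (intro sum_mono) (auto simp: divide_right_mono prime_gt_0_nat)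
    ultimately have "\<sigma> / 4 * ln R \<le> ln R * (\<Sum>p\<in>?I. 1 / real p)" by (simp add: sum_distrib_left)
    then show ?thesis using lnR0 by (simp add: mult.commute)
  qed
  ultimately show ?thesis by blast
qed

text \<open>The product of these primes is at most n \<le> R^u, and each factor exceeds
  R^(1/2).\<close>

lemma card_large_prime_divisors_le:
  fixes n :: nat and R :: real
  assumes n: "n \<ge> 1" "real n \<le> R ^ u" and R: "R > 1"
  shows "card {p. prime p \<and> p dvd n \<and> R powr (1 / 2) < real p} \<le> 2 * u"
proof -
  let ?T = "{p. prime p \<and> p dvd n \<and> R powr (1 / 2) < real p}"
  have sub: "?T \<subseteq> prime_factors n" using n by (auto simp: prime_factors_dvd)
  have fin: "finite ?T" by (rule finite_subset[OF sub]) simp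
  have "(R powr (1 / 2)) ^ card ?T = (\<Prod>p\<in>?T. R powr (1 / 2))" by simp
  also have "\<dots> \<le> (\<Prod>p\<in>?T. real p ^ multiplicity p n)"
  proof (intro prod_mono conjI)
    fix p assume p: "p \<in> ?T"
    then have "multiplicity p n \<ge> 1" using n by (auto simp: prime_multiplicity_gt_zero_iff Suc_le_eq)
    moreover have "real p \<ge> 1" using p by (auto dest: prime_ge_1_nat)
    ultimately have "real p \<le> real p ^ multiplicity p n" by (intro self_le_power) auto
    moreover have "R powr (1 / 2) < real p" using p by blast
    ultimately show "R powr (1 / 2) \<le> real p ^ multiplicity p n" by linarith
  qed simp
  also have "\<dots> \<le> (\<Prod>p\<in>prime_factors n. real p ^ multiplicity p n)"
  proof (rule prod_mono2[OF _ sub])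
    fix p assume "p \<in> prime_factors n - ?T"
    then have "p \<ge> 1" by (intro prime_ge_1_nat in_prime_factors_imp_prime) blast
    then show "1 \<le> real p ^ multiplicity p n" by (intro one_le_power) simp
  qed simp_all
  also have "\<dots> = real (\<Prod>p\<in>prime_factors n. p ^ multiplicity p n)" by simp
  also have "(\<Prod>p\<in>prime_factors n. p ^ multiplicity p n) = n"
    using n by (intro prime_factorization_nat[symmetric]) simp
  also have "real n \<le> R ^ u" by (rule n(2))
  also have "R ^ u = (R powr (1 / 2)) ^ (2 * u)"
    using R by (simp add: power_mult powr_half_sqrt)
  finally have "(R powr (1 / 2)) ^ card ?T \<le> (R powr (1 / 2)) ^ (2 * u)" .
  moreover have "R powr (1 / 2) > 1" using R by simp
  ultimately show ?thesis by (simp add: power_le_imp_le_exp)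
qed

text \<open>Products \<open>m p\<^sub>1 \<dots> p\<^sub>r\<close> with each prime \<open>p\<^sub>i\<close> in \<open>(R powr (1 - 1/u), R]\<close>, where \<open>R\<^sup>u = Y\<close>
  and \<open>r = u - 1\<close>, force \<open>m \<le> R\<^sup>2\<close>; no integer arises from more than \<open>(2 u)\<^sup>r\<close> of them.\<close>

theorem positive_density_smooth:
  fixes \<eta> :: real
  assumes \<eta>: "\<eta> > 0"
  shows "\<exists>c>0. \<exists>Y0. \<forall>Y\<ge>Y0. c * Y \<le> real (card {n \<in> {1..nat \<lfloor>Y\<rfloor>}. \<forall>p. prime p \<longrightarrow> p dvd n \<longrightarrow> real p \<le> Y powr \<eta>})"
proof -
  \<comment> \<open>Both R, which bounds the primes, and R^2, which bounds the cofactor, lie below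
    Y^\<eta>, since R^2 = Y^(2/u).\<close>
  define u where "u = max 2 (nat \<lceil>2 / \<eta>\<rceil>)"
  define r where "r = u - 1"
  define \<sigma> where "\<sigma> = 1 / real u"
  have u: "u \<ge> 2" "real u \<ge> 2 / \<eta>" unfolding u_def by linarith+
  have u\<eta>: "2 * \<sigma> \<le> \<eta>" using u \<eta> by (simp add: \<sigma>_def field_simps)
  have \<sigma>: "0 < \<sigma>" "\<sigma> \<le> 1 / 2" "\<sigma> < 1" using u by (auto simp: \<sigma>_def field_simps)
  obtain R0 where R0: "R0 > 1" "\<forall>R\<ge>R0. \<sigma> / 4 \<le> (\<Sum>p | prime p \<and> R powr (1 - \<sigma>) < real p \<and> real p \<le> R. 1 / real p)"
    using sum_inverse_primes_gap[OF \<sigma>(1,3)] by blast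
  define c where "c = (\<sigma> / 4) ^ r / 2 / real ((2 * u) ^ r)"
  have c: "c > 0" using \<sigma> u by (simp add: c_def)
  have "c * Y \<le> real (card {n \<in> {1..nat \<lfloor>Y\<rfloor>}. \<forall>p. prime p \<longrightarrow> p dvd n \<longrightarrow> real p \<le> Y powr \<eta>})" (is "_ \<le> real (card ?S)")
    if Y: "Y \<ge> R0 ^ u" for Y
  proof -
    have Y1: "Y > 1" using Y R0(1) u one_less_power[of R0 u] by linarith
    define R where "R = Y powr \<sigma>"
    have Ru: "R ^ u = Y" using u Y1 by (simp add: R_def \<sigma>_def powr_realpow[symmetric] powr_powr)
    have RR0: "R \<ge> R0"
    proof (rule ccontr)
      assume "\<not> ?thesis"
      then have "R ^ u < R0 ^ u" using u R0 by (intro power_strict_mono) (auto simp: R_def)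
      then show False using Y Ru by simp
    qed
    have R1: "R > 1" using RR0 R0(1) by simp
    have R2: "R ^ 2 \<le> Y powr \<eta>"
    proof -
      have "R ^ 2 = Y powr (2 * \<sigma>)" using Y1 by (simp add: R_def powr_power mult.commute)
      also have "\<dots> \<le> Y powr \<eta>" using u\<eta> Y1 by (intro powr_mono) auto
      finally show ?thesis .
    qed
    have RR: "R \<le> Y powr \<eta>" using R2 self_le_power[of R 2] R1 by linarith
    define I where "I = {p. prime p \<and> R powr (1 - \<sigma>) < real p \<and> real p \<le> R}"
    have finI: "finite I"
      by (rule finite_subset[of _ "{..nat \<lfloor>R\<rfloor>}"]) (auto simp: I_def le_nat_iff le_floor_iff)
    have I: "prime p" "R powr (1 - \<sigma>) < real p" "real p \<le> R" "real p > 0" if "p \<in> I" for p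
      using that by (auto simp: I_def dest: prime_gt_0_nat)
    define pprod where "pprod p = (\<Prod>i<r. p i)" for p :: "nat \<Rightarrow> nat"
    define \<P> where "\<P> = Pi\<^sub>E {..<r} (\<lambda>_. I)"
    have finP: "finite \<P>" unfolding \<P>_def using finI by (intro finite_PiE) auto
    have pprod_pos: "real (pprod p) > 0" and pprod_le: "real (pprod p) \<le> Y / R" and pprod_ge: "Y / real (pprod p) \<le> R ^ 2"
      if p: "p \<in> \<P>" for p
    proof -
      have pi: "p i \<in> I" if "i < r" for i using p that by (auto simp: \<P>_def PiE_iff)
      have Rr: "R ^ u = R ^ r * R" using u by (cases u) (auto simp: r_def)
      show 1: "real (pprod p) > 0" unfolding pprod_def using I(4) pi by (auto intro!: prod_pos)
      have "real (pprod p) \<le> (\<Prod>i<r. R)" unfolding pprod_def of_nat_prod using I pi by (intro prod_mono) auto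
      then have "real (pprod p) * R \<le> R ^ r * R" using R1 by (intro mult_right_mono) auto
      also have "\<dots> = Y" using Ru Rr by simp
      finally show "real (pprod p) \<le> Y / R" using R1 by (simp add: le_divide_eq)
      have "(\<Prod>i<r. R powr (1 - \<sigma>)) \<le> real (pprod p)"
        unfolding pprod_def of_nat_prod using I pi by (intro prod_mono) (auto intro: less_imp_le)
      then have 2: "R powr ((1 - \<sigma>) * real r) \<le> real (pprod p)" using R1 by (simp add: powr_power mult.commute)
      \<comment> \<open>(1 - 1/u) (u - 1) = u - 2 + 1/u, so the product of the primes is at least Y
        / R^2; this explains the choice of \<open>r\<close> and of the exponent 1 -
        \<sigma>.\<close>
      have "real u - 2 \<le> (1 - \<sigma>) * real r"
      proof -
        have "real r = real u - 1" using u by (simp add: r_def)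
        moreover have "(1 - \<sigma>) * (real u - 1) = real u - 2 + \<sigma>" using u by (simp add: \<sigma>_def field_simps)
        ultimately show ?thesis using \<sigma> by simp
      qed
      then have "R powr (real u - 2) \<le> R powr ((1 - \<sigma>) * real r)" using R1 by (intro powr_mono) auto
      also have "R powr (real u - 2) = Y / R ^ 2"
        using R1 by (simp add: powr_diff powr_realpow powr_numeral Ru)
      finally have "Y / R ^ 2 \<le> real (pprod p)" using 2 by linarith
      then show "Y / real (pprod p) \<le> R ^ 2" using 1 R1 by (simp add: field_simps)
    qed
    define D where "D = (SIGMA p:\<P>. {1..nat \<lfloor>Y / real (pprod p)\<rfloor>})"
    \<comment> \<open>All \<open>r\<close>-tuples of prime divisors of \<open>n\<close> above
      R^(1/2); they include the tuples that produce \<open>n\<close>, since 1 - \<sigma> \<ge>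
      1/2.\<close>
    define fib where "fib n = Pi\<^sub>E {..<r} (\<lambda>_. {q. prime q \<and> q dvd n \<and> R powr (1 / 2) < real q})" for n
    have finS: "finite ?S" by simp
    have fin_div: "finite {q. prime q \<and> q dvd n \<and> R powr (1 / 2) < real q}" if "n \<ge> 1" for n :: nat
      by (rule finite_subset[of _ "{..n}"]) (use that in \<open>auto dest: dvd_imp_le\<close>)
    have fin_fib: "finite (fib n)" if "n \<in> ?S" for n
      unfolding fib_def using fin_div[of n] that by (intro finite_PiE) auto
    have le_floor: "m \<le> nat \<lfloor>x\<rfloor> \<longleftrightarrow> real m \<le> x" if "x \<ge> 0" for m x
      using that by (simp add: le_nat_iff le_floor_iff)
    have sub: "(\<lambda>(p, m). (m * pprod p, p)) ` D \<subseteq> (SIGMA n:?S. fib n)"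
    proof (rule image_subsetI)
      fix x assume "x \<in> D"
      then obtain p m where x: "x = (p, m)" and p: "p \<in> \<P>" and m: "1 \<le> m" "m \<le> nat \<lfloor>Y / real (pprod p)\<rfloor>"
        unfolding D_def by auto
      note pp = pprod_pos[OF p] pprod_ge[OF p]
      have mY: "real m \<le> Y / real (pprod p)" using m(2) le_floor pp Y1 by auto
      then have "real (m * pprod p) \<le> Y" using pp by (simp add: field_simps)
      then have 1: "m * pprod p \<in> {1..nat \<lfloor>Y\<rfloor>}" using m pp Y1 le_floor[of Y "m * pprod p"] by (auto simp: Suc_le_eq)
      have "real q \<le> Y powr \<eta>" if q: "prime q" "q dvd m * pprod p" for q
      proof (cases "q dvd m")
        case True
        then have "q \<le> m" using m by (intro dvd_imp_le) auto
        then have "real q \<le> real m" by simp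
        then show ?thesis using mY pp R2 by linarith
      next
        case False
        then have "q dvd pprod p" using q by (simp add: prime_dvd_mult_iff)
        then obtain i where i: "i < r" "q dvd p i" using q(1) unfolding pprod_def by (auto simp: prime_dvd_prod_iff)
        then have "p i \<in> I" using p by (auto simp: \<P>_def PiE_iff)
        then have "q = p i" using i(2) q(1) I(1) primes_dvd_imp_eq by blast
        then show ?thesis using I(3)[OF \<open>p i \<in> I\<close>] RR by simp
      qed
      moreover have "p \<in> fib (m * pprod p)"
        unfolding fib_def
      proof (rule PiE_I)
        fix i assume i: "i \<in> {..<r}"
        then have pI: "p i \<in> I" using p by (auto simp: \<P>_def PiE_iff)
        have "p i dvd pprod p" unfolding pprod_def using i by (intro dvd_prodI) auto
        moreover have "R powr (1 / 2) \<le> R powr (1 - \<sigma>)" using R1 \<sigma> by (intro powr_mono) auto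
        ultimately show "p i \<in> {q. prime q \<and> q dvd m * pprod p \<and> R powr (1 / 2) < real q}" using I[OF pI] by auto
      next
        fix i assume "i \<notin> {..<r}"
        then show "p i = undefined" using p by (auto simp: \<P>_def PiE_def extensional_def)
      qed
      ultimately have "(m * pprod p, p) \<in> (SIGMA n:?S. fib n)" using 1 by blast
      then show "(case x of (p, m) \<Rightarrow> (m * pprod p, p)) \<in> (SIGMA n:?S. fib n)" by (simp only: x prod.case)
    qed
    have inj: "inj_on (\<lambda>(p, m). (m * pprod p, p)) D"
      using pprod_pos by (auto simp: inj_on_def D_def)
    have finSig: "finite (SIGMA n:?S. fib n)" by (rule finite_SigmaI[OF finS fin_fib])
    have "card D \<le> card (SIGMA n:?S. fib n)" by (rule card_inj_on_le[OF inj sub finSig])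
    also have "\<dots> = (\<Sum>n\<in>?S. card (fib n))" using finS fin_fib by (intro card_SigmaI) auto
    also have "\<dots> \<le> (\<Sum>n\<in>?S. (2 * u) ^ r)"
    proof (rule sum_mono)
      fix n assume "n \<in> ?S"
      then have n: "n \<ge> 1" "n \<le> nat \<lfloor>Y\<rfloor>" by auto
      then have "real n \<le> R ^ u" using Ru Y1 le_floor[of Y n] by simp
      then have "card {q. prime q \<and> q dvd n \<and> R powr (1 / 2) < real q} \<le> 2 * u"
        by (rule card_large_prime_divisors_le[OF n(1) _ R1])
      from power_mono[OF this, of r]
      show "card (fib n) \<le> (2 * u) ^ r" unfolding fib_def by (simp only: card_PiE finite_lessThan prod_constant card_lessThan)
    qed
    finally have "card D \<le> card ?S * (2 * u) ^ r" by simp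
    then have "real (card D) \<le> real (card ?S * (2 * u) ^ r)" by (rule of_nat_mono)
    then have "real (card D) \<le> real (card ?S) * real ((2 * u) ^ r)" unfolding of_nat_mult .
    moreover have "real (card D) \<ge> Y / 2 * (\<sigma> / 4) ^ r"
    proof -
      have "card D = (\<Sum>p\<in>\<P>. nat \<lfloor>Y / real (pprod p)\<rfloor>)" unfolding D_def using finP by (subst card_SigmaI) auto
      then have e1: "real (card D) = (\<Sum>p\<in>\<P>. real (nat \<lfloor>Y / real (pprod p)\<rfloor>))" by simp
      have e2: "(\<Sum>p\<in>\<P>. Y / 2 * (\<Prod>i<r. 1 / real (p i))) \<le> (\<Sum>p\<in>\<P>. real (nat \<lfloor>Y / real (pprod p)\<rfloor>))"
      proof (rule sum_mono)
        fix p assume p: "p \<in> \<P>"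
        \<comment> \<open>With only u - 1 primes the product is at most Y / R, so there is room for
          a cofactor and rounding down costs at most a factor 2.\<close>
        have "Y / real (pprod p) \<ge> 1"
        proof -
          have "real (pprod p) * 1 \<le> real (pprod p) * R" using pprod_pos[OF p] R1 by (intro mult_left_mono) auto
          also have "\<dots> \<le> Y" using pprod_le[OF p] R1 by (simp add: field_simps)
          finally show ?thesis using pprod_pos[OF p] by (simp add: field_simps)
        qed
        then have "Y / real (pprod p) / 2 \<le> real (nat \<lfloor>Y / real (pprod p)\<rfloor>)" by (rule half_le_nat_floor)
        moreover have "Y / 2 * (\<Prod>i<r. 1 / real (p i)) = Y / real (pprod p) / 2"
          by (simp add: pprod_def prod_dividef)
        ultimately show "Y / 2 * (\<Prod>i<r. 1 / real (p i)) \<le> real (nat \<lfloor>Y / real (pprod p)\<rfloor>)" by simp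
      qed
      \<comment> \<open>The sum over tuples factors into the \<open>r\<close>-th power of the sum of
        1 / q over \<open>I\<close>, which is at least \<sigma> / 4.\<close>
      have e3: "(\<Sum>p\<in>\<P>. Y / 2 * (\<Prod>i<r. 1 / real (p i))) = Y / 2 * (\<Prod>i<r. \<Sum>q\<in>I. 1 / real q)"
        unfolding \<P>_def sum_distrib_left[symmetric] using finI by (subst prod_sum_PiE) auto
      have "Y / 2 * (\<Prod>i<r. \<Sum>q\<in>I. 1 / real q) \<ge> Y / 2 * (\<sigma> / 4) ^ r"
        using R0(2) RR0 \<sigma> Y1 unfolding prod_constant card_lessThan I_def
        by (intro mult_left_mono power_mono) auto
      with e1 e2 e3 show ?thesis by linarith
    qed
    ultimately have "Y / 2 * (\<sigma> / 4) ^ r \<le> real (card ?S) * real ((2 * u) ^ r)" by linarith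
    moreover have "real ((2 * u) ^ r) > 0" using u by simp
    ultimately have "(Y / 2 * (\<sigma> / 4) ^ r) / real ((2 * u) ^ r) \<le> real (card ?S)" by (simp only: pos_divide_le_eq)
    moreover have "(Y / 2 * (\<sigma> / 4) ^ r) / real ((2 * u) ^ r) = c * Y" by (simp add: c_def)
    ultimately show ?thesis by linarith
  qed
  with c show ?thesis by blast
qed

section \<open>Homogeneous sets\<close>

text \<open>Reindexing: integers become naturals, indices start at 1, and the numbered equations are
  indexed by any finite set, so that the tuples of multipliers can serve as indices.\<close>

lemma simultaneous_power_recurrence_nat:
  fixes l :: "nat \<Rightarrow> int" and \<delta> :: real and J :: "'j set"
  assumes s: "s \<ge> 2" and l: "\<And>i. i \<in> {1..s} \<Longrightarrow> l i \<noteq> 0" and l0: "(\<Sum>i=1..s. l i) = 0"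
    and k: "k \<ge> 1" and \<delta>: "\<delta> > 0" and J: "finite J"
  shows "\<exists>L\<ge>1::nat. \<exists>c>0. \<forall>N\<ge>1::nat. \<forall>A\<subseteq>{1..N}. \<delta> * real N \<le> real (card A) \<longrightarrow>
    (\<forall>z. (\<forall>j\<in>J. \<bar>z j\<bar> * int L ^ k \<le> int N) \<longrightarrow>
      (\<exists>n\<in>{1..L}. \<forall>j\<in>J. c * real N ^ (s - 1) \<le> real (card {x \<in> {1..s} \<rightarrow>\<^sub>E A. (\<Sum>i=1..s. l i * int (x i)) = z j * int n ^ k})))"
proof -
  define lam where "lam i = l (Suc i)" for i
  have shift: "(\<Sum>i=1..s. g i) = (\<Sum>i<s. g (Suc i))" for g :: "nat \<Rightarrow> int"
    by (rule sum.reindex_bij_witness[of _ Suc "\<lambda>i. i - 1"]) auto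
  have lam: "lam i \<noteq> 0" if "i < s" for i using l[of "Suc i"] that by (simp add: lam_def)
  have lam0: "(\<Sum>i<s. lam i) = 0" using l0 unfolding shift lam_def .
  obtain h where h: "bij_betw h {0..<card J} J" using ex_bij_betw_nat_finite[OF J] by blast
  obtain L :: nat and c where L: "L \<ge> 1" and c: "c > 0" and core: "\<forall>N\<ge>1::nat. \<forall>A\<subseteq>{1..int N}. \<delta> * real N \<le> real (card A) \<longrightarrow>
    (\<forall>z. (\<forall>i<card J. \<bar>z i\<bar> * int L ^ k \<le> int N) \<longrightarrow>
      (\<exists>n\<in>{1..L}. \<forall>i<card J. c * real N ^ (s - 1) \<le> real (card {x \<in> Pi\<^sub>E {..<s} (\<lambda>_. A). (\<Sum>i<s. lam i * x i) = z i * int n ^ k})))"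
    using simultaneous_power_recurrence[where lam=lam and R="card J", OF s lam lam0 k \<delta>] by blast
  have "\<exists>n\<in>{1..L}. \<forall>j\<in>J. c * real N ^ (s - 1) \<le> real (card {x \<in> {1..s} \<rightarrow>\<^sub>E A. (\<Sum>i=1..s. l i * int (x i)) = z j * int n ^ k})"
    if N: "N \<ge> 1" and A: "A \<subseteq> {1..N}" and dens: "\<delta> * real N \<le> real (card A)" and z: "\<forall>j\<in>J. \<bar>z j\<bar> * int L ^ k \<le> int N" for N A z
  proof -
    have "int ` A \<subseteq> {1..int N}" using A by auto
    moreover have "\<delta> * real N \<le> real (card (int ` A))" using dens by (simp add: card_image)
    moreover have "\<forall>i<card J. \<bar>z (h i)\<bar> * int L ^ k \<le> int N" using z h by (auto simp: bij_betw_def)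
    ultimately obtain n where n: "n \<in> {1..L}" and big: "\<forall>i<card J. c * real N ^ (s - 1) \<le> real (card {x \<in> Pi\<^sub>E {..<s} (\<lambda>_. int ` A). (\<Sum>i<s. lam i * x i) = z (h i) * int n ^ k})"
      using core[rule_format, OF N, of "int ` A" "\<lambda>i. z (h i)"] by blast
    have finA: "finite A" using A finite_subset by blast
    have "c * real N ^ (s - 1) \<le> real (card {x \<in> {1..s} \<rightarrow>\<^sub>E A. (\<Sum>i=1..s. l i * int (x i)) = z j * int n ^ k})" if j: "j \<in> J" for j
    proof -
      have "j \<in> h ` {0..<card J}" using j h by (simp add: bij_betw_def)
      then obtain i where i: "i < card J" "h i = j" by auto
      let ?X = "{x \<in> Pi\<^sub>E {..<s} (\<lambda>_. int ` A). (\<Sum>i<s. lam i * x i) = z j * int n ^ k}"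
      let ?Y = "{x \<in> {1..s} \<rightarrow>\<^sub>E A. (\<Sum>i=1..s. l i * int (x i)) = z j * int n ^ k}"
      have "card ?X \<le> card ?Y"
      proof (rule card_inj_on_le[of "\<lambda>x. \<lambda>i\<in>{1..s}. nat (x (i - 1))"])
        have nonneg: "x i \<ge> 0" if "x \<in> ?X" "i < s" for x i
        proof -
          have "x i \<in> int ` A" using that by (auto simp: PiE_iff)
          then show ?thesis by auto
        qed
        show "inj_on (\<lambda>x. \<lambda>i\<in>{1..s}. nat (x (i - 1))) ?X"
        proof (rule inj_onI)
          fix x y assume x: "x \<in> ?X" and y: "y \<in> ?X" and eq: "(\<lambda>i\<in>{1..s}. nat (x (i - 1))) = (\<lambda>i\<in>{1..s}. nat (y (i - 1)))"
          have "x i = y i" if "i < s" for i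
          proof -
            have "nat (x i) = nat (y i)" using fun_cong[OF eq, of "Suc i"] that by simp
            then show ?thesis using nonneg[OF x that] nonneg[OF y that] by simp
          qed
          then show "x = y" using x y by (intro PiE_ext[where k="{..<s}"]) auto
        qed
        show "(\<lambda>x. \<lambda>i\<in>{1..s}. nat (x (i - 1))) ` ?X \<subseteq> ?Y"
        proof (rule image_subsetI)
          fix x assume x: "x \<in> ?X"
          have "nat (x (i - 1)) \<in> A" if "i \<in> {1..s}" for i
          proof -
            have "x (i - 1) \<in> int ` A" using x that by (auto simp: PiE_iff)
            then show ?thesis by auto
          qed
          then have "(\<lambda>i\<in>{1..s}. nat (x (i - 1))) \<in> {1..s} \<rightarrow>\<^sub>E A" by auto
          moreover have "(\<Sum>i=1..s. l i * int ((\<lambda>i\<in>{1..s}. nat (x (i - 1))) i)) = (\<Sum>i<s. lam i * x i)"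
            unfolding shift lam_def using nonneg[OF x] by (intro sum.cong) auto
          ultimately show "(\<lambda>i\<in>{1..s}. nat (x (i - 1))) \<in> ?Y" using x by auto
        qed
        show "finite ?Y" using finA by (intro finite_subset[OF _ finite_PiE[of "{1..s}" "\<lambda>_. A"]]) auto
      qed
      then have "real (card ?X) \<le> real (card ?Y)" by (rule of_nat_mono)
      then show ?thesis using big i by force
    qed
    then show ?thesis using n by blast
  qed
  then show ?thesis using L c by (intro exI[of _ L] conjI exI[of _ c]) auto
qed

theorem theorem10p1:
  fixes k s t :: nat and l \<mu> :: "nat \<Rightarrow> int"
  assumes "k \<ge> 1" and "s \<ge> 1"
    and "\<And>i. i \<in> {1..s} \<Longrightarrow> l i \<noteq> 0"
    and "\<And>j. j \<in> {1..t} \<Longrightarrow> \<mu> j \<noteq> 0"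
    and "(\<Sum>i=1..s. l i) = 0"
  shows "\<forall>(\<eta>::real) (\<delta>::real) (M::nat). \<eta> > 0 \<longrightarrow> \<delta> > 0 \<longrightarrow> M \<ge> 1 \<longrightarrow>
    (\<exists>(N\<^sub>0::nat) (c\<^sub>0::real). N\<^sub>0 \<ge> 1 \<and> c\<^sub>0 > 0 \<and>
      (\<forall>(N::real) (A::nat set) (B::nat set).
         N \<ge> real N\<^sub>0 \<longrightarrow>
         A \<subseteq> initial_segment N \<longrightarrow> real (card A) \<ge> \<delta> * N \<longrightarrow>
         0 \<notin> B \<longrightarrow>
         homogeneous_in M (smooth_numbers (N powr (1 / real k)) (N powr \<eta>)) B \<longrightarrow>
         at_least_many (c\<^sub>0 * N powr (real s + real t / real k - 1))
           (solutions k s t l \<mu> A B)))"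
proof (intro allI impI)
  fix \<eta> \<delta> :: real and M :: nat
  assume \<eta>: "\<eta> > 0" and \<delta>: "\<delta> > 0" and M: "M \<ge> 1"
  note k = assms(1)
  have s: "s \<ge> 2"
  proof (rule ccontr)
    assume "\<not> s \<ge> 2"
    then have "s = 1" using assms(2) by simp
    then show False using assms(3)[of 1] assms(5) by simp
  qed
  \<comment> \<open>One equation for each multiplier tuple, since homogeneity may return any of
    them.\<close>
  define J where "J = {1..t} \<rightarrow>\<^sub>E {1..M}"
  have finJ: "finite J" unfolding J_def by (intro finite_PiE) auto
  have cardJ: "card J = M ^ t" by (simp add: J_def card_PiE)
  obtain L :: nat and c where L: "L \<ge> 1" and c: "c > 0" and core: "\<forall>N\<ge>1::nat. \<forall>A\<subseteq>{1..N}. \<delta> * real N \<le> real (card A) \<longrightarrow>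
    (\<forall>z. (\<forall>j\<in>J. \<bar>z j\<bar> * int L ^ k \<le> int N) \<longrightarrow>
      (\<exists>n\<in>{1..L}. \<forall>j\<in>J. c * real N ^ (s - 1) \<le> real (card {x \<in> {1..s} \<rightarrow>\<^sub>E A. (\<Sum>i=1..s. l i * int (x i)) = z j * int n ^ k})))"
    using simultaneous_power_recurrence_nat[OF s assms(3) assms(5) k \<delta> finJ] by blast
  \<comment> \<open>For Y \<le> N^(1/k) the smoothness bound Y^(\<eta> k) is at most N^\<eta>, hence
    the exponent \<eta> k.\<close>
  obtain c1 Y0 where c1: "c1 > 0" and smooth: "\<forall>Y\<ge>Y0. c1 * Y \<le> real (card {n \<in> {1..nat \<lfloor>Y\<rfloor>}. \<forall>p. prime p \<longrightarrow> p dvd n \<longrightarrow> real p \<le> Y powr (\<eta> * real k)})"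
    using positive_density_smooth[of "\<eta> * real k"] \<eta> k by auto
  define \<kappa> where "\<kappa> = (\<Sum>j=1..t. \<bar>real_of_int (\<mu> j)\<bar>) + 1"
  have \<kappa>: "\<kappa> \<ge> 1" "(\<Sum>j=1..t. \<bar>real_of_int (\<mu> j)\<bar>) \<le> \<kappa>" unfolding \<kappa>_def by (auto simp: sum_nonneg)
  \<comment> \<open>Ensures q n m \<le> X / (2 \<kappa>) for q \<le> \<rho> X, n \<le> L and m \<le>
    M. This keeps every y_j below N^(1/k) and gives |z| L^k \<le> N / 2, which is at most the
    integer part of \<open>N\<close>.\<close>
  define \<rho> where "\<rho> = 1 / (2 * \<kappa> * real L * real M)"
  have LM: "real L \<ge> 1" "real M \<ge> 1" using L M by auto
  have \<rho>: "\<rho> > 0" using \<kappa> LM by (simp add: \<rho>_def)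
  have \<rho>LM: "\<rho> * real L * real M = 1 / (2 * \<kappa>)" using \<kappa> LM by (simp add: \<rho>_def field_simps)
  \<comment> \<open>The summands ensure N \<ge> 1, \<rho> N^(1/k) \<ge> Y0 and L M \<le> N^\<eta>;
    by the last one the factors n and m introduce no large primes.\<close>
  define N0 where "N0 = nat \<lceil>1 + max 1 (Y0 / \<rho>) ^ k + (real (L * M)) powr (1 / \<eta>)\<rceil>"
  \<comment> \<open>Density of the tuples \<open>q\<close>, divided by the multiplicity L M^t of a
    tuple \<open>y\<close>, times the density of \<open>x\<close> for each \<open>y\<close>;
    (1/2)^(s - 1) pays for replacing \<open>N\<close> by its integer part.\<close>
  define c0 where "c0 = (c1 * \<rho>) ^ t / real (L * M ^ t) * (c * (1 / 2) ^ (s - 1))"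
  have c0: "c0 > 0" using c1 \<rho> c L M by (simp add: c0_def)
  have main: "at_least_many (c0 * N powr (real s + real t / real k - 1)) (solutions k s t l \<mu> A B)"
    if N: "N \<ge> real N0" and A: "A \<subseteq> initial_segment N" and dens: "real (card A) \<ge> \<delta> * N"
      and hom: "homogeneous_in M (smooth_numbers (N powr (1 / real k)) (N powr \<eta>)) B" for N A B
  proof (cases "finite (solutions k s t l \<mu> A B)")
    case False
    then show ?thesis by (simp add: at_least_many_def)
  next
    case fin: True
    have N0: "real N0 \<ge> 1 + max 1 (Y0 / \<rho>) ^ k + (real (L * M)) powr (1 / \<eta>)" unfolding N0_def by linarith
    have "max 1 (Y0 / \<rho>) ^ k \<ge> 1" by (intro one_le_power) simp
    moreover have "(real (L * M)) powr (1 / \<eta>) \<ge> 0" by simp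
    ultimately have N1: "N \<ge> 1" "N \<ge> max 1 (Y0 / \<rho>) ^ k" "N \<ge> (real (L * M)) powr (1 / \<eta>)" using N N0 by linarith+
    define X where "X = N powr (1 / real k)"
    define Y where "Y = \<rho> * X"
    have Xk: "X ^ k = N" using N1 k by (simp add: X_def powr_realpow[symmetric] powr_powr)
    have Xpos: "X > 0" using N1 by (simp add: X_def)
    have XY0: "X \<ge> Y0 / \<rho>"
    proof (rule ccontr)
      assume "\<not> ?thesis"
      then have "X < max 1 (Y0 / \<rho>)" by simp
      then have "X ^ k < max 1 (Y0 / \<rho>) ^ k" using Xpos k by (intro power_strict_mono) auto
      then show False using Xk N1 by simp
    qed
    have YY0: "Y \<ge> Y0" using XY0 \<rho> by (simp add: Y_def field_simps)
    have Ypos: "Y > 0" using \<rho> Xpos by (simp add: Y_def)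
    have LMN: "real (L * M) \<le> N powr \<eta>"
    proof -
      have "((real (L * M)) powr (1 / \<eta>)) powr \<eta> \<le> N powr \<eta>" using N1 \<eta> by (intro powr_mono2) auto
      then show ?thesis using \<eta> L M by (simp add: powr_powr)
    qed
    have YX: "Y * real L * real M \<le> X / (2 * \<kappa>)"
      using \<rho>LM by (simp add: Y_def mult_ac)
    define n0 where "n0 = nat \<lfloor>N\<rfloor>"
    have n0: "n0 \<ge> 1" "real n0 \<le> N" "real n0 \<ge> N / 2"
      using N1 half_le_nat_floor[of N] by (auto simp: n0_def le_nat_iff)
    have A0: "A \<subseteq> {1..n0}" using A by (simp add: initial_segment_def n0_def)
    have dens0: "\<delta> * real n0 \<le> real (card A)" using dens n0 \<delta> by (smt (verit) mult_left_mono)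
    define D where "D = {n \<in> {1..nat \<lfloor>Y\<rfloor>}. \<forall>p. prime p \<longrightarrow> p dvd n \<longrightarrow> real p \<le> Y powr (\<eta> * real k)}"
    have finD: "finite D" by (simp add: D_def)
    have cD: "c1 * Y \<le> real (card D)" unfolding D_def using smooth YY0 by blast
    have YN: "Y powr (\<eta> * real k) \<le> N powr \<eta>"
    proof -
      have "1 * 1 \<le> real L * real M" using LM by (intro mult_mono) auto
      then have "1 * 1 \<le> (2 * \<kappa>) * (real L * real M)" using \<kappa> by (intro mult_mono) auto
      then have "2 * \<kappa> * real L * real M \<ge> 1" by (simp add: mult.assoc)
      then have "\<rho> \<le> 1" by (simp add: \<rho>_def divide_le_eq)
      then have "Y \<le> X" using Xpos by (simp add: Y_def mult_le_cancel_right1)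
      then have "Y powr (\<eta> * real k) \<le> X powr (\<eta> * real k)" using Ypos \<eta> by (intro powr_mono2) auto
      also have "\<dots> = N powr \<eta>" using k by (simp add: X_def powr_powr)
      finally show ?thesis .
    qed
    have D: "real q \<le> Y" "q \<ge> 1" "\<And>p. prime p \<Longrightarrow> p dvd q \<Longrightarrow> real p \<le> N powr \<eta>" if "q \<in> D" for q
    proof -
      show "real q \<le> Y" using that Ypos by (auto simp: D_def le_nat_iff le_floor_iff)
      show "q \<ge> 1" using that by (simp add: D_def)
      show "real p \<le> N powr \<eta>" if "prime p" "p dvd q" for p
      proof -
        have "real p \<le> Y powr (\<eta> * real k)" using that \<open>q \<in> D\<close> unfolding D_def by blast
        then show ?thesis using YN by linarith
      qed
    qed
    define Q where "Q = {1..t} \<rightarrow>\<^sub>E D"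
    have finQ: "finite Q" unfolding Q_def using finD by (intro finite_PiE) auto
    have cQ: "real (card Q) \<ge> (c1 * Y) ^ t"
      unfolding Q_def using cD c1 Ypos by (simp add: card_PiE power_mono)
    define r where "r y = real (card {x \<in> {1..s} \<rightarrow>\<^sub>E A. (\<Sum>i=1..s. l i * int (x i)) = (\<Sum>j=1..t. \<mu> j * int (y j) ^ k)})" for y :: "nat \<Rightarrow> nat"
    have "\<exists>n m y. n \<in> {1..L} \<and> m \<in> J \<and> y \<in> {1..t} \<rightarrow>\<^sub>E B \<and> (\<forall>j\<in>{1..t}. y j = q j * n * m j) \<and> c * real n0 ^ (s - 1) \<le> r y"
      if q: "q \<in> Q" for q
    proof -
      define z where "z m = (\<Sum>j=1..t. \<mu> j * (int (q j) * int (m j)) ^ k)" for m :: "nat \<Rightarrow> nat"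
      have qD: "q j \<in> D" if "j \<in> {1..t}" for j using q that by (auto simp: Q_def)
      have "\<bar>z m\<bar> * int L ^ k \<le> int n0" if m: "m \<in> J" for m
      proof -
        have "real_of_int (\<bar>z m\<bar> * int L ^ k) \<le> (\<Sum>j=1..t. \<bar>real_of_int (\<mu> j)\<bar> * (real (q j) * real (m j)) ^ k) * real L ^ k"
        proof -
          have "\<bar>z m\<bar> \<le> (\<Sum>j=1..t. \<bar>\<mu> j * (int (q j) * int (m j)) ^ k\<bar>)" unfolding z_def by (rule sum_abs)
          then have "real_of_int \<bar>z m\<bar> \<le> real_of_int (\<Sum>j=1..t. \<bar>\<mu> j * (int (q j) * int (m j)) ^ k\<bar>)" by (simp only: of_int_le_iff)
          then have "real_of_int \<bar>z m\<bar> \<le> (\<Sum>j=1..t. \<bar>real_of_int (\<mu> j)\<bar> * (real (q j) * real (m j)) ^ k)"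
            by (simp add: abs_mult power_abs)
          then have "real_of_int \<bar>z m\<bar> * real L ^ k \<le> (\<Sum>j=1..t. \<bar>real_of_int (\<mu> j)\<bar> * (real (q j) * real (m j)) ^ k) * real L ^ k"
            by (intro mult_right_mono) auto
          then show ?thesis by simp
        qed
        also have "\<dots> = (\<Sum>j=1..t. \<bar>real_of_int (\<mu> j)\<bar> * (real (q j) * real L * real (m j)) ^ k)"
          unfolding sum_distrib_right by (intro sum.cong) (auto simp: power_mult_distrib)
        also have "\<dots> \<le> (\<Sum>j=1..t. \<bar>real_of_int (\<mu> j)\<bar> * (X / (2 * \<kappa>)) ^ k)"
        proof (intro sum_mono mult_left_mono power_mono)
          fix j assume j: "j \<in> {1..t}"
          have "real (m j) \<le> real M" using m j by (auto simp: J_def PiE_iff)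
          then have "real (q j) * real L * real (m j) \<le> Y * real L * real M"
            using D(1)[OF qD[OF j]] Ypos by (intro mult_mono) auto
          then show "real (q j) * real L * real (m j) \<le> X / (2 * \<kappa>)" using YX by linarith
        qed auto
        also have "\<dots> \<le> \<kappa> * (X / (2 * \<kappa>)) ^ k"
          unfolding sum_distrib_right[symmetric] using \<kappa> Xpos by (intro mult_right_mono) auto
        also have "\<dots> = \<kappa> / (2 * \<kappa>) ^ k * N" by (simp add: power_divide Xk)
        also have "\<dots> \<le> \<kappa> / (2 * \<kappa>) * N"
        proof (intro mult_right_mono divide_left_mono)
          show "2 * \<kappa> \<le> (2 * \<kappa>) ^ k" using \<kappa> k by (intro self_le_power) auto
        qed (use \<kappa> N1 in auto)
        also have "\<dots> \<le> real n0" using \<kappa> n0 by simp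
        finally show ?thesis by linarith
      qed
      then obtain n where n: "n \<in> {1..L}" and big: "\<And>m. m \<in> J \<Longrightarrow> c * real n0 ^ (s - 1) \<le> real (card {x \<in> {1..s} \<rightarrow>\<^sub>E A. (\<Sum>i=1..s. l i * int (x i)) = z m * int n ^ k})"
        using core[rule_format, OF n0(1) A0 dens0, of z] by blast
      \<comment> \<open>\<open>n\<close> is already fixed, so homogeneity is applied with difference
        q_j n; whatever multipliers it returns, they form an index in \<open>J\<close> for which
        \<open>big\<close> holds.\<close>
      have "\<exists>m\<in>{1..M}. q j * n * m \<in> B" if j: "j \<in> {1..t}" for j
      proof -
        have "homogeneous_progression (q j * n) M \<subseteq> smooth_numbers (N powr (1 / real k)) (N powr \<eta>)"
        proof
          fix v assume "v \<in> homogeneous_progression (q j * n) M"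
          then obtain m where m: "m \<in> {1..M}" "v = q j * n * m" by (auto simp: homogeneous_progression_def)
          have "real v \<le> Y * real L * real M"
            unfolding m(2) of_nat_mult using D(1)[OF qD[OF j]] n m(1) Ypos by (intro mult_mono) auto
          also have "\<dots> \<le> X / (2 * \<kappa>)" by (rule YX)
          also have "\<dots> \<le> X / 1" using \<kappa> Xpos by (intro divide_left_mono) auto
          finally have "real v \<le> X" by simp
          moreover have "v \<ge> 1" using D(2)[OF qD[OF j]] n m by simp
          ultimately have "v \<in> initial_segment (N powr (1 / real k))"
            using Xpos unfolding X_def initial_segment_def by (simp add: le_nat_iff le_floor_iff)
          moreover have "real p \<le> N powr \<eta>" if p: "prime p" "p dvd v" for p
          proof (cases "p dvd q j")
            case True
            then show ?thesis using D(3)[OF qD[OF j] p(1)] by blast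
          next
            case False
            then have "p dvd n * m" using p by (simp add: m(2) mult.assoc prime_dvd_mult_iff)
            then have "p \<le> n * m" using n m by (intro dvd_imp_le) auto
            also have "\<dots> \<le> L * M" using n m by (intro mult_mono) auto
            finally have "real p \<le> real (L * M)" by (rule of_nat_mono)
            then show ?thesis using LMN by simp
          qed
          ultimately show "v \<in> smooth_numbers (N powr (1 / real k)) (N powr \<eta>)" by (simp add: smooth_numbers_def)
        qed
        moreover have "q j * n \<ge> 1" using D(2)[OF qD[OF j]] n by simp
        ultimately have "B \<inter> homogeneous_progression (q j * n) M \<noteq> {}" using hom unfolding homogeneous_in_def by blast
        then show ?thesis by (auto simp: homogeneous_progression_def)
      qed
      then obtain m where m: "\<And>j. j \<in> {1..t} \<Longrightarrow> m j \<in> {1..M} \<and> q j * n * m j \<in> B" by metis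
      define m' where "m' = restrict m {1..t}"
      define y where "y = (\<lambda>j\<in>{1..t}. q j * n * m j)"
      have m'J: "m' \<in> J" using m by (auto simp: m'_def J_def)
      have yB: "y \<in> {1..t} \<rightarrow>\<^sub>E B" using m by (auto simp: y_def)
      have "(\<Sum>j=1..t. \<mu> j * int (y j) ^ k) = z m' * int n ^ k"
        unfolding z_def sum_distrib_right by (intro sum.cong) (auto simp: y_def m'_def power_mult_distrib)
      then have "c * real n0 ^ (s - 1) \<le> r y" using big[OF m'J] by (simp add: r_def)
      moreover have "\<forall>j\<in>{1..t}. y j = q j * n * m' j" by (simp add: y_def m'_def)
      ultimately show ?thesis using n m'J yB by blast
    qed
    then obtain fn fm fy where f: "\<And>q. q \<in> Q \<Longrightarrow> fn q \<in> {1..L} \<and> fm q \<in> J \<and> fy q \<in> {1..t} \<rightarrow>\<^sub>E B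
        \<and> (\<forall>j\<in>{1..t}. fy q j = q j * fn q * fm q j) \<and> c * real n0 ^ (s - 1) \<le> r (fy q)" by metis
    \<comment> \<open>Given \<open>y\<close>, \<open>n\<close> and the multipliers, each q_j is
      found by division, so a tuple \<open>y\<close> comes from at most L M^t tuples
      \<open>q\<close>.\<close>
    have "card Q \<le> card (fy ` Q \<times> {1..L} \<times> J)"
    proof (rule card_inj_on_le[of "\<lambda>q. (fy q, fn q, fm q)"])
      show "inj_on (\<lambda>q. (fy q, fn q, fm q)) Q"
      proof (rule inj_onI)
        fix q q' assume q: "q \<in> Q" "q' \<in> Q" and eq: "(fy q, fn q, fm q) = (fy q', fn q', fm q')"
        show "q = q'"
        proof (rule PiE_ext[where k="{1..t}"])
          fix j assume j: "j \<in> {1..t}"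
          have eqs: "fy q = fy q'" "fn q = fn q'" "fm q = fm q'" using eq by auto
          have "fy q j = q j * fn q * fm q j" "fy q' j = q' j * fn q' * fm q' j" using f[OF q(1)] f[OF q(2)] j by blast+
          then have "q j * (fn q * fm q j) = q' j * (fn q * fm q j)" unfolding eqs mult.assoc by (rule trans[OF sym])
          moreover have "fn q \<in> {1..L}" "fm q j \<in> {1..M}" using f[OF q(1)] j unfolding J_def by blast+
          then have "fn q * fm q j > 0" by simp
          ultimately show "q j = q' j" by simp
        qed (use q in \<open>auto simp: Q_def\<close>)
      qed
      show "(\<lambda>q. (fy q, fn q, fm q)) ` Q \<subseteq> fy ` Q \<times> {1..L} \<times> J" using f by auto
      show "finite (fy ` Q \<times> {1..L} \<times> J)" using finQ finJ by auto
    qed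
    also have "\<dots> = card (fy ` Q) * (L * M ^ t)" by (simp add: card_cartesian_product cardJ)
    finally have "real (card Q) \<le> real (card (fy ` Q) * (L * M ^ t))" by (rule of_nat_mono)
    then have "(c1 * Y) ^ t \<le> real (card (fy ` Q)) * real (L * M ^ t)" using cQ unfolding of_nat_mult by linarith
    then have cY: "(c1 * Y) ^ t / real (L * M ^ t) \<le> real (card (fy ` Q))" using L M by (subst pos_divide_le_eq) auto
    define Xs where "Xs y = {x \<in> {1..s} \<rightarrow>\<^sub>E A. (\<Sum>i=1..s. l i * int (x i)) = (\<Sum>j=1..t. \<mu> j * int (y j) ^ k)}" for y :: "nat \<Rightarrow> nat"
    have finA: "finite A" using A0 finite_subset by blast
    have finXs: "finite (Xs y)" for y
      unfolding Xs_def using finA by (intro finite_subset[OF _ finite_PiE[of "{1..s}" "\<lambda>_. A"]]) auto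
    have "card (SIGMA y:fy ` Q. Xs y) \<le> card (solutions k s t l \<mu> A B)"
    proof (rule card_inj_on_le[of prod.swap, OF _ _ fin])
      show "prod.swap ` (SIGMA y:fy ` Q. Xs y) \<subseteq> solutions k s t l \<mu> A B"
      proof (rule image_subsetI)
        fix p assume "p \<in> (SIGMA y:fy ` Q. Xs y)"
        then obtain q x where q: "q \<in> Q" and p: "p = (fy q, x)" and x: "x \<in> Xs (fy q)" by blast
        have "fy q \<in> {1..t} \<rightarrow>\<^sub>E B" using f[OF q] by blast
        then show "prod.swap p \<in> solutions k s t l \<mu> A B" using x by (simp add: p solutions_def Xs_def)
      qed
    qed (auto simp: inj_on_def)
    then have "real (card (SIGMA y:fy ` Q. Xs y)) \<le> real (card (solutions k s t l \<mu> A B))" by (rule of_nat_mono)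
    moreover have "real (card (SIGMA y:fy ` Q. Xs y)) = (\<Sum>y\<in>fy ` Q. r y)"
      using finQ finXs by (subst card_SigmaI) (auto simp: r_def Xs_def)
    moreover have "(\<Sum>y\<in>fy ` Q. c * real n0 ^ (s - 1)) \<le> (\<Sum>y\<in>fy ` Q. r y)" 
    proof (rule sum_mono)
      fix y assume "y \<in> fy ` Q"
      then obtain q where "q \<in> Q" "y = fy q" by blast
      then show "c * real n0 ^ (s - 1) \<le> r y" using f by blast
    qed
    ultimately have total: "real (card (fy ` Q)) * (c * real n0 ^ (s - 1)) \<le> real (card (solutions k s t l \<mu> A B))" by simp
    have "c0 * N powr (real s + real t / real k - 1) = (c1 * Y) ^ t / real (L * M ^ t) * (c * (N / 2) ^ (s - 1))"
    proof -
      have "N powr (real s + real t / real k - 1) = N powr (real t / real k) * N powr (real (s - 1))"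
      proof -
        have "real s + real t / real k - 1 = real t / real k + real (s - 1)" using s by simp
        then show ?thesis by (simp only: powr_add)
      qed
      also have "N powr (real (s - 1)) = N ^ (s - 1)" using N1 by (intro powr_realpow) simp
      also have "N powr (real t / real k) = X ^ t" using N1 by (simp add: X_def powr_power)
      finally show ?thesis by (simp add: c0_def Y_def power_mult_distrib power_divide mult_ac)
    qed
    also have "\<dots> \<le> real (card (fy ` Q)) * (c * real n0 ^ (s - 1))"
      using cY c n0 N1 by (intro mult_mono mult_left_mono power_mono) auto
    also note total
    finally show ?thesis by (simp add: at_least_many_def)
  qed
  have "N0 \<ge> 1"
  proof -
    have "max 1 (Y0 / \<rho>) ^ k \<ge> 0" "(real (L * M)) powr (1 / \<eta>) \<ge> 0" by auto
    then have "1 + max 1 (Y0 / \<rho>) ^ k + (real (L * M)) powr (1 / \<eta>) \<ge> 1" by linarith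
    then show ?thesis unfolding N0_def by linarith
  qed
  then show "\<exists>(N\<^sub>0::nat) (c\<^sub>0::real). N\<^sub>0 \<ge> 1 \<and> c\<^sub>0 > 0 \<and>
      (\<forall>(N::real) (A::nat set) (B::nat set).
         N \<ge> real N\<^sub>0 \<longrightarrow>
         A \<subseteq> initial_segment N \<longrightarrow> real (card A) \<ge> \<delta> * N \<longrightarrow>
         0 \<notin> B \<longrightarrow>
         homogeneous_in M (smooth_numbers (N powr (1 / real k)) (N powr \<eta>)) B \<longrightarrow>
         at_least_many (c\<^sub>0 * N powr (real s + real t / real k - 1))
           (solutions k s t l \<mu> A B))"
    using main c0 by (intro exI[of _ N0] exI[of _ c0]) blast
qed

end
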